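(* Let $a$ satisfy the standing assumptions (i)-(iii) of the context and let $C_a=\frac1{a(1)}\min\{4,\frac1{2-\mu_a}\}$. Then the degenerate wave equation is observable in time $T$ (via the normal derivative at $x=1$) provided that $$T>T_a:=\frac1{2-\mu_a}\Big(\frac4{\min\{1,a(1)\}}+2\,\mu_a\sqrt{C_a}\Big).$$ In this case $$C_T\geqslant\frac1{a(1)}\Big\{(2-\mu_a)T-\frac4{\min\{1,a(1)\}}-2\,\mu_a\sqrt{C_a}\Big\},$$ where $C_T$ is the supremum of all observability constants in time $T$.
   Context: Standing assumptions on $a$: $a\in C([0,1])\cap C^1(]0,1])$ and (i) $a(x)>0$ for all $x\in]0,1]$, $a(0)=0$; (ii) $\mu_a:=\sup_{0<x\leqslant 1}\frac{x|a'(x)|}{a(x)}<2$; (iii) $a\in C^{[\mu_a]}([0,1])$, where $[\cdot]$ is the integer part (so $a\in C^1([0,1])$ if $\mu_a\in[1,2[$, no extra condition if $\mu_a\in[0,1[$). Spaces: $V^1_a(0,1)$ is the space of $u\in L^2(0,1)$ that are locally absolutely continuous in $]0,1]$ with $\sqrt a\,u'\in L^2(0,1)$, with norm $\|u\|_{1,a}=\{\int_0^1(a|u'|^2+|u|^2)dx\}^{1/2}$ (functions in $V^1_a(0,1)$ are continuous up to $x=0$ when $\mu_a\in[0,1[$). $H^1_a(0,1)$ is the closed subspace of those $u\in V^1_a(0,1)$ with $u(1)=0$ and, when $\mu_a\in[0,1[$, also $u(0)=0$. $V^2_a(0,1)=\{u\in V^1_a(0,1): au'\in H^1(0,1)\}$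 and $H^2_a(0,1)=V^2_a(0,1)\cap H^1_a(0,1)$. Problem: $u_{tt}-(a(x)u_x)_x=0$ in $]0,\infty[\times]0,1[$, with $u(t,1)=0$, and $u(t,0)=0$ if $\mu_a\in[0,1[$, $\lim_{x\downarrow0}a(x)u_x(t,x)=0$ if $\mu_a\in[1,2[$, and $u(0,\cdot)=u_0$, $u_t(0,\cdot)=u_1$. Solutions: on the Hilbert space $H^1_a(0,1)\times L^2(0,1)$ with scalar product $\langle(u,v),(\tilde u,\tilde v)\rangle=\int_0^1(v\tilde v+au'\tilde u')dx$, the operator $A(u,v)=(v,(au')')$ with $D(A)=H^2_a(0,1)\times H^1_a(0,1)$ is maximal dissipative and generates a contraction semigroup $e^{tA}$. The mild solution is the first component of $e^{tA}(u_0,u_1)$, its second component being $u_t$; it is called classical if $(u_0,u_1)\in D(A)$. For mild solutions, $u_x(\cdot,1)\in L^2(0,T)$ is defined as the $L^2(0,T)$-limit of $u^n_x(\cdot,1)$, where $u^n$ are classical solutions with data in $D(A)$ converging to $(u_0,u_1)$ in $H^1_a(0,1)\times L^2(0,1)$ (this limit exists and is independent of the approximation). Energy: $E_u(t)=\frac12\int_0^1\{u_t^2(t,x)+a(x)u_x^2(t,x)\}dx$. Observability: the equation is observable in time $T>0$ if there is a constant $C>0$ such that for every $(u_0,u_1)\in H^1_a(0,1)\times L^2(0,1)$ the mild solution satisfies $\int_0^Tu_x^2(t,1)\,dt\geqslant C\,E_u(0)$; any such $C$ is called an observability constant in time $T$. Equivalently, $C_T=\inf_{(u_0,u_1)\neq(0,0)}\int_0^Tu_x^2(t,1)dt\,/\,E_u(0)>0$.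 *)

theory Defs
  imports "HOL-Analysis.Analysis"
begin

text \<open>
  Functions on (0,1) are represented by functions of type \<^typ>\<open>real \<Rightarrow> real\<close>, whose values
  outside the interval are irrelevant. Elements of Lebesgue spaces are representatives, so
  equality between them is equality almost everywhere.
\<close>

section \<open>The coefficient\<close>

text \<open>One-sided at end points of the interval, so that it also gives derivatives at 1.\<close>

definition deriv_on :: "real set \<Rightarrow> (real \<Rightarrow> real) \<Rightarrow> real \<Rightarrow> real" where
  "deriv_on J f x = vector_derivative f (at x within J)"

definition C1_on :: "real set \<Rightarrow> (real \<Rightarrow> real) \<Rightarrow> bool" where
  "C1_on J f \<longleftrightarrow> f differentiable_on J \<and> continuous_on J (deriv_on J f)"

definition log_slope :: "(real \<Rightarrow> real) \<Rightarrow> real \<Rightarrow> real" where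
  "log_slope a x = x * \<bar>deriv_on {0<..1} a x\<bar> / a x"

definition mu :: "(real \<Rightarrow> real) \<Rightarrow> real" where
  "mu a = (SUP x\<in>{0<..1}. log_slope a x)"

text \<open>Boundedness of \<^const>\<open>log_slope\<close> is part of the condition that its supremum is below 2,
  because suprema of unbounded sets of reals are unspecified. As the supremum lies in [0,2),
  its integer part is 0 or 1; in the first case C^[mu] is plain continuity.\<close>

definition degenerate_coefficient :: "(real \<Rightarrow> real) \<Rightarrow> bool" where
  "degenerate_coefficient a \<longleftrightarrow>
     continuous_on {0..1} a \<and> C1_on {0<..1} a \<and>
     (\<forall>x\<in>{0<..1}. a x > 0) \<and> a 0 = 0 \<and>
     bdd_above (log_slope a ` {0<..1}) \<and> mu a < 2 \<and>
     (1 \<le> mu a \<longrightarrow> C1_on {0..1} a)"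

section \<open>Function spaces\<close>

definition L2 :: "real \<Rightarrow> (real \<Rightarrow> real) set" where
  "L2 b = {f. f \<in> borel_measurable (lebesgue_on {0<..<b}) \<and>
              integrable (lebesgue_on {0<..<b}) (\<lambda>x. (f x)\<^sup>2)}"

definition eq_ae :: "(real \<Rightarrow> real) \<Rightarrow> (real \<Rightarrow> real) \<Rightarrow> bool" where
  "eq_ae f g \<longleftrightarrow> (AE x in lebesgue_on {0<..<1}. f x = g x)"

text \<open>In the following definition, P is a finite family of non-overlapping intervals [x,y].\<close>

definition abs_cont_on :: "real set \<Rightarrow> (real \<Rightarrow> real) \<Rightarrow> bool" where
  "abs_cont_on J f \<longleftrightarrow>
     (\<forall>e>0. \<exists>d>0. \<forall>P. finite P \<and> (\<forall>(x, y)\<in>P. x \<le> y \<and> {x..y} \<subseteq> J) \<and>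
        pairwise (\<lambda>p q. {fst p<..<snd p} \<inter> {fst q<..<snd q} = {}) P \<and>
        (\<Sum>(x, y)\<in>P. y - x) < d \<longrightarrow> (\<Sum>(x, y)\<in>P. \<bar>f y - f x\<bar>) < e)"

definition loc_abs_cont :: "(real \<Rightarrow> real) \<Rightarrow> bool" where
  "loc_abs_cont u \<longleftrightarrow> (\<forall>c\<in>{0<..1}. abs_cont_on {c..1} u)"

definition H1 :: "(real \<Rightarrow> real) set" where
  "H1 = {f. \<exists>h. abs_cont_on {0..1} h \<and> deriv h \<in> L2 1 \<and> eq_ae f h}"

definition V1 :: "(real \<Rightarrow> real) \<Rightarrow> (real \<Rightarrow> real) set" where
  "V1 a = {u \<in> L2 1. loc_abs_cont u \<and> (\<lambda>x. sqrt (a x) * deriv u x) \<in> L2 1}"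

text \<open>The boundary value at 0 is that of the continuous extension of u from (0,1].\<close>

definition H1a :: "(real \<Rightarrow> real) \<Rightarrow> (real \<Rightarrow> real) set" where
  "H1a a = {u \<in> V1 a. u 1 = 0 \<and> (mu a < 1 \<longrightarrow> (u \<longlongrightarrow> 0) (at_right 0))}"

definition V2 :: "(real \<Rightarrow> real) \<Rightarrow> (real \<Rightarrow> real) set" where
  "V2 a = {u \<in> V1 a. (\<lambda>x. a x * deriv u x) \<in> H1}"

definition H2a :: "(real \<Rightarrow> real) \<Rightarrow> (real \<Rightarrow> real) set" where
  "H2a a = V2 a \<inter> H1a a"

section \<open>The semigroup\<close>

type_synonym state = "(real \<Rightarrow> real) \<times> (real \<Rightarrow> real)"

definition state_space :: "(real \<Rightarrow> real) \<Rightarrow> state set" where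
  "state_space a = H1a a \<times> L2 1"

definition state_eq :: "state \<Rightarrow> state \<Rightarrow> bool" where
  "state_eq U V \<longleftrightarrow> eq_ae (fst U) (fst V) \<and> eq_ae (snd U) (snd V)"

definition lincomb :: "real \<Rightarrow> state \<Rightarrow> real \<Rightarrow> state \<Rightarrow> state" where
  "lincomb c U d V = (\<lambda>x. c * fst U x + d * fst V x, \<lambda>x. c * snd U x + d * snd V x)"

definition state_inner :: "(real \<Rightarrow> real) \<Rightarrow> state \<Rightarrow> state \<Rightarrow> real" where
  "state_inner a U V = (LINT x|lebesgue_on {0<..<1}.
     snd U x * snd V x + a x * deriv (fst U) x * deriv (fst V) x)"

definition state_norm :: "(real \<Rightarrow> real) \<Rightarrow> state \<Rightarrow> real" where
  "state_norm a U = sqrt (state_inner a U U)"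

definition state_dist :: "(real \<Rightarrow> real) \<Rightarrow> state \<Rightarrow> state \<Rightarrow> real" where
  "state_dist a U V = state_norm a (lincomb 1 U (-1) V)"

definition wave_dom :: "(real \<Rightarrow> real) \<Rightarrow> state set" where
  "wave_dom a = H2a a \<times> H1a a"

definition wave_op :: "(real \<Rightarrow> real) \<Rightarrow> state \<Rightarrow> state" where
  "wave_op a U = (snd U, deriv (\<lambda>x. a x * deriv (fst U) x))"

text \<open>The graph of the operator, closed under almost-everywhere equality of representatives.\<close>

definition wave_graph :: "(real \<Rightarrow> real) \<Rightarrow> (state \<times> state) set" where
  "wave_graph a = {(U, F). U \<in> state_space a \<and> F \<in> state_space a \<and>
     (\<exists>W\<in>wave_dom a. state_eq U W \<and> state_eq F (wave_op a W))}"

definition contraction_semigroup :: "(real \<Rightarrow> real) \<Rightarrow> (real \<Rightarrow> state \<Rightarrow> state) \<Rightarrow> bool" where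
  "contraction_semigroup a S \<longleftrightarrow>
     (\<forall>t\<ge>0. \<forall>U\<in>state_space a. S t U \<in> state_space a) \<and>
     (\<forall>t\<ge>0. \<forall>U\<in>state_space a. \<forall>V\<in>state_space a. \<forall>c d.
        state_eq (S t (lincomb c U d V)) (lincomb c (S t U) d (S t V))) \<and>
     (\<forall>t\<ge>0. \<forall>U\<in>state_space a. state_norm a (S t U) \<le> state_norm a U) \<and>
     (\<forall>U\<in>state_space a. state_eq (S 0 U) U) \<and>
     (\<forall>s\<ge>0. \<forall>t\<ge>0. \<forall>U\<in>state_space a. state_eq (S (s + t) U) (S s (S t U))) \<and>
     (\<forall>U\<in>state_space a. ((\<lambda>t. state_dist a (S t U) U) \<longlongrightarrow> 0) (at_right 0))"

definition generator_graph ::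
    "(real \<Rightarrow> real) \<Rightarrow> (real \<Rightarrow> state \<Rightarrow> state) \<Rightarrow> (state \<times> state) set" where
  "generator_graph a S = {(U, F). U \<in> state_space a \<and> F \<in> state_space a \<and>
     ((\<lambda>h. state_dist a (lincomb (1/h) (S h U) (-(1/h)) U) F) \<longlongrightarrow> 0) (at_right 0)}"

text \<open>This determines S t U up to almost-everywhere equality, for nonnegative t and U in the
  state space: a strongly continuous semigroup is determined by its generator.\<close>

definition wave_semigroup :: "(real \<Rightarrow> real) \<Rightarrow> (real \<Rightarrow> state \<Rightarrow> state) \<Rightarrow> bool" where
  "wave_semigroup a S \<longleftrightarrow> contraction_semigroup a S \<and> generator_graph a S = wave_graph a"

section \<open>Observability\<close>

text \<open>The mild solution with data U is u(t) = fst (S t U), with time derivative snd (S t U).\<close>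

definition energy :: "(real \<Rightarrow> real) \<Rightarrow> (real \<Rightarrow> state \<Rightarrow> state) \<Rightarrow> state \<Rightarrow> real \<Rightarrow> real" where
  "energy a S U t = 1/2 * (LINT x|lebesgue_on {0<..<1}.
     (snd (S t U) x)\<^sup>2 + a x * (deriv (fst (S t U)) x)\<^sup>2)"

definition classical_trace :: "(real \<Rightarrow> state \<Rightarrow> state) \<Rightarrow> state \<Rightarrow> real \<Rightarrow> real" where
  "classical_trace S U t = deriv_on {0<..1} (fst (S t U)) 1"

definition is_normal_trace ::
    "(real \<Rightarrow> real) \<Rightarrow> (real \<Rightarrow> state \<Rightarrow> state) \<Rightarrow> real \<Rightarrow> state \<Rightarrow> (real \<Rightarrow> real) \<Rightarrow> bool" where
  "is_normal_trace a S T U g \<longleftrightarrow> g \<in> L2 T \<and>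
     (\<forall>W :: nat \<Rightarrow> state.
        (\<forall>n. W n \<in> wave_dom a) \<and> (\<lambda>n. state_dist a (W n) U) \<longlonglongrightarrow> 0 \<longrightarrow>
        (\<forall>n. classical_trace S (W n) \<in> L2 T) \<and>
        (\<lambda>n. LINT t|lebesgue_on {0<..<T}. (classical_trace S (W n) t - g t)\<^sup>2) \<longlonglongrightarrow> 0)"

definition normal_trace ::
    "(real \<Rightarrow> real) \<Rightarrow> (real \<Rightarrow> state \<Rightarrow> state) \<Rightarrow> real \<Rightarrow> state \<Rightarrow> real \<Rightarrow> real" where
  "normal_trace a S T U = (SOME g. is_normal_trace a S T U g)"

definition observability_constant ::
    "(real \<Rightarrow> real) \<Rightarrow> (real \<Rightarrow> state \<Rightarrow> state) \<Rightarrow> real \<Rightarrow> real \<Rightarrow> bool" where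
  "observability_constant a S T C \<longleftrightarrow> C > 0 \<and>
     (\<forall>U\<in>state_space a.
        (LINT t|lebesgue_on {0<..<T}. (normal_trace a S T U t)\<^sup>2) \<ge> C * energy a S U 0)"

definition observable :: "(real \<Rightarrow> real) \<Rightarrow> (real \<Rightarrow> state \<Rightarrow> state) \<Rightarrow> real \<Rightarrow> bool" where
  "observable a S T \<longleftrightarrow> T > 0 \<and> (\<exists>C. observability_constant a S T C)"

definition best_constant :: "(real \<Rightarrow> real) \<Rightarrow> (real \<Rightarrow> state \<Rightarrow> state) \<Rightarrow> real \<Rightarrow> ereal" where
  "best_constant a S T = (SUP C\<in>{C. observability_constant a S T C}. ereal C)"

definition poincare_const :: "(real \<Rightarrow> real) \<Rightarrow> real" where
  "poincare_const a = 1 / a 1 * min 4 (1 / (2 - mu a))"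

definition observability_time :: "(real \<Rightarrow> real) \<Rightarrow> real" where
  "observability_time a =
     1 / (2 - mu a) * (4 / min 1 (a 1) + 2 * mu a * sqrt (poincare_const a))"

end

theory Submission
  imports Defs
begin

text \<open>
  For a classical solution, differentiating
  \<open>\<integral> (x u\<^sub>x + (\<mu>/4) u) u\<^sub>t dx\<close> in time and integrating by parts in space gives
  \<open>a(1) u\<^sub>x(t,1)\<^sup>2 / 2\<close> minus a quadratic form in \<open>(\<surd>a u\<^sub>x, u\<^sub>t)\<close>, which is at least
  \<open>1 - \<mu>/2\<close> times the energy because \<open>x |a'| \<le> \<mu> a\<close>. The energy is conserved, so
  integrating over \<open>(0,T)\<close> leaves only two boundary terms in time, controlled by
  \<open>a(x) \<ge> a(1) x\<^sup>2\<close> and a Poincare inequality. The boundary terms at \<open>x = 0\<close> vanish because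
  they have limits whose quotients by \<open>x\<close> are integrable. The bound passes to mild solutions by
  density of the domain; the same identity, read as an upper bound, shows that the normal
  trace exists as a limit in L2.

  Elements of the function spaces are only absolutely continuous, so the calculus rests on
  Lebesgue's theorem: an absolutely continuous function is a difference of two monotone ones, each
  is the distribution function of a measure with a density (Radon-Nikodym), and indefinite
  integrals are differentiable almost everywhere.
\<close>

section \<open>Absolutely continuous functions\<close>

text \<open>The semigroup is given only through the graph of its generator, on representatives: for
  \<open>W\<close> in the domain, \<open>S t W\<close> need not lie in \<open>wave_dom a\<close>, it
  only agrees almost everywhere with some \<open>Z\<close> that does. Integrations by parts are
  therefore done on \<open>Z\<close> and carried back because bounded bilinear forms cannot separate
  \<open>state_eq\<close> states. The factor \<open>mu a / 4\<close> in the multiplier is the one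
  for which kinetic and potential energy get the same lower coefficient
  \<open>1 / 2 - mu a / 4\<close>. The Neumann condition at 0 for \<open>mu a \<ge> 1\<close> is not
  written into \<open>H2a\<close>; it follows from finite energy and \<open>a x \<le> B * x\<close>,
  which is where differentiability of \<open>a\<close> up to 0 enters. The final constant arises as
  \<open>(2 - mu a) * T - 4 * boundary_const\<close>: one factor 2 comes from \<open>a 1 / 2\<close>
  in the trace identity, the other from the energy being half the squared norm.\<close>

definition nonoverlapping :: "real set \<Rightarrow> (real \<times> real) set \<Rightarrow> bool" where
  "nonoverlapping J P \<longleftrightarrow> finite P \<and> (\<forall>(x, y)\<in>P. x < y \<and> {x..y} \<subseteq> J) \<and>
     pairwise (\<lambda>p q. snd p \<le> fst q \<or> snd q \<le> fst p) P"

definition increments :: "(real \<Rightarrow> real) \<Rightarrow> (real \<times> real) set \<Rightarrow> real" where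
  "increments f P = (\<Sum>(x, y)\<in>P. \<bar>f y - f x\<bar>)"

lemma nonoverlapping_empty [simp]: "nonoverlapping J {}"
  by (auto simp: nonoverlapping_def)

lemma nonoverlapping_singleton: "x < y \<Longrightarrow> {x..y} \<subseteq> J \<Longrightarrow> nonoverlapping J {(x, y)}"
  by (auto simp: nonoverlapping_def pairwise_def)

lemma nonoverlapping_finite: "nonoverlapping J P \<Longrightarrow> finite P"
  by (auto simp: nonoverlapping_def)

lemma nonoverlapping_mono: "nonoverlapping J P \<Longrightarrow> J \<subseteq> K \<Longrightarrow> nonoverlapping K P"
  unfolding nonoverlapping_def by (intro conjI; elim conjE) (assumption, blast, assumption)

lemma increments_insert:
  "finite P \<Longrightarrow> (x, y) \<notin> P \<Longrightarrow> increments f (insert (x, y) P) = \<bar>f y - f x\<bar> + increments f P"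
  by (simp add: increments_def)

text \<open>\<open>nonoverlapping\<close> excludes degenerate intervals and states disjointness as
  an order condition, the form used when families are cut, extended or merged. This lemma and the
  next translate to and from \<open>abs_cont_on\<close>.\<close>

lemma abs_cont_onD:
  assumes "abs_cont_on J f" "e > 0"
  obtains d where "d > 0"
    "\<And>P. nonoverlapping J P \<Longrightarrow> (\<Sum>(x, y)\<in>P. y - x) < d \<Longrightarrow> increments f P < e"
proof -
  from assms(1)[unfolded abs_cont_on_def, rule_format, OF assms(2)]
  obtain d where d: "d > 0 \<and> (\<forall>P. finite P \<and> (\<forall>(x, y)\<in>P. x \<le> y \<and> {x..y} \<subseteq> J) \<and>
        pairwise (\<lambda>p q. {fst p<..<snd p} \<inter> {fst q<..<snd q} = {}) P \<and>
        (\<Sum>(x, y)\<in>P. y - x) < d \<longrightarrow> (\<Sum>(x, y)\<in>P. \<bar>f y - f x\<bar>) < e)" ..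
  show thesis
  proof (rule that[OF conjunct1[OF d]])
    fix P assume P: "nonoverlapping J P" "(\<Sum>(x, y)\<in>P. y - x) < d"
    then have "\<forall>(x, y)\<in>P. x \<le> y \<and> {x..y} \<subseteq> J"
      unfolding nonoverlapping_def by (blast intro: less_imp_le)
    moreover have "pairwise (\<lambda>p q. {fst p<..<snd p} \<inter> {fst q<..<snd q} = {}) P"
      using P(1) unfolding nonoverlapping_def by (auto elim!: pairwise_mono)
    ultimately show "increments f P < e"
      using P unfolding increments_def
      by (intro conjunct2[OF d, rule_format] conjI nonoverlapping_finite)
  qed
qed

lemma abs_cont_onI:
  assumes "\<And>e. e > 0 \<Longrightarrow> \<exists>d>0. \<forall>P. nonoverlapping J P \<longrightarrow> (\<Sum>(x, y)\<in>P. y - x) < d \<longrightarrow> increments f P < e"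
  shows "abs_cont_on J f"
  unfolding abs_cont_on_def
proof (intro allI impI)
  fix e :: real assume "e > 0"
  from assms[OF this] obtain d where
    d: "d > 0 \<and> (\<forall>P. nonoverlapping J P \<longrightarrow> (\<Sum>(x, y)\<in>P. y - x) < d \<longrightarrow> increments f P < e)" ..
  show "\<exists>d>0. \<forall>P. finite P \<and> (\<forall>(x, y)\<in>P. x \<le> y \<and> {x..y} \<subseteq> J) \<and>
        pairwise (\<lambda>p q. {fst p<..<snd p} \<inter> {fst q<..<snd q} = {}) P \<and>
        (\<Sum>(x, y)\<in>P. y - x) < d \<longrightarrow> (\<Sum>(x, y)\<in>P. \<bar>f y - f x\<bar>) < e"
  proof (intro exI[of _ d] conjI allI impI conjunct1[OF d])
    fix P assume P: "finite P \<and> (\<forall>(x, y)\<in>P. x \<le> y \<and> {x..y} \<subseteq> J) \<and>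
        pairwise (\<lambda>p q. {fst p<..<snd p} \<inter> {fst q<..<snd q} = {}) P \<and>
        (\<Sum>(x, y)\<in>P. y - x) < d"
    \<comment> \<open>Degenerate intervals contribute nothing to either sum, and between
      nondegenerate ones disjoint interiors amount to being ordered.\<close>
    let ?Q = "{p\<in>P. fst p < snd p}"
    have *: "(\<Sum>(x, y)\<in>P. y - x) = (\<Sum>(x, y)\<in>?Q. y - x)"
      "(\<Sum>(x, y)\<in>P. \<bar>f y - f x\<bar>) = (\<Sum>(x, y)\<in>?Q. \<bar>f y - f x\<bar>)"
      using P by (intro sum.mono_neutral_right; fastforce simp del: Int_greaterThanLessThan simp: order_le_less)+
    have "snd p \<le> fst q \<or> snd q \<le> fst p" if "p \<in> ?Q" "q \<in> ?Q" "p \<noteq> q" for p q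
    proof -
      have "{fst p<..<snd p} \<inter> {fst q<..<snd q} = {}" using P that unfolding pairwise_def by blast
      then show ?thesis using that by (auto simp: min_def max_def split: if_splits)
    qed
    then have "nonoverlapping J ?Q"
      using P unfolding nonoverlapping_def by (auto intro!: pairwiseI)
    from conjunct2[OF d, rule_format, OF this] show "(\<Sum>(x, y)\<in>P. \<bar>f y - f x\<bar>) < e"
      using P * by (simp add: increments_def)
  qed
qed

lemma lipschitz_abs_cont_on:
  assumes "\<And>x y. x \<in> J \<Longrightarrow> y \<in> J \<Longrightarrow> x \<le> y \<Longrightarrow> \<bar>f y - f x\<bar> \<le> L * (y - x)"
  shows "abs_cont_on J f"
proof (rule abs_cont_onI)
  fix e :: real assume e: "e > 0"
  have L: "\<bar>L\<bar> + 1 > 0" using abs_ge_zero[of L] by linarith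
  show "\<exists>d>0. \<forall>P. nonoverlapping J P \<longrightarrow> (\<Sum>(x, y)\<in>P. y - x) < d \<longrightarrow> increments f P < e"
  proof (intro exI[of _ "e / (\<bar>L\<bar> + 1)"] conjI allI impI)
    fix P assume P: "nonoverlapping J P" "(\<Sum>(x, y)\<in>P. y - x) < e / (\<bar>L\<bar> + 1)"
    have "increments f P \<le> (\<Sum>(x, y)\<in>P. (\<bar>L\<bar> + 1) * (y - x))"
      unfolding increments_def
    proof (rule sum_mono, clarify)
      fix x y assume "(x, y) \<in> P"
      then have xy: "x < y" "x \<in> J" "y \<in> J" using P unfolding nonoverlapping_def by fastforce+
      then have "\<bar>f y - f x\<bar> \<le> L * (y - x)" by (intro assms) auto
      also have "\<dots> \<le> (\<bar>L\<bar> + 1) * (y - x)" using xy by (intro mult_right_mono) auto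
      finally show "\<bar>f y - f x\<bar> \<le> (\<bar>L\<bar> + 1) * (y - x)" .
    qed
    also have "\<dots> = (\<bar>L\<bar> + 1) * (\<Sum>(x, y)\<in>P. y - x)"
      by (simp add: sum_distrib_left case_prod_unfold)
    also have "\<dots> < e" using P(2) L by (simp add: pos_less_divide_eq mult.commute)
    finally show "increments f P < e" .
  qed (use e L in simp)
qed

lemma abs_cont_on_subset: "abs_cont_on J f \<Longrightarrow> K \<subseteq> J \<Longrightarrow> abs_cont_on K f"
proof (rule abs_cont_onI)
  fix e :: real assume f: "abs_cont_on J f" and "K \<subseteq> J" "e > 0"
  obtain d where d: "d > 0"
    "\<And>P. nonoverlapping J P \<Longrightarrow> (\<Sum>(x, y)\<in>P. y - x) < d \<Longrightarrow> increments f P < e"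
    using abs_cont_onD[OF f \<open>e > 0\<close>] by metis
  show "\<exists>d>0. \<forall>P. nonoverlapping K P \<longrightarrow> (\<Sum>(x, y)\<in>P. y - x) < d \<longrightarrow> increments f P < e"
  proof (intro exI[of _ d] conjI allI impI d(1))
    fix P assume "nonoverlapping K P" "(\<Sum>(x, y)\<in>P. y - x) < d"
    then show "increments f P < e" using d(2)[OF nonoverlapping_mono[OF _ \<open>K \<subseteq> J\<close>]] by simp
  qed
qed

lemma abs_cont_on_cong:
  assumes "abs_cont_on J f" "\<And>x. x \<in> J \<Longrightarrow> f x = g x"
  shows "abs_cont_on J g"
proof (rule abs_cont_onI)
  fix e :: real assume e: "e > 0"
  obtain d where d: "d > 0"
    "\<And>P. nonoverlapping J P \<Longrightarrow> (\<Sum>(x, y)\<in>P. y - x) < d \<Longrightarrow> increments f P < e"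
    using abs_cont_onD[OF assms(1) e] by metis
  have eq: "increments g P = increments f P" if "nonoverlapping J P" for P
    unfolding increments_def
  proof (intro sum.cong refl, clarify)
    fix x y assume "(x, y) \<in> P"
    then have "x \<in> J" "y \<in> J" using that unfolding nonoverlapping_def by fastforce+
    then show "\<bar>g y - g x\<bar> = \<bar>f y - f x\<bar>" by (simp add: assms)
  qed
  show "\<exists>d>0. \<forall>P. nonoverlapping J P \<longrightarrow> (\<Sum>(x, y)\<in>P. y - x) < d \<longrightarrow> increments g P < e"
  proof (intro exI[of _ d] conjI allI impI d(1))
    fix P assume "nonoverlapping J P" "(\<Sum>(x, y)\<in>P. y - x) < d"
    then show "increments g P < e" using d(2) eq by metis
  qed
qed

lemma abs_cont_on_continuous:
  assumes "abs_cont_on {c..d} f"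
  shows "continuous_on {c..d} f"
  unfolding continuous_on_iff
proof (intro ballI allI impI)
  fix x e :: real assume x: "x \<in> {c..d}" and e: "e > 0"
  obtain \<delta> where \<delta>: "\<delta> > 0"
    "\<And>P. nonoverlapping {c..d} P \<Longrightarrow> (\<Sum>(x, y)\<in>P. y - x) < \<delta> \<Longrightarrow> increments f P < e"
    using abs_cont_onD[OF assms e] by metis
  have *: "\<bar>f v - f u\<bar> < e" if "u \<in> {c..d}" "v \<in> {c..d}" "u < v" "v - u < \<delta>" for u v
    using \<delta>(2)[of "{(u, v)}"] that nonoverlapping_singleton[of u v "{c..d}"]
    by (auto simp: increments_def)
  have "dist (f x') (f x) < e" if "x' \<in> {c..d}" "dist x' x < \<delta>" for x'
    using *[of x x'] *[of x' x] x e that by (cases x x' rule: linorder_cases) (auto simp: dist_real_def)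
  then show "\<exists>d'>0. \<forall>x'\<in>{c..d}. dist x' x < d' \<longrightarrow> dist (f x') (f x) < e"
    using \<delta>(1) by auto
qed

lemma abs_cont_on_lincomb:
  assumes "abs_cont_on J f" "abs_cont_on J g"
  shows "abs_cont_on J (\<lambda>x. r * f x + s * g x)"
proof (rule abs_cont_onI)
  fix e :: real assume e: "e > 0"
  define m where "m = \<bar>r\<bar> + \<bar>s\<bar> + 1"
  have m: "m > 0" unfolding m_def by linarith
  obtain d1 where d1: "d1 > 0"
    "\<And>P. nonoverlapping J P \<Longrightarrow> (\<Sum>(x, y)\<in>P. y - x) < d1 \<Longrightarrow> increments f P < e / m"
    using abs_cont_onD[OF assms(1), of "e / m"] e m by auto
  obtain d2 where d2: "d2 > 0"
    "\<And>P. nonoverlapping J P \<Longrightarrow> (\<Sum>(x, y)\<in>P. y - x) < d2 \<Longrightarrow> increments g P < e / m"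
    using abs_cont_onD[OF assms(2), of "e / m"] e m by auto
  have less: "increments (\<lambda>x. r * f x + s * g x) P < e"
    if P: "nonoverlapping J P" "(\<Sum>(x, y)\<in>P. y - x) < min d1 d2" for P
  proof -
    have "increments (\<lambda>x. r * f x + s * g x) P \<le> (\<Sum>(x, y)\<in>P. \<bar>r\<bar> * \<bar>f y - f x\<bar> + \<bar>s\<bar> * \<bar>g y - g x\<bar>)"
      unfolding increments_def
    proof (rule sum_mono, clarify)
      fix x y
      have "\<bar>r * (f y - f x) + s * (g y - g x)\<bar> \<le> \<bar>r\<bar> * \<bar>f y - f x\<bar> + \<bar>s\<bar> * \<bar>g y - g x\<bar>"
        by (metis abs_mult abs_triangle_ineq)
      then show "\<bar>r * f y + s * g y - (r * f x + s * g x)\<bar> \<le> \<bar>r\<bar> * \<bar>f y - f x\<bar> + \<bar>s\<bar> * \<bar>g y - g x\<bar>"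
        by (simp add: algebra_simps)
    qed
    also have "\<dots> = \<bar>r\<bar> * increments f P + \<bar>s\<bar> * increments g P"
      by (simp add: increments_def sum.distrib sum_distrib_left case_prod_unfold)
    also have "\<dots> \<le> \<bar>r\<bar> * (e / m) + \<bar>s\<bar> * (e / m)"
      using d1(2)[OF P(1)] d2(2)[OF P(1)] P(2) by (intro add_mono mult_left_mono) auto
    also have "\<dots> < (\<bar>r\<bar> + \<bar>s\<bar> + 1) * (e / m)" using e m by (simp add: algebra_simps)
    also have "\<dots> = e" using m by (simp add: m_def[symmetric])
    finally show ?thesis .
  qed
  show "\<exists>d>0. \<forall>P. nonoverlapping J P \<longrightarrow> (\<Sum>(x, y)\<in>P. y - x) < d \<longrightarrow>
      increments (\<lambda>x. r * f x + s * g x) P < e"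
    by (intro exI[of _ "min d1 d2"] conjI allI impI less) (use d1(1) d2(1) in simp)
qed

lemma abs_cont_on_mult:
  assumes f: "abs_cont_on {c..d} f" and g: "abs_cont_on {c..d} g"
  shows "abs_cont_on {c..d} (\<lambda>x. f x * g x)"
proof (rule abs_cont_onI)
  fix e :: real assume e: "e > 0"
  have "compact (f ` {c..d})" "compact (g ` {c..d})"
    using f g by (auto intro!: compact_continuous_image abs_cont_on_continuous)
  then obtain A B where AB: "\<And>x. x \<in> {c..d} \<Longrightarrow> \<bar>f x\<bar> \<le> A" "\<And>x. x \<in> {c..d} \<Longrightarrow> \<bar>g x\<bar> \<le> B"
    by (metis compact_imp_bounded bounded_iff imageI real_norm_def)
  define m where "m = \<bar>A\<bar> + \<bar>B\<bar> + 1"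
  have m: "m > 0" unfolding m_def by linarith
  obtain d1 where d1: "d1 > 0"
    "\<And>P. nonoverlapping {c..d} P \<Longrightarrow> (\<Sum>(x, y)\<in>P. y - x) < d1 \<Longrightarrow> increments f P < e / m"
    using abs_cont_onD[OF assms(1), of "e / m"] e m by auto
  obtain d2 where d2: "d2 > 0"
    "\<And>P. nonoverlapping {c..d} P \<Longrightarrow> (\<Sum>(x, y)\<in>P. y - x) < d2 \<Longrightarrow> increments g P < e / m"
    using abs_cont_onD[OF assms(2), of "e / m"] e m by auto
  have less: "increments (\<lambda>x. f x * g x) P < e"
    if P: "nonoverlapping {c..d} P" "(\<Sum>(x, y)\<in>P. y - x) < min d1 d2" for P
  proof -
    have "increments (\<lambda>x. f x * g x) P \<le> (\<Sum>(x, y)\<in>P. \<bar>B\<bar> * \<bar>f y - f x\<bar> + \<bar>A\<bar> * \<bar>g y - g x\<bar>)"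
      unfolding increments_def
    proof (rule sum_mono, clarify)
      fix x y assume "(x, y) \<in> P"
      then have xy: "x \<in> {c..d}" "y \<in> {c..d}" using P unfolding nonoverlapping_def by fastforce+
      have "\<bar>f y * g y - f x * g x\<bar> = \<bar>g y * (f y - f x) + f x * (g y - g x)\<bar>"
        by (simp add: algebra_simps)
      also have "\<dots> \<le> \<bar>g y\<bar> * \<bar>f y - f x\<bar> + \<bar>f x\<bar> * \<bar>g y - g x\<bar>"
        by (metis abs_mult abs_triangle_ineq)
      also have "\<dots> \<le> \<bar>B\<bar> * \<bar>f y - f x\<bar> + \<bar>A\<bar> * \<bar>g y - g x\<bar>"
        using AB(1)[OF xy(1)] AB(2)[OF xy(2)] by (intro add_mono mult_right_mono) auto
      finally show "\<bar>f y * g y - f x * g x\<bar> \<le> \<bar>B\<bar> * \<bar>f y - f x\<bar> + \<bar>A\<bar> * \<bar>g y - g x\<bar>" .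
    qed
    also have "\<dots> = \<bar>B\<bar> * increments f P + \<bar>A\<bar> * increments g P"
      by (simp add: increments_def sum.distrib sum_distrib_left case_prod_unfold)
    also have "\<dots> \<le> \<bar>B\<bar> * (e / m) + \<bar>A\<bar> * (e / m)"
      using d1(2)[OF P(1)] d2(2)[OF P(1)] P(2) by (intro add_mono mult_left_mono) auto
    also have "\<dots> < (\<bar>A\<bar> + \<bar>B\<bar> + 1) * (e / m)" using e m by (simp add: algebra_simps)
    also have "\<dots> = e" using m by (simp add: m_def[symmetric])
    finally show ?thesis .
  qed
  show "\<exists>\<delta>>0. \<forall>P. nonoverlapping {c..d} P \<longrightarrow> (\<Sum>(x, y)\<in>P. y - x) < \<delta> \<longrightarrow>
      increments (\<lambda>x. f x * g x) P < e"
    by (intro exI[of _ "min d1 d2"] conjI allI impI less) (use d1(1) d2(1) in simp)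
qed

text \<open>Absolute continuity of \<open>F\<close> makes its Stieltjes measure absolutely
  continuous: a null set sits in an open set of small length, which is filled by countably many
  nonoverlapping intervals, and these have small total increment. Outside \<open>{c..d}\<close> the
  function is constant and the measure vanishes.\<close>

lemma mono_abs_cont_null_sets:
  fixes F :: "real \<Rightarrow> real"
  assumes cd: "c < d" and mono: "mono F" and cont: "continuous_on UNIV F"
    and low: "\<And>x. x \<le> c \<Longrightarrow> F x = F c" and high: "\<And>x. d \<le> x \<Longrightarrow> F x = F d"
    and ac: "abs_cont_on {c..d} F" and N: "N \<in> null_sets lborel"
  shows "emeasure (interval_measure F) N = 0"
proof -
  let ?M = "interval_measure F"
  have mF: "F x \<le> F y" if "x \<le> y" for x y using mono that by (auto simp: mono_def)
  have Icc: "emeasure ?M {x..y} = F y - F x" if "x \<le> y" for x y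
    using emeasure_interval_measure_Icc[OF that mF cont] .
  have Nb: "N \<in> sets borel" using N by auto
  have le: "emeasure ?M (N \<inter> {c..d}) \<le> ennreal e" if e: "e > 0" for e
  proof -
    obtain \<delta> where \<delta>: "\<delta> > 0"
      "\<And>P. nonoverlapping {c..d} P \<Longrightarrow> (\<Sum>(x, y)\<in>P. y - x) < \<delta> \<Longrightarrow> increments F P < e"
      using abs_cont_onD[OF ac e] by metis
    obtain U where U: "open U" "N \<subseteq> U" "emeasure lborel (U - N) < \<delta>"
      using outer_regular_lborel[OF Nb \<delta>(1)] by metis
    have UN: "emeasure lborel U < \<delta>"
      using U N by (metis emeasure_Diff_null_set sets_lborel borel_open)
    \<comment> \<open>This gauge forces every interval of the covering into \<open>U\<close>: each
      one carries a tag in \<open>N\<close>, and \<open>N\<close> lies inside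
      \<open>U\<close>.\<close>
    define g where "g = (\<lambda>x. if x \<in> U then U else UNIV)"
    have gg: "gauge g" using U(1) by (auto simp: gauge_def g_def)
    have cov: "N \<inter> {c..d} \<subseteq> cbox c d" "box c d \<noteq> {}" using cd by auto
    obtain D where D: "countable D" "\<Union>D \<subseteq> cbox c d"
      "\<And>K. K \<in> D \<Longrightarrow> interior K \<noteq> {} \<and> (\<exists>c d. K = cbox c d)"
      "pairwise (\<lambda>A B. interior A \<inter> interior B = {}) D"
      "\<And>K. K \<in> D \<Longrightarrow> \<exists>x\<in>(N \<inter> {c..d}) \<inter> K. K \<subseteq> g x"
      "\<And>u v. cbox u v \<in> D \<Longrightarrow> \<exists>n. \<forall>i\<in>Basis. v \<bullet> i - u \<bullet> i = (d \<bullet> i - c \<bullet> i) / 2 ^ n"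
      "N \<inter> {c..d} \<subseteq> \<Union>D"
      by (rule covering_lemma[OF cov gg], rule that)
    have DU: "K \<subseteq> U" if K: "K \<in> D" for K
    proof -
      obtain x where "x \<in> N" "K \<subseteq> g x" using D(5)[OF K] by blast
      then show ?thesis using U(2) by (auto simp: g_def split: if_splits)
    qed
    have Icc': "\<exists>x y. K = {x..y} \<and> x < y" if K: "K \<in> D" for K
    proof -
      obtain u v where "K = cbox u v" "interior K \<noteq> {}" using D(3)[OF K] by metis
      then have "K = {u..v} \<and> u < v" by (simp add: interior_cbox)
      then show ?thesis by blast
    qed
    define l where "l = (\<lambda>K::real set. Inf K)"
    define r where "r = (\<lambda>K::real set. Sup K)"
    have lr: "K = {l K..r K}" "l K < r K" if "K \<in> D" for K
      using Icc'[OF that] by (auto simp: l_def r_def)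
    \<comment> \<open>The lengths add up to at most the measure of \<open>U\<close>, hence to less
      than \<open>\<delta>\<close>; absolute continuity then bounds the sum of the increments of
      \<open>F\<close>, which are exactly the \<open>?M\<close> measures of the intervals.\<close>
    have fin: "(\<Sum>K\<in>D'. emeasure ?M K) \<le> ennreal e" if D': "D' \<subseteq> D" "finite D'" for D'
    proof -
      let ?P = "(\<lambda>K. (l K, r K)) ` D'"
      have inj: "inj_on (\<lambda>K. (l K, r K)) D'"
      proof (rule inj_onI)
        fix K L assume "K \<in> D'" "L \<in> D'" "(l K, r K) = (l L, r L)"
        then show "K = L" using lr(1)[of K] lr(1)[of L] D'(1) by auto
      qed
      have int: "interior K = {l K<..<r K}" if "K \<in> D" for K
        using lr[OF that] by (metis interior_atLeastAtMost_real)
      have P: "nonoverlapping {c..d} ?P"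
        unfolding nonoverlapping_def
      proof (intro conjI)
        show "\<forall>(x, y)\<in>?P. x < y \<and> {x..y} \<subseteq> {c..d}"
          using lr D(2) D'(1) by (fastforce simp: subset_iff)
        have "r K \<le> l L \<or> r L \<le> l K" if "K \<in> D'" "L \<in> D'" "K \<noteq> L" for K L
        proof -
          have KL: "K \<in> D" "L \<in> D" using that D'(1) by auto
          then have "{l K<..<r K} \<inter> {l L<..<r L} = {}"
            using D(4) int[OF KL(1)] int[OF KL(2)] that(3) unfolding pairwise_def by metis
          then show ?thesis using lr(2)[OF KL(1)] lr(2)[OF KL(2)]
            by (auto simp: min_def max_def split: if_splits)
        qed
        then show "pairwise (\<lambda>p q. snd p \<le> fst q \<or> snd q \<le> fst p) ?P"
          by (auto simp: pairwise_def)
      qed (use D' in auto)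
      have "(\<Sum>(x, y)\<in>?P. y - x) = (\<Sum>K\<in>D'. r K - l K)"
        by (simp add: sum.reindex[OF inj])
      also have "ennreal \<dots> = (\<Sum>K\<in>D'. emeasure lborel {l K<..<r K})"
        using lr D'(1) by (subst sum_ennreal[symmetric]) (auto intro!: sum.cong simp: less_imp_le subset_iff)
      also have "\<dots> = emeasure lborel (\<Union>K\<in>D'. {l K<..<r K})"
        using D(4) D' int
        by (intro sum_emeasure) (auto simp: disjoint_family_on_def pairwise_def subset_iff)
      also have "\<dots> \<le> emeasure lborel U"
        using DU lr D'(1) U(1) by (intro emeasure_mono) (auto simp: subset_iff, metis atLeastAtMost_iff less_imp_le)
      also have "\<dots> < \<delta>" by fact
      finally have "ennreal (\<Sum>(x, y)\<in>?P. y - x) < ennreal \<delta>" .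
      then have "(\<Sum>(x, y)\<in>?P. y - x) < \<delta>"
        by (metis ennreal_leI not_le)
      then have "increments F ?P < e" by (rule \<delta>(2)[OF P])
      moreover have "increments F ?P = (\<Sum>K\<in>D'. F (r K) - F (l K))"
        unfolding increments_def using lr D'(1) mF
        by (subst sum.reindex[OF inj]) (auto intro!: sum.cong simp: subset_iff less_imp_le)
      moreover have "ennreal (\<Sum>K\<in>D'. F (r K) - F (l K)) = (\<Sum>K\<in>D'. emeasure ?M K)"
      proof (subst sum_ennreal[symmetric])
        show "0 \<le> F (r K) - F (l K)" if "K \<in> D'" for K using mF lr(2) D'(1) that by (auto simp: less_imp_le)
        show "(\<Sum>K\<in>D'. ennreal (F (r K) - F (l K))) = (\<Sum>K\<in>D'. emeasure ?M K)"
          using Icc lr D'(1) by (intro sum.cong refl) (metis less_imp_le subsetD)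
      qed
      ultimately show ?thesis by (metis ennreal_leI less_imp_le)
    qed
    have Dm: "K \<in> sets borel" if "K \<in> D" for K
      using lr(1)[OF that] by (metis borel_closed closed_atLeastAtMost)
    show ?thesis
    proof (cases "D = {}")
      case True
      then show ?thesis using D(7) by auto
    next
      case False
      \<comment> \<open>Absolute continuity speaks of finite families only, so the countable
        covering is exhausted by finite unions and the bound passes to the limit by continuity from
        below.\<close>
      define A where "A = (\<lambda>n. \<Union>(from_nat_into D ` {..n}))"
      have fD: "from_nat_into D ` {..n} \<subseteq> D" for n using False by (auto intro: from_nat_into)
      have A: "A n \<in> sets ?M" for n
        unfolding A_def using fD Dm by (auto intro!: sets.finite_Union)
      have Ale: "emeasure ?M (A n) \<le> e" for n
      proof -
        have "emeasure ?M (A n) \<le> (\<Sum>K\<in>from_nat_into D ` {..n}. emeasure ?M K)"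
          using emeasure_subadditive_finite[of "from_nat_into D ` {..n}" "\<lambda>K. K" ?M] fD[of n] Dm
          by (auto simp: A_def)
        also have "\<dots> \<le> e" by (rule fin[OF fD]) auto
        finally show ?thesis .
      qed
      have "\<Union>D = (\<Union>n. A n)"
      proof
        show "\<Union>D \<subseteq> (\<Union>n. A n)"
        proof
          fix x assume "x \<in> \<Union>D"
          then obtain K where K: "K \<in> D" "x \<in> K" by blast
          then obtain n where "from_nat_into D n = K" using from_nat_into_surj[OF D(1)] by blast
          with K(2) have "x \<in> A n" unfolding A_def by blast
          then show "x \<in> (\<Union>n. A n)" by blast
        qed
        show "(\<Union>n. A n) \<subseteq> \<Union>D" unfolding A_def using fD by blast
      qed
      moreover have "incseq A" unfolding A_def incseq_def by (intro allI impI Union_mono image_mono) auto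
      ultimately have "emeasure ?M (\<Union>D) = (SUP n. emeasure ?M (A n))"
        using A by (subst SUP_emeasure_incseq) auto
      also have "\<dots> \<le> e" using Ale by (intro SUP_least) auto
      finally have "emeasure ?M (\<Union>D) \<le> e" .
      moreover have "emeasure ?M (N \<inter> {c..d}) \<le> emeasure ?M (\<Union>D)"
        using D Dm by (intro emeasure_mono) (auto intro!: sets.countable_Union)
      ultimately show ?thesis by (rule order_trans[rotated])
    qed
  qed
  have 1: "emeasure ?M (N \<inter> {c..d}) = 0"
    by (metis ennreal_le_epsilon le add.left_neutral le_zero_eq)
  have 2: "emeasure ?M (\<Union>n. {c - real n..c}) = 0"
  proof (rule emeasure_UN_eq_0)
    fix n :: nat show "emeasure ?M {c - real n..c} = 0" using Icc[of "c - real n" c] low[of "c - real n"] by simp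
  qed auto
  have 3: "emeasure ?M (\<Union>n. {d..d + real n}) = 0"
  proof (rule emeasure_UN_eq_0)
    fix n :: nat show "emeasure ?M {d..d + real n} = 0" using Icc[of d "d + real n"] high[of "d + real n"] by simp
  qed auto
  have "N \<subseteq> (N \<inter> {c..d}) \<union> (\<Union>n. {c - real n..c}) \<union> (\<Union>n. {d..d + real n})"
  proof
    fix x assume x: "x \<in> N"
    obtain n :: nat where "real n \<ge> max (c - x) (x - d)" by (meson real_arch_simple)
    then show "x \<in> (N \<inter> {c..d}) \<union> (\<Union>n. {c - real n..c}) \<union> (\<Union>n. {d..d + real n})"
      using x by (cases "x < c"; cases "x > d") (auto intro!: exI[of _ n])
  qed
  then have "emeasure ?M N \<le> emeasure ?M ((N \<inter> {c..d}) \<union> (\<Union>n. {c - real n..c}) \<union> (\<Union>n. {d..d + real n}))"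
    using Nb by (intro emeasure_mono) auto
  also have "\<dots> \<le> emeasure ?M ((N \<inter> {c..d}) \<union> (\<Union>n. {c - real n..c})) + emeasure ?M (\<Union>n. {d..d + real n})"
    using Nb by (intro emeasure_subadditive) auto
  also have "\<dots> \<le> emeasure ?M (N \<inter> {c..d}) + emeasure ?M (\<Union>n. {c - real n..c}) + emeasure ?M (\<Union>n. {d..d + real n})"
    using Nb by (intro add_right_mono emeasure_subadditive) auto
  finally show ?thesis by (simp add: 1 2 3)
qed

text \<open>Clamping the argument extends \<open>F\<close> to a monotone continuous function on the
  whole line; its Stieltjes measure has a density by the preceding lemma.\<close>

lemma mono_abs_cont_has_integral:
  fixes F :: "real \<Rightarrow> real"
  assumes cd: "c < d" and mono: "mono_on {c..d} F" and ac: "abs_cont_on {c..d} F"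
  obtains g where "\<And>x. 0 \<le> g x"
    "\<And>x y. c \<le> x \<Longrightarrow> x \<le> y \<Longrightarrow> y \<le> d \<Longrightarrow> (g has_integral F y - F x) {x..y}"
proof -
  define G where "G = (\<lambda>x. F (max c (min d x)))"
  have GF: "G x = F x" if "x \<in> {c..d}" for x using that by (auto simp: G_def)
  have mG: "mono G"
    using mono cd unfolding G_def mono_def mono_on_def by auto
  then have mG': "\<And>x y. x \<le> y \<Longrightarrow> G x \<le> G y" by (auto simp: mono_def)
  have cG: "continuous_on UNIV G"
    unfolding G_def using cd
    by (intro continuous_on_compose2[OF abs_cont_on_continuous[OF ac]] continuous_intros) auto
  have acG: "abs_cont_on {c..d} G" by (rule abs_cont_on_cong[OF ac]) (simp add: GF)
  let ?M = "interval_measure G"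
  have "absolutely_continuous lborel ?M"
    unfolding absolutely_continuous_def
  proof
    fix N :: "real set" assume N: "N \<in> null_sets lborel"
    have "emeasure ?M N = 0"
      by (rule mono_abs_cont_null_sets[OF cd mG cG _ _ acG N]) (use cd in \<open>auto simp: G_def\<close>)
    with N show "N \<in> null_sets ?M" by (auto simp: null_sets_def)
  qed
  then obtain f where f: "f \<in> borel_measurable lborel" "density lborel f = ?M"
    using sigma_finite_measure.Radon_Nikodym[OF lborel.sigma_finite_measure_axioms, of ?M] by auto
  have [measurable]: "f \<in> borel_measurable borel" using f by simp
  define f' where "f' = (\<lambda>x. f x * indicator {c..d} x)"
  have fint: "(\<integral>\<^sup>+x. f x * indicator {x1..x2} x \<partial>lborel) = G x2 - G x1" if "x1 \<le> x2" for x1 x2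
  proof -
    have "emeasure (density lborel f) {x1..x2} = G x2 - G x1"
      unfolding f(2) by (rule emeasure_interval_measure_Icc[OF that mG' cG])
    then show ?thesis by (subst (asm) emeasure_density) auto
  qed
  \<comment> \<open>The Radon-Nikodym density may take the value infinity; its finite integral
    confines this to a null set, so that \<open>enn2real\<close> loses nothing.\<close>
  have "(\<integral>\<^sup>+x. f' x \<partial>lborel) = G d - G c" unfolding f'_def using fint cd by simp
  then have fin: "AE x in lborel. f' x \<noteq> \<infinity>"
    by (intro nn_integral_PInf_AE) (auto simp: f'_def)
  define g where "g = (\<lambda>x. enn2real (f' x))"
  have [measurable]: "f' \<in> borel_measurable borel" "g \<in> borel_measurable borel"
    unfolding g_def f'_def by measurable
  show thesis
  proof
    show "0 \<le> g x" for x by (simp add: g_def)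
    fix x y assume xy: "c \<le> x" "x \<le> y" "y \<le> d"
    have "(\<integral>\<^sup>+z. ennreal (g z * indicator {x..y} z) \<partial>lborel) = (\<integral>\<^sup>+z. f z * indicator {x..y} z \<partial>lborel)"
    proof (rule nn_integral_cong_AE, use fin in eventually_elim)
      fix z assume "f' z \<noteq> \<infinity>"
      then show "ennreal (g z * indicator {x..y} z) = f z * indicator {x..y} z"
        using xy by (auto simp: g_def f'_def indicator_def top.not_eq_extremum split: if_splits)
    qed
    also have "\<dots> = G y - G x" using fint xy by auto
    finally have "((\<lambda>z. g z * indicator {x..y} z) has_integral G y - G x) UNIV"
      using mG' xy by (intro nn_integral_has_integral) (auto simp: g_def)
    also have "(\<lambda>z. g z * indicator {x..y} z) = (\<lambda>z. if z \<in> {x..y} then g z else 0)"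
      by (auto simp: indicator_def)
    finally show "(g has_integral F y - F x) {x..y}"
      unfolding has_integral_restrict_UNIV using xy GF by simp
  qed
qed

section \<open>Total variation\<close>

lemma nonoverlapping_lengths:
  assumes P: "nonoverlapping {c..d} P" and cd: "c \<le> d"
  shows "(\<Sum>(x, y)\<in>P. y - x) \<le> d - c"
proof -
  have lt: "fst p < snd p" "c \<le> fst p" "snd p \<le> d" if "p \<in> P" for p
    using P that unfolding nonoverlapping_def by fastforce+
  have "ennreal (\<Sum>p\<in>P. snd p - fst p) = (\<Sum>p\<in>P. emeasure lborel {fst p<..<snd p})"
    using lt by (subst sum_ennreal[symmetric]) (auto intro!: sum.cong simp: less_imp_le)
  also have "\<dots> = emeasure lborel (\<Union>p\<in>P. {fst p<..<snd p})"
    using P by (intro sum_emeasure) (force simp: nonoverlapping_def disjoint_family_on_def pairwise_def)+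
  also have "\<dots> \<le> emeasure lborel {c..d}"
    using lt by (intro emeasure_mono) (fastforce, auto)
  also have "\<dots> = ennreal (d - c)" using cd by simp
  finally show ?thesis
    using cd by (simp add: case_prod_unfold ennreal_le_iff)
qed

text \<open>At most one interval has \<open>y\<close> in its interior. Cutting that one at
  \<open>y\<close> can only increase the increments, by the triangle inequality.\<close>

lemma nonoverlapping_split:
  assumes P: "nonoverlapping {x..z} P" and xyz: "x \<le> y" "y \<le> z"
  obtains P1 P2 where "nonoverlapping {x..y} P1" "nonoverlapping {y..z} P2"
    "increments f P \<le> increments f P1 + increments f P2"
proof -
  have fin: "finite P" using P by (rule nonoverlapping_finite)
  have lt: "u < v" "x \<le> u" "v \<le> z" if "(u, v) \<in> P" for u v
    using P that unfolding nonoverlapping_def by fastforce+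
  have dj: "v \<le> u' \<or> v' \<le> u" if "(u, v) \<in> P" "(u', v') \<in> P" "(u, v) \<noteq> (u', v')" for u v u' v'
    using P that unfolding nonoverlapping_def pairwise_def by fastforce
  define A where "A = {p\<in>P. snd p \<le> y}"
  define B where "B = {p\<in>P. y \<le> fst p}"
  have A: "nonoverlapping {x..y} A"
    using P unfolding nonoverlapping_def A_def by (auto simp: pairwise_def)
  have B: "nonoverlapping {y..z} B"
    using P unfolding nonoverlapping_def B_def by (auto simp: pairwise_def)
  have fAB: "finite A" "finite B" using A B by (auto dest: nonoverlapping_finite)
  have AB: "A \<inter> B = {}" using lt unfolding A_def B_def by force
  have inc_AB: "increments f (A \<union> B) = increments f A + increments f B"
    unfolding increments_def using fAB AB by (intro sum.union_disjoint) auto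
  show thesis
  proof (cases "P = A \<union> B")
    case True
    then show ?thesis using that[OF A B] inc_AB by simp
  next
    case False
    then obtain u v where uv: "(u, v) \<in> P" "u < y" "y < v"
      unfolding A_def B_def by force
    have others: "(u', v') \<in> A \<union> B" if "(u', v') \<in> P" "(u', v') \<noteq> (u, v)" for u' v'
    proof (rule ccontr)
      assume "(u', v') \<notin> A \<union> B"
      then have "u' < y" "y < v'" using that by (auto simp: A_def B_def)
      then show False using dj[OF uv(1) that(1)] that(2) uv by auto
    qed
    have P_eq: "P = insert (u, v) (A \<union> B)"
    proof
      show "P \<subseteq> insert (u, v) (A \<union> B)" using others by (metis insert_iff subsetI surj_pair)
      show "insert (u, v) (A \<union> B) \<subseteq> P" using uv by (auto simp: A_def B_def)
    qed
    have notin: "(u, v) \<notin> A \<union> B" using uv by (auto simp: A_def B_def)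
    have dA: "v' \<le> u" if "(u', v') \<in> A" for u' v'
    proof -
      have "(u', v') \<in> P" "(u', v') \<noteq> (u, v)" "u' < v'" "v' \<le> y" using that notin lt(1) by (auto simp: A_def)
      then show ?thesis using dj[OF uv(1), of u' v'] uv by auto
    qed
    have dB: "v \<le> u'" if "(u', v') \<in> B" for u' v'
    proof -
      have "(u', v') \<in> P" "(u', v') \<noteq> (u, v)" "u' < v'" "y \<le> u'" using that notin lt(1) by (auto simp: B_def)
      then show ?thesis using dj[OF uv(1), of u' v'] uv by auto
    qed
    have P1: "nonoverlapping {x..y} (insert (u, y) A)"
      using A uv lt[OF uv(1)] dA unfolding nonoverlapping_def pairwise_insert by auto
    have P2: "nonoverlapping {y..z} (insert (y, v) B)"
      using B uv lt[OF uv(1)] dB unfolding nonoverlapping_def pairwise_insert by auto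
    have nA: "(u, y) \<notin> A" using dA[of u y] uv by auto
    have nB: "(y, v) \<notin> B" using dB[of y v] uv by auto
    have "increments f P = \<bar>f v - f u\<bar> + (increments f A + increments f B)"
      unfolding P_eq using fAB notin by (subst increments_insert) (auto simp: inc_AB)
    also have "\<dots> \<le> increments f (insert (u, y) A) + increments f (insert (y, v) B)"
      using fAB nA nB by (simp add: increments_insert)
    finally show ?thesis using that[OF P1 P2] by simp
  qed
qed

text \<open>The families need not cover \<open>{x..y}\<close>, so no refinement of partitions is
  required. The supremum is meaningful once the increments are bounded, which the next lemma
  provides for absolutely continuous functions.\<close>

definition variation :: "(real \<Rightarrow> real) \<Rightarrow> real \<Rightarrow> real \<Rightarrow> real" where
  "variation f x y = (SUP P\<in>{P. nonoverlapping {x..y} P}. increments f P)"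

lemma abs_cont_on_bounded_increments:
  assumes ac: "abs_cont_on {c..d} f"
  shows "bdd_above (increments f ` {P. nonoverlapping {c..d} P})"
proof (cases "c \<le> d")
  case False
  then have "{P. nonoverlapping {c..d} P} = {{}}"
    by (force simp: nonoverlapping_def)
  then show ?thesis by simp
next
  case True
  obtain \<delta> where \<delta>: "\<delta> > 0"
    "\<And>P. nonoverlapping {c..d} P \<Longrightarrow> (\<Sum>(x, y)\<in>P. y - x) < \<delta> \<Longrightarrow> increments f P < 1"
    using abs_cont_onD[OF ac, of 1] by auto
  \<comment> \<open>Induction over steps of length \<open>\<delta> / 2\<close>: each step adds at
    most 1. Half of \<open>\<delta>\<close> keeps the length of a step strictly below
    \<open>\<delta>\<close>.\<close>
  have *: "increments f P \<le> real n + 1" if "nonoverlapping {c..y} P" "c \<le> y" "y \<le> d" "y \<le> c + real n * (\<delta> / 2)" for n y P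
    using that
  proof (induction n arbitrary: y P)
    case 0
    then have "y = c" by simp
    have "p \<notin> P" for p
    proof
      assume "p \<in> P"
      then have "fst p < snd p" "{fst p..snd p} \<subseteq> {c..y}" using 0(1) unfolding nonoverlapping_def by auto
      then have "fst p \<in> {c..y}" "snd p \<in> {c..y}" by auto
      then show False using \<open>y = c\<close> \<open>fst p < snd p\<close> by simp
    qed
    then have "P = {}" by blast
    then show ?case by (simp add: increments_def)
  next
    case (Suc n)
    define m where "m = max c (y - \<delta> / 2)"
    have m: "c \<le> m" "m \<le> y" "y - m < \<delta>" using Suc.prems \<delta>(1) by (auto simp: m_def)
    obtain P1 P2 where P: "nonoverlapping {c..m} P1" "nonoverlapping {m..y} P2"
      "increments f P \<le> increments f P1 + increments f P2"
      using nonoverlapping_split[OF Suc.prems(1) m(1,2)] by metis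
    have "increments f P1 \<le> real n + 1"
    proof (rule Suc.IH[OF P(1)])
      show "c \<le> m" "m \<le> d" using m Suc.prems by auto
      have "y - \<delta> / 2 \<le> c + real n * (\<delta> / 2)" using Suc.prems(4) by (simp add: field_simps)
      then show "m \<le> c + real n * (\<delta> / 2)" using \<delta>(1) by (simp add: m_def)
    qed
    moreover have "increments f P2 < 1"
      using nonoverlapping_lengths[OF P(2)] m Suc.prems by (intro \<delta>(2) nonoverlapping_mono[OF P(2)]) auto
    ultimately show ?case using P(3) by simp
  qed
  obtain n where "real n \<ge> (d - c) / (\<delta> / 2)" by (meson real_arch_simple)
  then have "d \<le> c + real n * (\<delta> / 2)" using \<delta>(1) by (simp add: field_simps)
  then show ?thesis using *[of d _ n] True by (intro bdd_aboveI2[of _ _ "real n + 1"]) auto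
qed

lemma variation_upper:
  assumes "abs_cont_on {c..d} f" "nonoverlapping {c..d} P"
  shows "increments f P \<le> variation f c d"
  unfolding variation_def
  using assms by (intro cSUP_upper abs_cont_on_bounded_increments) auto

lemma variation_least:
  assumes "\<And>P. nonoverlapping {c..d} P \<Longrightarrow> increments f P \<le> B"
  shows "variation f c d \<le> B"
  unfolding variation_def
proof (rule cSUP_least)
  show "{P. nonoverlapping {c..d} P} \<noteq> {}" using nonoverlapping_empty by blast
qed (use assms in auto)

text \<open>A family in \<open>{c..x}\<close> can be extended by the interval \<open>(x, y)\<close>.
  As a consequence both the variation and its difference with \<open>f\<close> are monotone.\<close>

lemma variation_add_increment:
  assumes ac: "abs_cont_on {c..d} f" and xy: "c \<le> x" "x < y" "y \<le> d"
  shows "variation f c x + \<bar>f y - f x\<bar> \<le> variation f c y"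
proof -
  have "variation f c x \<le> variation f c y - \<bar>f y - f x\<bar>"
  proof (rule variation_least)
    fix P assume P: "nonoverlapping {c..x} P"
    have "nonoverlapping {c..y} (insert (x, y) P)"
      using P xy unfolding nonoverlapping_def pairwise_insert by fastforce
    then have "increments f (insert (x, y) P) \<le> variation f c y"
      using xy by (intro variation_upper abs_cont_on_subset[OF ac]) auto
    moreover have "(x, y) \<notin> P" using P xy unfolding nonoverlapping_def by fastforce
    ultimately show "increments f P \<le> variation f c y - \<bar>f y - f x\<bar>"
      using nonoverlapping_finite[OF P] by (simp add: increments_insert)
  qed
  then show ?thesis by simp
qed

lemma variation_subadd:
  assumes ac: "abs_cont_on {c..d} f" and xy: "c \<le> x" "x \<le> y" "y \<le> d"
  shows "variation f c y \<le> variation f c x + variation f x y"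
proof (rule variation_least)
  fix P assume "nonoverlapping {c..y} P"
  then obtain P1 P2 where P: "nonoverlapping {c..x} P1" "nonoverlapping {x..y} P2"
    "increments f P \<le> increments f P1 + increments f P2"
    using nonoverlapping_split xy by metis
  have "increments f P1 \<le> variation f c x" "increments f P2 \<le> variation f x y"
    using P xy by (auto intro!: variation_upper abs_cont_on_subset[OF ac])
  with P(3) show "increments f P \<le> variation f c x + variation f x y" by simp
qed

lemma variation_mono_on:
  assumes ac: "abs_cont_on {c..d} f"
  shows "mono_on {c..d} (variation f c)"
proof (rule mono_onI)
  fix x y assume "x \<in> {c..d}" "y \<in> {c..d}" "x \<le> y"
  then show "variation f c x \<le> variation f c y"
    using variation_add_increment[OF ac, of x y] by (cases "x = y") (auto simp: abs_le_iff intro: order_trans[rotated])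
qed

text \<open>Each interval of a short family is replaced by a nearly optimal family inside it. The
  union is still nonoverlapping and no longer than before, so the \<open>\<delta>\<close> of
  \<open>f\<close> for \<open>e / 2\<close> serves the variation as well.\<close>

lemma abs_cont_on_variation:
  assumes ac: "abs_cont_on {c..d} f"
  shows "abs_cont_on {c..d} (variation f c)"
proof (rule abs_cont_onI)
  fix e :: real assume e: "e > 0"
  obtain \<delta> where \<delta>: "\<delta> > 0"
    "\<And>P. nonoverlapping {c..d} P \<Longrightarrow> (\<Sum>(x, y)\<in>P. y - x) < \<delta> \<Longrightarrow> increments f P < e / 2"
    using abs_cont_onD[OF ac, of "e / 2"] e by auto
  have less: "increments (variation f c) P < e"
    if P: "nonoverlapping {c..d} P" "(\<Sum>(x, y)\<in>P. y - x) < \<delta>" for P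
  proof -
    have fin: "finite P" using P(1) by (rule nonoverlapping_finite)
    have lt: "fst p < snd p" "c \<le> fst p" "snd p \<le> d" if "p \<in> P" for p
      using P that unfolding nonoverlapping_def by fastforce+
    \<comment> \<open>The errors of all intervals together stay below \<open>e / 2\<close>; the
      added 1 covers the empty family.\<close>
    define \<epsilon> where "\<epsilon> = e / (4 * (real (card P) + 1))"
    have \<epsilon>: "\<epsilon> > 0" using e by (simp add: \<epsilon>_def)
    have "\<exists>Q. nonoverlapping {fst p..snd p} Q \<and> variation f (fst p) (snd p) \<le> increments f Q + \<epsilon>" if "p \<in> P" for p
    proof (rule ccontr)
      assume "\<not> ?thesis"
      then have "variation f (fst p) (snd p) \<le> variation f (fst p) (snd p) - \<epsilon>"
        by (intro variation_least) force
      with \<epsilon> show False by simp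
    qed
    then obtain Q where Q: "\<And>p. p \<in> P \<Longrightarrow> nonoverlapping {fst p..snd p} (Q p)"
      "\<And>p. p \<in> P \<Longrightarrow> variation f (fst p) (snd p) \<le> increments f (Q p) + \<epsilon>" by metis
    have Qin: "u < v" "fst p \<le> u" "v \<le> snd p" if "p \<in> P" "(u, v) \<in> Q p" for p u v
      using Q(1)[OF that(1)] that(2) unfolding nonoverlapping_def by fastforce+
    have finQ: "finite (Q p)" if "p \<in> P" for p using Q(1)[OF that] by (rule nonoverlapping_finite)
    have disj: "v \<le> u' \<or> v' \<le> u"
      if "p \<in> P" "q \<in> P" "p \<noteq> q" "(u, v) \<in> Q p" "(u', v') \<in> Q q" for p q u v u' v'
    proof -
      have "snd p \<le> fst q \<or> snd q \<le> fst p"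
        using P(1) that unfolding nonoverlapping_def pairwise_def by auto
      with Qin[OF that(1,4)] Qin[OF that(2,5)] show ?thesis by linarith
    qed
    have disjQ: "Q p \<inter> Q q = {}" if "p \<in> P" "q \<in> P" "p \<noteq> q" for p q
      using disj[OF that] Qin(1) that by fastforce
    define R where "R = (\<Union>p\<in>P. Q p)"
    have sumR: "(\<Sum>r\<in>R. h r) = (\<Sum>p\<in>P. \<Sum>r\<in>Q p. h r)" for h :: "_ \<Rightarrow> real"
      unfolding R_def using fin finQ disjQ by (intro sum.UNION_disjoint) auto
    have R: "nonoverlapping {c..d} R"
      unfolding nonoverlapping_def
    proof (intro conjI)
      show "finite R" unfolding R_def using fin finQ by auto
      show "\<forall>(x, y)\<in>R. x < y \<and> {x..y} \<subseteq> {c..d}"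
        unfolding R_def using Qin lt by fastforce
      show "pairwise (\<lambda>p q. snd p \<le> fst q \<or> snd q \<le> fst p) R"
      proof (rule pairwiseI)
        fix r s assume "r \<in> R" "s \<in> R" and rs: "r \<noteq> s"
        then obtain p q where pq: "p \<in> P" "q \<in> P" "r \<in> Q p" "s \<in> Q q" by (auto simp: R_def)
        show "snd r \<le> fst s \<or> snd s \<le> fst r"
        proof (cases "p = q")
          case True
          then show ?thesis using Q(1)[OF pq(1)] pq rs unfolding nonoverlapping_def pairwise_def by auto
        next
          case False
          then show ?thesis using disj[of p q "fst r" "snd r" "fst s" "snd s"] pq by auto
        qed
      qed
    qed
    have "(\<Sum>(x, y)\<in>R. y - x) \<le> (\<Sum>(x, y)\<in>P. y - x)"
      unfolding sumR using nonoverlapping_lengths[OF Q(1)] lt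
      by (auto intro!: sum_mono simp: case_prod_unfold less_imp_le)
    then have "increments f R < e / 2" using P(2) by (intro \<delta>(2)[OF R]) auto
    moreover have "increments f R = (\<Sum>p\<in>P. increments f (Q p))"
      unfolding increments_def by (rule sumR)
    moreover have "increments (variation f c) P \<le> (\<Sum>p\<in>P. increments f (Q p) + \<epsilon>)"
      unfolding increments_def[of "variation f c"]
    proof (rule sum_mono, clarify)
      fix x y assume xy: "(x, y) \<in> P"
      then have "c \<le> x" "x < y" "y \<le> d" using lt by force+
      then show "\<bar>variation f c y - variation f c x\<bar> \<le> increments f (Q (x, y)) + \<epsilon>"
        using variation_subadd[OF ac, of x y] variation_add_increment[OF ac, of x y] Q(2)[OF xy] by auto
    qed
    moreover have "real (card P) * \<epsilon> < e / 2"
    proof -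
      have "real (card P) * \<epsilon> \<le> (real (card P) + 1) * \<epsilon>" using \<epsilon> by simp
      also have "\<dots> = e / 4" unfolding \<epsilon>_def using add_nonneg_pos[of "real (card P)" 1] by (simp add: field_simps)
      finally show ?thesis using e by simp
    qed
    ultimately show ?thesis by (simp add: sum.distrib)
  qed
  show "\<exists>\<delta>>0. \<forall>P. nonoverlapping {c..d} P \<longrightarrow> (\<Sum>(x, y)\<in>P. y - x) < \<delta> \<longrightarrow> increments (variation f c) P < e"
    by (intro exI[of _ \<delta>] conjI allI impI less \<delta>(1))
qed

text \<open>Both monotone parts have nonnegative densities, which makes the density of
  \<open>f\<close> absolutely integrable and not merely gauge integrable.\<close>

lemma abs_cont_on_has_integral:
  assumes ac: "abs_cont_on {c..d} f" and cd: "c < d"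
  obtains g where "g absolutely_integrable_on {c..d}"
    "\<And>x y. c \<le> x \<Longrightarrow> x \<le> y \<Longrightarrow> y \<le> d \<Longrightarrow> (g has_integral f y - f x) {x..y}"
proof -
  let ?V = "variation f c"
  have V: "mono_on {c..d} ?V" "abs_cont_on {c..d} ?V"
    using variation_mono_on[OF ac] abs_cont_on_variation[OF ac] .
  let ?W = "\<lambda>x. 1 * ?V x + (-1) * f x"
  have W: "abs_cont_on {c..d} ?W" by (rule abs_cont_on_lincomb[OF V(2) ac])
  have mW: "mono_on {c..d} ?W"
  proof (rule mono_onI)
    fix x y assume xy: "x \<in> {c..d}" "y \<in> {c..d}" "x \<le> y"
    show "?W x \<le> ?W y"
    proof (cases "x = y")
      case False
      then show ?thesis using variation_add_increment[OF ac, of x y] xy by auto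
    qed auto
  qed
  obtain g1 where g1: "\<And>x. 0 \<le> g1 x"
    "\<And>x y. c \<le> x \<Longrightarrow> x \<le> y \<Longrightarrow> y \<le> d \<Longrightarrow> (g1 has_integral ?V y - ?V x) {x..y}"
    by (rule mono_abs_cont_has_integral[OF cd V], rule that)
  obtain g2 where g2: "\<And>x. 0 \<le> g2 x"
    "\<And>x y. c \<le> x \<Longrightarrow> x \<le> y \<Longrightarrow> y \<le> d \<Longrightarrow> (g2 has_integral ?W y - ?W x) {x..y}"
    by (rule mono_abs_cont_has_integral[OF cd mW W], rule that)
  have i1: "g1 integrable_on {c..d}" using g1(2)[of c d] cd by (auto intro: has_integral_integrable)
  have i2: "g2 integrable_on {c..d}" using g2(2)[of c d] cd by (auto intro: has_integral_integrable)
  show thesis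
  proof
    show "(\<lambda>x. g1 x - g2 x) absolutely_integrable_on {c..d}"
      using nonnegative_absolutely_integrable_1[OF i1 g1(1)] nonnegative_absolutely_integrable_1[OF i2 g2(1)]
      by (rule set_integral_diff(1))
    fix x y assume xy: "c \<le> x" "x \<le> y" "y \<le> d"
    have "((\<lambda>x. g1 x - g2 x) has_integral (?V y - ?V x) - (?W y - ?W x)) {x..y}"
      using g1(2)[OF xy] g2(2)[OF xy] by (rule has_integral_diff)
    then show "((\<lambda>x. g1 x - g2 x) has_integral f y - f x) {x..y}" by simp
  qed
qed

section \<open>Differentiability almost everywhere\<close>

lemma has_field_derivative_at_iff_sides:
  fixes f :: "real \<Rightarrow> real"
  assumes "((\<lambda>h. (f (x + h) - f x) / h) \<longlongrightarrow> D) (at_right 0)"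
    "((\<lambda>h. (f x - f (x - h)) / h) \<longlongrightarrow> D) (at_right 0)"
  shows "DERIV f x :> D"
proof -
  have "((\<lambda>h. (f (x + h) - f x) / h) \<longlongrightarrow> D) (at_left 0)"
    unfolding filterlim_at_left_to_right minus_zero
    using assms(2) by (rule Lim_transform_eventually)
      (auto intro!: always_eventually simp: field_simps minus_divide_left)
  with assms(1) show ?thesis
    unfolding DERIV_def by (simp add: filterlim_at_split)
qed

lemma indefinite_integral_right_difference_quotient:
  fixes g :: "real \<Rightarrow> real"
  assumes "\<And>a b. g integrable_on {a..b}"
  obtains N where "negligible N"
    "\<And>x. x \<notin> N \<Longrightarrow> ((\<lambda>h. integral {x..x + h} g / h) \<longlongrightarrow> g x) (at_right 0)"
proof -
  obtain N where N: "negligible N"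
       "\<And>x e. \<lbrakk>x \<notin> N; 0 < e\<rbrakk> \<Longrightarrow> \<exists>d>0. \<forall>h. 0 < h \<and> h < d \<longrightarrow>
            norm (integral (cbox x (x + h *\<^sub>R One)) g /\<^sub>R h ^ DIM(real) - g x) < e"
    by (rule integrable_ccontinuous_explicit[of g], use assms in simp, rule that)
  show thesis
  proof (rule that[OF N(1)])
    fix x assume "x \<notin> N"
    show "((\<lambda>h. integral {x..x + h} g / h) \<longlongrightarrow> g x) (at_right 0)"
    proof (rule tendstoI)
      fix e :: real assume "e > 0"
      from N(2)[OF \<open>x \<notin> N\<close> this] obtain d where "d > 0"
        "\<forall>h. 0 < h \<and> h < d \<longrightarrow> norm (integral (cbox x (x + h *\<^sub>R One)) g /\<^sub>R h ^ DIM(real) - g x) < e" by blast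
      then show "\<forall>\<^sub>F h in at_right 0. dist (integral {x..x + h} g / h) (g x) < e"
        unfolding eventually_at_right_field by (intro exI[of _ d]) (auto simp: dist_real_def divide_inverse mult.commute)
    qed
  qed
qed

text \<open>The differentiation theorem for integrals is applied to intervals
  \<open>{x..x + h}\<close> and yields right difference quotients; the left ones come from applying
  it to the reflected density \<open>g0 (- x)\<close>.\<close>

lemma abs_cont_on_differentiable_AE:
  assumes ac: "abs_cont_on {c..d} f" and cd: "c < d"
  obtains N where "negligible N"
    "\<And>x. x \<in> {c<..<d} - N \<Longrightarrow> f field_differentiable at x"
    "deriv f absolutely_integrable_on {c..d}"
    "\<And>x y. c \<le> x \<Longrightarrow> x \<le> y \<Longrightarrow> y \<le> d \<Longrightarrow> (deriv f has_integral f y - f x) {x..y}"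
proof -
  obtain g where g: "g absolutely_integrable_on {c..d}"
    "\<And>x y. c \<le> x \<Longrightarrow> x \<le> y \<Longrightarrow> y \<le> d \<Longrightarrow> (g has_integral f y - f x) {x..y}"
    by (rule abs_cont_on_has_integral[OF ac cd], rule that)
  \<comment> \<open>Extension by zero gives integrability on every interval, also after
    reflection.\<close>
  define g0 where "g0 = (\<lambda>x. if x \<in> {c..d} then g x else 0)"
  have "g0 integrable_on UNIV"
    using set_lebesgue_integral_eq_integral(1)[OF g(1)] unfolding g0_def integrable_restrict_UNIV .
  then have i0: "g0 integrable_on {x..y}" for x y by (rule integrable_on_subinterval) auto
  have i1: "(\<lambda>x. g0 (- x)) integrable_on {x..y}" for x y
    using i0[of "- y" "- x"] Henstock_Kurzweil_Integration.integrable_reflect_real[of g0 "- x" "- y"] by simp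
  obtain N where N: "negligible N"
    "\<And>x. x \<notin> N \<Longrightarrow> ((\<lambda>h. integral {x..x + h} g0 / h) \<longlongrightarrow> g0 x) (at_right 0)"
    by (rule indefinite_integral_right_difference_quotient[OF i0], rule that)
  obtain M where M: "negligible M"
    "\<And>x. x \<notin> M \<Longrightarrow> ((\<lambda>h. integral {x..x + h} (\<lambda>x. g0 (- x)) / h) \<longlongrightarrow> g0 (- x)) (at_right 0)"
    by (rule indefinite_integral_right_difference_quotient[OF i1], rule that)
  define K where "K = N \<union> uminus ` M \<union> {c, d}"
  have K: "negligible K"
    unfolding K_def using N(1) M(1)
    by (intro negligible_Un negligible_differentiable_image_negligible)
      (auto simp: differentiable_on_def)
  have fg: "integral {x..y} g0 = f y - f x" if "c \<le> x" "x \<le> y" "y \<le> d" for x y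
  proof -
    have "integral {x..y} g0 = integral {x..y} g" by (rule integral_cong) (use that in \<open>auto simp: g0_def\<close>)
    then show ?thesis using g(2)[OF that] by (simp add: integral_unique)
  qed
  have D: "DERIV f x :> g x" if x: "x \<in> {c<..<d} - K" for x
  proof (rule has_field_derivative_at_iff_sides)
    have xx: "c < x" "x < d" "x \<notin> N" "- x \<notin> M" using x unfolding K_def by (auto simp: image_iff)
    have gx: "g0 x = g x" using xx by (simp add: g0_def)
    show "((\<lambda>h. (f (x + h) - f x) / h) \<longlongrightarrow> g x) (at_right 0)"
    proof (rule Lim_transform_eventually)
      show "((\<lambda>h. integral {x..x + h} g0 / h) \<longlongrightarrow> g x) (at_right 0)" using N(2) xx gx by metis
      show "\<forall>\<^sub>F h in at_right 0. integral {x..x + h} g0 / h = (f (x + h) - f x) / h"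
        unfolding eventually_at_right_field using xx by (intro exI[of _ "d - x"]) (auto intro!: fg)
    qed
    show "((\<lambda>h. (f x - f (x - h)) / h) \<longlongrightarrow> g x) (at_right 0)"
    proof (rule Lim_transform_eventually)
      show "((\<lambda>h. integral {- x..- x + h} (\<lambda>x. g0 (- x)) / h) \<longlongrightarrow> g x) (at_right 0)"
        using M(2)[of "- x"] xx gx by simp
      have "integral {- x..- x + h} (\<lambda>x. g0 (- x)) = f x - f (x - h)" if "0 < h" "h < x - c" for h
        using Henstock_Kurzweil_Integration.integral_reflect_real[of "x" "x - h" g0] fg[of "x - h" x] that xx by simp
      then show "\<forall>\<^sub>F h in at_right 0. integral {- x..- x + h} (\<lambda>x. g0 (- x)) / h = (f x - f (x - h)) / h"
        unfolding eventually_at_right_field using xx by (intro exI[of _ "x - c"]) auto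
    qed
  qed
  \<comment> \<open>On the negligible set \<open>K\<close>, where \<open>f\<close> may fail to be
    differentiable, \<open>deriv f\<close> is an arbitrary value; the integral does not see
    it.\<close>
  have eq: "deriv f x = g x" if "x \<in> {c..d} - K" for x
    using D[of x] that by (intro DERIV_imp_deriv) (auto simp: K_def)
  show thesis
  proof (rule that[OF K])
    show "f field_differentiable at x" if "x \<in> {c<..<d} - K" for x
      using D[OF that] by (auto simp: field_differentiable_def)
    show "deriv f absolutely_integrable_on {c..d}"
      by (rule absolutely_integrable_spike[OF g(1) K eq])
    show "(deriv f has_integral f y - f x) {x..y}" if "c \<le> x" "x \<le> y" "y \<le> d" for x y
      by (rule has_integral_spike[OF K _ g(2)[OF that]]) (use that eq in auto)
  qed
qed

section \<open>Lebesgue measure on open intervals\<close>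

abbreviation leb :: "real measure" where "leb \<equiv> lebesgue_on {0<..<1}"

lemma space_leb [simp]: "space leb = {0<..<1}" by simp

lemma finite_measure_lebesgue_on_Ioo: "finite_measure (lebesgue_on {0<..<T::real})"
  by (rule finite_measureI) (cases "0 \<le> T"; simp add: emeasure_restrict_space)

lemma AE_lebesgue_on_negligible:
  assumes "negligible N" "\<And>x. x \<in> {a<..<b::real} - N \<Longrightarrow> P x"
  shows "AE x in lebesgue_on {a<..<b}. P x"
proof -
  have "AE x in lebesgue. x \<notin> N"
    using assms(1) by (simp add: AE_not_in negligible_iff_null_sets)
  then show ?thesis
    by (subst AE_restrict_space_iff) (use assms(2) in \<open>auto elim!: eventually_mono\<close>)
qed

lemma AE_lebesgue_on_obtain_negligible:
  assumes "AE x in lebesgue_on {a<..<b::real}. P x"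
  obtains N where "negligible N" "\<And>x. x \<in> {a<..<b} - N \<Longrightarrow> P x"
proof -
  have "AE x in lebesgue. x \<in> {a<..<b} \<longrightarrow> P x"
    using assms by (subst (asm) AE_restrict_space_iff) auto
  then obtain N where N: "{x \<in> space lebesgue. \<not> (x \<in> {a<..<b} \<longrightarrow> P x)} \<subseteq> N"
    "emeasure lebesgue N = 0" "N \<in> sets lebesgue"
    by (rule AE_E)
  show thesis
  proof (rule that)
    show "negligible N" using N by (simp add: negligible_iff_null_sets null_setsI)
    show "P x" if "x \<in> {a<..<b} - N" for x using N(1) that by auto
  qed
qed

text \<open>Rests on completeness of Lebesgue measure: \<open>g\<close> may be anything on the
  exceptional null set.\<close>

lemma measurable_lebesgue_on_AE:
  fixes f g :: "real \<Rightarrow> real"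
  assumes f: "f \<in> borel_measurable (lebesgue_on {a<..<b})" and ae: "AE x in lebesgue_on {a<..<b}. f x = g x"
  shows "g \<in> borel_measurable (lebesgue_on {a<..<b})"
proof -
  have "(\<lambda>x. indicator {a<..<b} x *\<^sub>R f x) \<in> borel_measurable lebesgue"
    using f by (subst (asm) borel_measurable_restrict_space_iff) (auto simp: mult.commute)
  moreover have "AE x in lebesgue. indicator {a<..<b} x *\<^sub>R f x = indicator {a<..<b} x *\<^sub>R g x"
    using ae by (subst (asm) AE_restrict_space_iff) (auto elim!: eventually_mono simp: indicator_def)
  ultimately have "(\<lambda>x. indicator {a<..<b} x *\<^sub>R g x) \<in> borel_measurable lebesgue"
    by (rule borel_measurable_AE)
  then show ?thesis
    by (subst borel_measurable_restrict_space_iff) (auto simp: mult.commute)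
qed

lemma continuous_on_measurable_lebesgue_on:
  fixes f :: "real \<Rightarrow> real"
  assumes "continuous_on {a<..<b} f"
  shows "f \<in> borel_measurable (lebesgue_on {a<..<b})"
  using assms by (intro continuous_imp_measurable_on_sets_lebesgue) auto

text \<open>The common core of the Cauchy-Schwarz inequalities for \<open>L2\<close> and for the
  energy product. Both forms are only semidefinite on representatives, hence the case
  \<open>C = 0\<close>.\<close>

lemma quadratic_nonneg_imp_discriminant:
  fixes A B C :: real
  assumes "\<And>t. 0 \<le> A + 2 * t * B + t\<^sup>2 * C" "0 \<le> C"
  shows "B\<^sup>2 \<le> A * C"
proof (cases "C = 0")
  case True
  have "B = 0"
  proof (rule ccontr)
    assume B: "B \<noteq> 0"
    have "0 \<le> A + 2 * (- (A + 1) / (2 * B)) * B" using assms(1)[of "- (A + 1) / (2 * B)"] True by simp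
    also have "\<dots> = - 1" using B by (simp add: field_simps)
    finally show False by simp
  qed
  then show ?thesis using True by simp
next
  case False
  then have C: "C > 0" using assms(2) by simp
  have "0 \<le> (A + 2 * (- B / C) * B + (- B / C)\<^sup>2 * C) * C"
    using assms(1)[of "- B / C"] C by (intro mult_nonneg_nonneg) auto
  also have "\<dots> = A * C - B\<^sup>2" using C by (simp add: field_simps power2_eq_square)
  finally show ?thesis by simp
qed

section \<open>Square integrable functions\<close>

lemma L2_measurable: "f \<in> L2 b \<Longrightarrow> f \<in> borel_measurable (lebesgue_on {0<..<b})"
  by (simp add: L2_def)

lemma L2_integrable: "f \<in> L2 b \<Longrightarrow> integrable (lebesgue_on {0<..<b}) (\<lambda>x. (f x)\<^sup>2)"
  by (simp add: L2_def)

lemma L2_mult_integrable: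
  assumes "f \<in> L2 b" "g \<in> L2 b"
  shows "integrable (lebesgue_on {0<..<b}) (\<lambda>x. f x * g x)"
proof (rule Bochner_Integration.integrable_bound)
  show "integrable (lebesgue_on {0<..<b}) (\<lambda>x. (f x)\<^sup>2 + (g x)\<^sup>2)"
    using assms by (intro Bochner_Integration.integrable_add L2_integrable)
  show "(\<lambda>x. f x * g x) \<in> borel_measurable (lebesgue_on {0<..<b})"
    using assms[THEN L2_measurable] by measurable
  have "\<bar>p * q\<bar> \<le> p\<^sup>2 + q\<^sup>2" for p q :: real
    using sum_squares_bound[of "\<bar>p\<bar>" "\<bar>q\<bar>"] mult_nonneg_nonneg[OF abs_ge_zero[of p] abs_ge_zero[of q]]
    unfolding abs_mult power2_abs by linarith
  then show "AE x in lebesgue_on {0<..<b}. norm (f x * g x) \<le> norm ((f x)\<^sup>2 + (g x)\<^sup>2)"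
    by simp
qed

lemma L2_lincomb:
  assumes "f \<in> L2 b" "g \<in> L2 b"
  shows "(\<lambda>x. c * f x + d * g x) \<in> L2 b"
proof -
  have "(\<lambda>x. c * f x + d * g x) \<in> borel_measurable (lebesgue_on {0<..<b})"
    using assms[THEN L2_measurable] by measurable
  moreover have "integrable (lebesgue_on {0<..<b}) (\<lambda>x. c\<^sup>2 * (f x)\<^sup>2 + 2 * c * d * (f x * g x) + d\<^sup>2 * (g x)\<^sup>2)"
    using assms by (intro Bochner_Integration.integrable_add integrable_mult_right L2_mult_integrable L2_integrable)
  moreover have "(\<lambda>x. c\<^sup>2 * (f x)\<^sup>2 + 2 * c * d * (f x * g x) + d\<^sup>2 * (g x)\<^sup>2) = (\<lambda>x. (c * f x + d * g x)\<^sup>2)"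
    by (auto simp: power2_eq_square algebra_simps)
  ultimately show ?thesis by (simp add: L2_def)
qed

lemma L2_cong_AE:
  assumes f: "f \<in> L2 b" and ae: "AE x in lebesgue_on {0<..<b}. f x = g x"
  shows "g \<in> L2 b"
proof -
  have m: "g \<in> borel_measurable (lebesgue_on {0<..<b})"
    by (rule measurable_lebesgue_on_AE[OF L2_measurable[OF f] ae])
  moreover have "integrable (lebesgue_on {0<..<b}) (\<lambda>x. (g x)\<^sup>2)"
    by (rule integrable_cong_AE_imp[OF L2_integrable[OF f]]) (use m ae in \<open>auto elim!: eventually_mono\<close>)
  ultimately show ?thesis by (simp add: L2_def)
qed

lemma L2_cong: "f \<in> L2 b \<Longrightarrow> (\<And>x. x \<in> {0<..<b} \<Longrightarrow> f x = g x) \<Longrightarrow> g \<in> L2 b"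
  by (erule L2_cong_AE) (auto intro!: AE_I2)

lemma L2_bounded_mult:
  assumes f: "f \<in> L2 b" and m: "m \<in> borel_measurable (lebesgue_on {0<..<b})"
    and B: "\<And>x. x \<in> {0<..<b} \<Longrightarrow> \<bar>m x\<bar> \<le> B"
  shows "(\<lambda>x. m x * f x) \<in> L2 b"
proof -
  have "integrable (lebesgue_on {0<..<b}) (\<lambda>x. (m x * f x)\<^sup>2)"
  proof (rule Bochner_Integration.integrable_bound)
    show "integrable (lebesgue_on {0<..<b}) (\<lambda>x. B\<^sup>2 * (f x)\<^sup>2)"
      by (intro integrable_mult_right L2_integrable f)
    show "(\<lambda>x. (m x * f x)\<^sup>2) \<in> borel_measurable (lebesgue_on {0<..<b})"
      using m L2_measurable[OF f] by measurable
    show "AE x in lebesgue_on {0<..<b}. norm ((m x * f x)\<^sup>2) \<le> norm (B\<^sup>2 * (f x)\<^sup>2)"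
    proof (rule AE_I2)
      fix x assume "x \<in> space (lebesgue_on {0<..<b})"
      then have "\<bar>m x\<bar>\<^sup>2 \<le> B\<^sup>2" using B by (intro power_mono) auto
      then have "(m x)\<^sup>2 * (f x)\<^sup>2 \<le> B\<^sup>2 * (f x)\<^sup>2" by (intro mult_right_mono) auto
      then show "norm ((m x * f x)\<^sup>2) \<le> norm (B\<^sup>2 * (f x)\<^sup>2)" by (simp add: power_mult_distrib)
    qed
  qed
  then show ?thesis using m L2_measurable[OF f] by (simp add: L2_def)
qed

lemma L2_const: "(\<lambda>x. c) \<in> L2 b"
  by (simp add: L2_def finite_measure.integrable_const[OF finite_measure_lebesgue_on_Ioo])

lemma L2_bounded:
  assumes m: "m \<in> borel_measurable (lebesgue_on {0<..<b})"
    and B: "\<And>x. x \<in> {0<..<b} \<Longrightarrow> \<bar>m x\<bar> \<le> B"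
  shows "m \<in> L2 b"
  using L2_bounded_mult[OF L2_const[of 1] m B] by simp

lemma L2_imp_integrable:
  assumes "f \<in> L2 b" shows "integrable (lebesgue_on {0<..<b}) f"
  using L2_mult_integrable[OF assms L2_const[of 1]] by simp

lemma L2_Cauchy_Schwarz:
  assumes "f \<in> L2 b" "g \<in> L2 b"
  shows "(LINT x|lebesgue_on {0<..<b}. f x * g x)\<^sup>2 \<le>
    (LINT x|lebesgue_on {0<..<b}. (f x)\<^sup>2) * (LINT x|lebesgue_on {0<..<b}. (g x)\<^sup>2)"
proof (rule quadratic_nonneg_imp_discriminant)
  let ?M = "lebesgue_on {0<..<b}"
  note i = L2_integrable[OF assms(1)] L2_integrable[OF assms(2)] L2_mult_integrable[OF assms]
  fix t :: real
  have "0 \<le> (LINT x|?M. (f x + t * g x)\<^sup>2)" by simp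
  also have "(\<lambda>x. (f x + t * g x)\<^sup>2) = (\<lambda>x. (f x)\<^sup>2 + 2 * t * (f x * g x) + t\<^sup>2 * (g x)\<^sup>2)"
    by (auto simp: power2_eq_square algebra_simps)
  finally show "0 \<le> (LINT x|?M. (f x)\<^sup>2) + 2 * t * (LINT x|?M. f x * g x) + t\<^sup>2 * (LINT x|?M. (g x)\<^sup>2)"
    using i by (simp add: Bochner_Integration.integral_add)
qed simp

section \<open>Local absolute continuity and the fundamental theorem of calculus\<close>

lemma loc_abs_cont_lincomb:
  "loc_abs_cont f \<Longrightarrow> loc_abs_cont g \<Longrightarrow> loc_abs_cont (\<lambda>x. r * f x + s * g x)"
  unfolding loc_abs_cont_def by (auto intro: abs_cont_on_lincomb)

lemma loc_abs_cont_mult: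
  "loc_abs_cont f \<Longrightarrow> loc_abs_cont g \<Longrightarrow> loc_abs_cont (\<lambda>x. f x * g x)"
  unfolding loc_abs_cont_def by (auto intro: abs_cont_on_mult)

lemma abs_cont_on_loc_abs_cont: "abs_cont_on {0..1} f \<Longrightarrow> loc_abs_cont f"
  unfolding loc_abs_cont_def by (auto intro: abs_cont_on_subset)

lemma loc_abs_cont_continuous:
  assumes "loc_abs_cont f"
  shows "continuous_on {0<..1} f"
proof (rule continuous_on_eq_continuous_within[THEN iffD2], rule ballI)
  fix x :: real assume x: "x \<in> {0<..1}"
  have "continuous_on {x/2..1} f"
    using assms x unfolding loc_abs_cont_def by (auto intro!: abs_cont_on_continuous)
  then have "continuous (at x within {x/2..1}) f" using x by (auto simp: continuous_on_eq_continuous_within)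
  moreover have "at x within {x/2..1} = at x within {0<..1}"
    by (rule at_within_nhd[of _ "{x/2<..}"]) (use x in auto)
  ultimately show "continuous (at x within {0<..1}) f" by simp
qed

lemma loc_abs_cont_measurable: "loc_abs_cont f \<Longrightarrow> f \<in> borel_measurable leb"
  by (rule continuous_on_measurable_lebesgue_on) (auto intro: continuous_on_subset loc_abs_cont_continuous)

lemma loc_abs_cont_has_integral:
  assumes f: "loc_abs_cont f" and xy: "0 < x" "x \<le> y" "y \<le> 1"
  shows "(deriv f has_integral f y - f x) {x..y}"
proof (cases "x = y")
  case False
  have "abs_cont_on {x..y} f"
    using f xy unfolding loc_abs_cont_def by (auto intro: abs_cont_on_subset[of "{x..1}"])
  then show ?thesis by (rule abs_cont_on_differentiable_AE) (use xy False in auto)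
qed (simp add: has_integral_refl)

lemma loc_abs_cont_differentiable_AE:
  assumes f: "loc_abs_cont f"
  shows "AE x in leb. f field_differentiable at x"
proof -
  \<comment> \<open>Countably many intervals exhaust \<open>{0<..<1}\<close>; with
    \<open>n + 2\<close> the left end point stays below 1 even for \<open>n = 0\<close>.\<close>
  have "\<exists>N. negligible N \<and> (\<forall>x\<in>{1 / (real n + 2)<..<1} - N. f field_differentiable at x)" for n :: nat
  proof -
    have "abs_cont_on {1 / (real n + 2)..1} f"
      using f unfolding loc_abs_cont_def by auto
    then show ?thesis by (rule abs_cont_on_differentiable_AE) auto
  qed
  then obtain N where N: "\<And>n. negligible (N n)"
    "\<And>n x. x \<in> {1 / (real n + 2)<..<1} - N n \<Longrightarrow> f field_differentiable at x" by metis
  show ?thesis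
  proof (rule AE_lebesgue_on_negligible)
    show "negligible (\<Union>n. N n)" using N(1) by (intro negligible_Union_nat)
    fix x assume x: "x \<in> {0<..<1} - (\<Union>n. N n)"
    obtain n :: nat where "1 / x < real n" using reals_Archimedean2 by blast
    then have "1 / (real n + 2) < x" using x by (simp add: field_simps)
    then show "f field_differentiable at x" using x by (intro N(2)[of x n]) auto
  qed
qed

lemma loc_abs_cont_DERIV_AE:
  assumes f: "loc_abs_cont f"
  shows "AE x in leb. DERIV f x :> deriv f x"
  using loc_abs_cont_differentiable_AE[OF f] by (auto elim!: eventually_mono simp: DERIV_deriv_iff_field_differentiable)

text \<open>The fundamental theorem for functions that are uncontrolled at 0: an integrable
  derivative forces a limit there, since indefinite integrals are continuous. All spatial
  integrations by parts go through this lemma; the value of the limit is identified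
  separately.\<close>

lemma loc_abs_cont_tendsto_at_0:
  assumes f: "loc_abs_cont f" and g: "integrable leb g" and ae: "AE x in leb. DERIV f x :> g x"
  shows "(f \<longlongrightarrow> f 1 - (LINT x|leb. g x)) (at_right 0)"
proof -
  have hi: "(g has_integral (LINT x|leb. g x)) {0..1}"
    using has_integral_integral_lebesgue_on[OF g] by (simp add: has_integral_Icc_iff_Ioo)
  have "continuous_on {0..1} (\<lambda>x. integral {x..1} g)"
    using hi by (intro indefinite_integral_continuous_1') auto
  then have "((\<lambda>x. integral {x..1} g) \<longlongrightarrow> integral {0..1} g) (at 0 within {0..1})"
    by (auto simp: continuous_on_def)
  then have "((\<lambda>x. f 1 - integral {x..1} g) \<longlongrightarrow> f 1 - integral {0..1} g) (at_right 0)"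
    by (intro tendsto_intros) (simp add: at_within_Icc_at_right)
  moreover have "f 1 - integral {x..1} g = f x" if x: "0 < x" "x < 1" for x
  proof -
    obtain N where N: "negligible N" "\<And>x. x \<in> {0<..<1} - N \<Longrightarrow> DERIV f x :> g x"
      using AE_lebesgue_on_obtain_negligible[OF ae] by metis
    have "integral {x..1} g = integral {x..1} (deriv f)"
      by (rule integral_spike[of "N \<union> {1}"])
        (use N x in \<open>auto intro!: negligible_Un DERIV_imp_deriv simp: negligible_finite\<close>)
    then show ?thesis using loc_abs_cont_has_integral[OF f, of x 1] x by (auto simp: integral_unique)
  qed
  then have "\<forall>\<^sub>F x in at_right 0. f 1 - integral {x..1} g = f x"
    unfolding eventually_at_right_field by (intro exI[of _ 1]) auto
  ultimately have "(f \<longlongrightarrow> f 1 - integral {0..1} g) (at_right 0)"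
    by (rule Lim_transform_eventually)
  then show ?thesis using hi by (simp add: integral_unique)
qed

text \<open>A continuous derivative is bounded on each \<open>{c..1}\<close>, so the function is
  Lipschitz there.\<close>

lemma C1_loc_abs_cont:
  assumes D: "\<And>x. x \<in> {0<..1} \<Longrightarrow> (f has_real_derivative f' x) (at x within {0<..1})"
    and c: "continuous_on {0<..1} f'"
  shows "loc_abs_cont f"
  unfolding loc_abs_cont_def
proof
  fix c :: real assume c0: "c \<in> {0<..1}"
  have "compact (f' ` {c..1})"
    using c0 by (intro compact_continuous_image continuous_on_subset[OF c]) auto
  then obtain B where B: "\<And>x. x \<in> {c..1} \<Longrightarrow> \<bar>f' x\<bar> \<le> B"
    by (metis compact_imp_bounded bounded_iff imageI real_norm_def)
  show "abs_cont_on {c..1} f"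
  proof (rule lipschitz_abs_cont_on)
    fix x y assume xy: "x \<in> {c..1}" "y \<in> {c..1}" "x \<le> y"
    have "norm (f y - f x) \<le> B * norm (y - x)"
    proof (rule field_differentiable_bound[of "{c..1}" f f'])
      show "(f has_field_derivative f' z) (at z within {c..1})" if "z \<in> {c..1}" for z
        using D[of z] c0 that by (intro has_field_derivative_subset[OF D]) auto
    qed (use xy B in auto)
    then show "\<bar>f y - f x\<bar> \<le> B * (y - x)" using xy by simp
  qed
qed

lemma loc_abs_cont_ln: "loc_abs_cont ln"
  by (rule C1_loc_abs_cont[of _ "\<lambda>x. 1 / x"])
    (auto intro!: continuous_intros derivative_eq_intros simp: divide_inverse)

text \<open>Otherwise \<open>ln\<close> would have a finite limit at 0.\<close>

lemma not_integrable_inverse: "\<not> integrable leb (\<lambda>x. 1 / x)"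
proof
  assume i: "integrable leb (\<lambda>x. 1 / x)"
  have "AE x in leb. DERIV ln x :> 1 / x"
    by (rule AE_I2) (auto intro!: derivative_eq_intros simp: divide_inverse)
  from loc_abs_cont_tendsto_at_0[OF loc_abs_cont_ln i this]
  have "\<exists>l. ((ln :: real \<Rightarrow> real) \<longlongrightarrow> l) (at_right 0)" by blast
  then show False
    using ln_at_0 not_tendsto_and_filterlim_at_infinity[of "at_right (0::real)" ln]
      filterlim_at_bot_imp_at_infinity by (metis trivial_limit_at_right_real)
qed

text \<open>Near 0 a nonzero limit would bound \<open>|f x|\<close> from below, and integrability of
  \<open>f x / x\<close> would pass to \<open>1 / x\<close>. This is how boundary terms at 0 are
  shown to vanish.\<close>

lemma tendsto_0_if_quotient_integrable:
  fixes l :: real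
  assumes lim: "(f \<longlongrightarrow> l) (at_right 0)" and i: "integrable leb (\<lambda>x. f x / x)"
  shows "l = 0"
proof (rule ccontr)
  assume l: "l \<noteq> 0"
  have "\<forall>\<^sub>F x in at_right 0. dist (f x) l < \<bar>l\<bar> / 2"
    using lim l by (intro tendstoD) auto
  then obtain d where d: "d > 0" "\<And>x. 0 < x \<Longrightarrow> x < d \<Longrightarrow> dist (f x) l < \<bar>l\<bar> / 2"
    unfolding eventually_at_right_field by auto
  have "integrable leb (\<lambda>x. 1 / x)"
  proof (rule Bochner_Integration.integrable_bound)
    \<comment> \<open>The first summand dominates \<open>1 / x\<close> for \<open>x < d\<close>, the
      constant \<open>1 / d\<close> does so for the remaining \<open>x\<close>.\<close>
    show "integrable leb (\<lambda>x. 2 / \<bar>l\<bar> * \<bar>f x / x\<bar> + 1 / d)"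
      using i finite_measure.integrable_const[OF finite_measure_lebesgue_on_Ioo]
      by (intro Bochner_Integration.integrable_add integrable_mult_right integrable_abs)
    show "(\<lambda>x. 1 / x) \<in> borel_measurable leb"
      by (rule continuous_on_measurable_lebesgue_on) (auto intro!: continuous_intros)
    show "AE x in leb. norm (1 / x) \<le> norm (2 / \<bar>l\<bar> * \<bar>f x / x\<bar> + 1 / d)"
    proof (rule AE_I2)
      fix x assume "x \<in> space leb"
      then have x: "0 < x" "x < 1" by auto
      have "1 / x \<le> 2 / \<bar>l\<bar> * \<bar>f x / x\<bar> + 1 / d"
      proof (cases "x < d")
        case True
        then have "\<bar>l\<bar> / 2 \<le> \<bar>f x\<bar>" using d(2)[of x] x unfolding dist_real_def by linarith
        then have "1 \<le> 2 / \<bar>l\<bar> * \<bar>f x\<bar>" using l by (simp add: field_simps)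
        then have "1 / x \<le> (2 / \<bar>l\<bar> * \<bar>f x\<bar>) / x" using x by (intro divide_right_mono) auto
        also have "\<dots> = 2 / \<bar>l\<bar> * \<bar>f x / x\<bar>" using x by (simp add: abs_divide)
        finally show ?thesis using d(1) by (simp add: add_increasing2)
      next
        case False
        then have "1 / x \<le> 1 / d" using d(1) x by (simp add: frac_le)
        then show ?thesis by (simp add: add_increasing)
      qed
      then show "norm (1 / x) \<le> norm (2 / \<bar>l\<bar> * \<bar>f x / x\<bar> + 1 / d)" using x by simp
    qed
  qed
  then show False using not_integrable_inverse by simp
qed

section \<open>Growth bounds for the degenerate coefficient\<close>

lemma at_within_Ioc_1: "0 < x \<Longrightarrow> x < 1 \<Longrightarrow> at x within {0<..1::real} = at x"
  by (rule at_within_nhd[of _ "{0<..<1}"]) auto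

locale degenerate =
  fixes a :: "real \<Rightarrow> real"
  assumes coefficient: "degenerate_coefficient a"
begin

abbreviation "a' \<equiv> deriv_on {0<..1} a"

lemma a_pos: "0 < x \<Longrightarrow> x \<le> 1 \<Longrightarrow> a x > 0"
  using coefficient by (auto simp: degenerate_coefficient_def)

lemma a_continuous: "continuous_on {0..1} a"
  using coefficient by (auto simp: degenerate_coefficient_def)

lemma a_deriv: "x \<in> {0<..1} \<Longrightarrow> (a has_real_derivative a' x) (at x within {0<..1})"
  using coefficient unfolding degenerate_coefficient_def C1_on_def deriv_on_def
    has_real_derivative_iff_has_vector_derivative
  by (metis differentiable_on_def vector_derivative_works)

lemma a_DERIV: "0 < x \<Longrightarrow> x < 1 \<Longrightarrow> DERIV a x :> a' x"
  using a_deriv[of x] by (simp add: at_within_Ioc_1)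

lemma a'_continuous: "continuous_on {0<..1} a'"
  using coefficient by (auto simp: degenerate_coefficient_def C1_on_def)

lemma mu_bound: "x \<in> {0<..1} \<Longrightarrow> x * \<bar>a' x\<bar> \<le> mu a * a x"
proof -
  assume x: "x \<in> {0<..1}"
  have "log_slope a x \<le> mu a"
    unfolding mu_def using coefficient x by (intro cSUP_upper) (auto simp: degenerate_coefficient_def)
  then show ?thesis using x a_pos[of x] by (simp add: log_slope_def pos_divide_le_eq)
qed

lemma mu_nonneg: "0 \<le> mu a"
proof -
  have "0 \<le> log_slope a 1" using a_pos[of 1] by (simp add: log_slope_def)
  also have "\<dots> \<le> mu a"
    unfolding mu_def using coefficient by (intro cSUP_upper) (auto simp: degenerate_coefficient_def)
  finally show ?thesis .
qed

lemma mu_less_2: "mu a < 2"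
  using coefficient by (auto simp: degenerate_coefficient_def)

lemma a_1_pos: "a 1 > 0" by (rule a_pos) auto

text \<open>By \<open>z * a' z \<le> mu a * a z\<close> the function \<open>a z * z powr - s\<close>
  is nonincreasing, so it is at least its value at 1. The exponents used later are 2, 1 when
  \<open>mu a \<le> 1\<close>, and \<open>mu a\<close> itself for the integrability of
  \<open>1 / a\<close>.\<close>

lemma a_ge_powr:
  assumes s: "mu a \<le> s" and x: "0 < x" "x \<le> 1"
  shows "a 1 * x powr s \<le> a x"
proof (cases "x = 1")
  case False
  have "a 1 * 1 powr - s \<le> a x * x powr - s"
  proof (rule DERIV_nonpos_imp_decreasing_open[of x 1 "\<lambda>z. a z * z powr - s"])
    show "continuous_on {x..1} (\<lambda>z. a z * z powr - s)"
      using x by (intro continuous_intros continuous_on_subset[OF a_continuous]) auto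
    fix z assume z: "x < z" "z < 1"
    have z0: "0 < z" using z x by simp
    have le: "z * a' z \<le> s * a z"
    proof -
      have "z * a' z \<le> z * \<bar>a' z\<bar>" using z0 by (intro mult_left_mono) auto
      also have "\<dots> \<le> mu a * a z" using mu_bound[of z] z z0 by simp
      also have "\<dots> \<le> s * a z" using s a_pos[of z] z z0 by (intro mult_right_mono) auto
      finally show ?thesis .
    qed
    have "DERIV (\<lambda>z. a z * z powr - s) z :> a' z * z powr - s + (- s * z powr (- s - 1)) * a z"
      using z0 z by (intro DERIV_mult a_DERIV has_real_derivative_powr) auto
    moreover have "a' z * z powr - s + (- s * z powr (- s - 1)) * a z = z powr (- s - 1) * (z * a' z - s * a z)"
      using z0 powr_mult_base[of z "- s - 1"] by (simp add: algebra_simps)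
    moreover have "\<dots> \<le> 0" using le by (intro mult_nonneg_nonpos) auto
    ultimately show "\<exists>y. DERIV (\<lambda>z. a z * z powr - s) z :> y \<and> y \<le> 0" by metis
  qed (use x False in auto)
  then have "a 1 * x powr s \<le> a x * x powr - s * x powr s" by (intro mult_right_mono) auto
  also have "\<dots> = a x" using x by (simp add: powr_minus)
  finally show ?thesis .
qed simp

lemma a_ge_power:
  assumes "mu a \<le> real m" "0 < x" "x \<le> 1"
  shows "a 1 * x ^ m \<le> a x"
  using a_ge_powr[OF assms] assms by (simp add: powr_realpow)

lemma a_ge_square: "0 < x \<Longrightarrow> x \<le> 1 \<Longrightarrow> a 1 * x\<^sup>2 \<le> a x"
  using a_ge_power[of 2 x] mu_less_2 by simp

lemma a_measurable: "a \<in> borel_measurable leb"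
  by (rule continuous_on_measurable_lebesgue_on) (auto intro: continuous_on_subset[OF a_continuous])

lemma a'_measurable: "a' \<in> borel_measurable leb"
  by (rule continuous_on_measurable_lebesgue_on) (auto intro: continuous_on_subset[OF a'_continuous])

subsection \<open>The weighted Sobolev space\<close>

abbreviation sderiv :: "(real \<Rightarrow> real) \<Rightarrow> real \<Rightarrow> real" where
  "sderiv u \<equiv> \<lambda>x. sqrt (a x) * deriv u x"

lemma V1_L2: "u \<in> V1 a \<Longrightarrow> u \<in> L2 1" by (simp add: V1_def)

lemma V1_loc_abs_cont: "u \<in> V1 a \<Longrightarrow> loc_abs_cont u" by (simp add: V1_def)

lemma V1_sderiv: "u \<in> V1 a \<Longrightarrow> sderiv u \<in> L2 1" by (simp add: V1_def)

lemma sderiv_mult: "x \<in> {0<..<1} \<Longrightarrow> sderiv u x * sderiv w x = a x * deriv u x * deriv w x"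
proof -
  assume "x \<in> {0<..<1}"
  then have "sqrt (a x) * sqrt (a x) = a x" using a_pos[of x] by simp
  then show ?thesis by (metis (no_types, opaque_lifting) mult.assoc mult.left_commute)
qed

lemma V1_energy_integrable:
  assumes "u \<in> V1 a" "w \<in> V1 a"
  shows "integrable leb (\<lambda>x. a x * deriv u x * deriv w x)"
proof -
  have "integrable leb (\<lambda>x. sderiv u x * sderiv w x)"
    using assms by (intro L2_mult_integrable V1_sderiv)
  then show ?thesis
    by (rule Bochner_Integration.integrable_cong[THEN iffD1, rotated -1]) (auto simp: sderiv_mult)
qed

lemma V1_energy_LINT:
  "(LINT x|leb. a x * deriv u x * deriv w x) = (LINT x|leb. sderiv u x * sderiv w x)"
  by (rule Bochner_Integration.integral_cong) (auto simp: sderiv_mult)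

lemma V1_deriv_measurable:
  assumes "u \<in> V1 a" shows "deriv u \<in> borel_measurable leb"
proof -
  have "(\<lambda>x. sderiv u x / sqrt (a x)) \<in> borel_measurable leb"
    using L2_measurable[OF V1_sderiv[OF assms]] a_measurable by measurable
  then show ?thesis
    by (rule measurable_cong[THEN iffD1, rotated]) (use a_pos in \<open>auto simp: less_le\<close>)
qed

lemma x_div_sqrt_a_measurable: "(\<lambda>x. x / sqrt (a x)) \<in> borel_measurable leb"
proof -
  have [measurable]: "(\<lambda>x. x) \<in> borel_measurable leb"
    by (rule continuous_on_measurable_lebesgue_on) (rule continuous_on_id)
  show ?thesis using a_measurable by measurable
qed

lemma x_div_sqrt_a_bound:
  assumes "0 < x" "x \<le> 1" shows "\<bar>x / sqrt (a x)\<bar> \<le> 1 / sqrt (a 1)"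
proof -
  have "sqrt (a 1) * x = sqrt (a 1 * x\<^sup>2)" using assms by (simp add: real_sqrt_mult)
  also have "\<dots> \<le> sqrt (a x)" using a_ge_square[OF assms] by simp
  finally show ?thesis using a_1_pos a_pos[OF assms] assms by (simp add: field_simps)
qed

text \<open>The function \<open>x / sqrt (a x)\<close> is bounded because \<open>a\<close> dominates
  \<open>a 1 * x^2\<close>; here \<open>mu a < 2\<close> makes the multiplier
  \<open>x * deriv u x\<close> square integrable.\<close>

lemma V1_x_deriv_L2:
  assumes "u \<in> V1 a" shows "(\<lambda>x. x * deriv u x) \<in> L2 1"
proof -
  have "(\<lambda>x. x / sqrt (a x) * sderiv u x) \<in> L2 1"
    by (rule L2_bounded_mult[OF V1_sderiv[OF assms] x_div_sqrt_a_measurable], rule x_div_sqrt_a_bound) auto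
  then show ?thesis by (rule L2_cong) (use a_pos in \<open>auto simp: less_le\<close>)
qed

lemma x_square_le_energy:
  assumes x: "0 < x" "x \<le> 1" shows "(x * d)\<^sup>2 \<le> 1 / a 1 * (a x * d\<^sup>2)"
proof -
  have "a 1 * x\<^sup>2 * d\<^sup>2 \<le> a x * d\<^sup>2" by (intro mult_right_mono a_ge_square x) auto
  then show ?thesis using a_1_pos by (simp add: field_simps power_mult_distrib)
qed

lemma deriv_lincomb_AE:
  assumes "loc_abs_cont u" "loc_abs_cont w"
  shows "AE x in leb. deriv (\<lambda>x. c * u x + d * w x) x = c * deriv u x + d * deriv w x"
  using loc_abs_cont_DERIV_AE[OF assms(1)] loc_abs_cont_DERIV_AE[OF assms(2)]
  by eventually_elim (auto intro!: DERIV_imp_deriv derivative_eq_intros)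

lemma V1_lincomb:
  assumes "u \<in> V1 a" "w \<in> V1 a"
  shows "(\<lambda>x. c * u x + d * w x) \<in> V1 a"
proof -
  have "sderiv (\<lambda>x. c * u x + d * w x) \<in> L2 1"
  proof (rule L2_cong_AE)
    show "(\<lambda>x. c * sderiv u x + d * sderiv w x) \<in> L2 1"
      using assms by (intro L2_lincomb V1_sderiv)
    show "AE x in leb. c * sderiv u x + d * sderiv w x = sderiv (\<lambda>x. c * u x + d * w x) x"
      using deriv_lincomb_AE[OF assms[THEN V1_loc_abs_cont], of c d]
      by eventually_elim (simp add: algebra_simps)
  qed
  then show ?thesis
    using assms unfolding V1_def by (auto intro: L2_lincomb loc_abs_cont_lincomb)
qed

lemma H1a_lincomb:
  assumes "u \<in> H1a a" "w \<in> H1a a"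
  shows "(\<lambda>x. c * u x + d * w x) \<in> H1a a"
proof -
  have "((\<lambda>x. c * u x + d * w x) \<longlongrightarrow> c * 0 + d * 0) (at_right 0)" if "mu a < 1"
    using assms that by (intro tendsto_intros) (auto simp: H1a_def)
  then show ?thesis using assms V1_lincomb[of u w c d] by (auto simp: H1a_def)
qed

text \<open>The derivative of \<open>x * (u x)^2\<close> is integrable, so this product has a limit
  at 0; dividing it by \<open>x\<close> leaves the integrable \<open>(u x)^2\<close>, so the limit
  is 0.\<close>

lemma V1_square_parts:
  assumes u: "u \<in> V1 a"
  shows "(LINT x|leb. (u x)\<^sup>2 + 2 * (u x * (x * deriv u x))) = (u 1)\<^sup>2" (is ?A)
    and "((\<lambda>x. x * (u x)\<^sup>2) \<longlongrightarrow> 0) (at_right 0)" (is ?B)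
proof -
  let ?f = "\<lambda>x. x * (u x * u x)"
  let ?g = "\<lambda>x. (u x)\<^sup>2 + 2 * (u x * (x * deriv u x))"
  note lac = V1_loc_abs_cont[OF u]
  have lx: "loc_abs_cont (\<lambda>x. x)"
    by (rule C1_loc_abs_cont[of _ "\<lambda>x. 1"]) (auto intro!: derivative_eq_intros)
  have "loc_abs_cont ?f" by (intro loc_abs_cont_mult lx lac)
  moreover have "integrable leb ?g"
    using V1_L2[OF u] V1_x_deriv_L2[OF u]
    by (intro Bochner_Integration.integrable_add integrable_mult_right L2_mult_integrable L2_integrable)
  moreover have "AE x in leb. DERIV ?f x :> ?g x"
    using loc_abs_cont_DERIV_AE[OF lac]
    by eventually_elim (auto intro!: derivative_eq_intros simp: power2_eq_square algebra_simps)
  ultimately have lim: "(?f \<longlongrightarrow> ?f 1 - (LINT x|leb. ?g x)) (at_right 0)"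
    by (rule loc_abs_cont_tendsto_at_0)
  moreover have "integrable leb (\<lambda>x. ?f x / x)"
    by (rule Bochner_Integration.integrable_cong[THEN iffD1, OF refl _ L2_integrable[OF V1_L2[OF u]]])
      (auto simp: power2_eq_square)
  ultimately have z: "?f 1 - (LINT x|leb. ?g x) = 0" by (rule tendsto_0_if_quotient_integrable)
  then show ?A by (simp add: power2_eq_square)
  show ?B using lim unfolding z by (simp add: power2_eq_square)
qed

text \<open>The weight \<open>x + c x\<^sup>2\<close> with \<open>c = 0\<close> is used for \<open>\<mu> \<ge> 1\<close> and with \<open>c = 1\<close> for \<open>\<mu> \<le> 1\<close>. It
  yields the constant \<^const>\<open>poincare_const\<close> up to a factor of at most 4, which the observability
  time can afford.\<close>

lemma Poincare:
  assumes u: "u \<in> H1a a"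
  shows "(LINT x|leb. (u x)\<^sup>2) \<le> 4 * poincare_const a * (LINT x|leb. a x * deriv u x * deriv u x)"
proof -
  have uV: "u \<in> V1 a" and u1: "u 1 = 0" using u by (auto simp: H1a_def)
  note lac = V1_loc_abs_cont[OF uV] and uL = V1_L2[OF uV]
  let ?E = "LINT x|leb. a x * deriv u x * deriv u x"
  have E0: "?E \<ge> 0" unfolding V1_energy_LINT by simp
  have iE: "integrable leb (\<lambda>x. a x * deriv u x * deriv u x)" by (rule V1_energy_integrable[OF uV uV])
  have iu: "integrable leb (\<lambda>x. (u x)\<^sup>2)" by (rule L2_integrable[OF uL])
  have i1: "integrable leb (\<lambda>x. (u x)\<^sup>2 + 2 * (u x * (x * deriv u x)))"
    using uL V1_x_deriv_L2[OF uV]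
    by (intro Bochner_Integration.integrable_add integrable_mult_right L2_mult_integrable L2_integrable)
  show ?thesis
  proof (cases "mu a \<le> 1")
    case False
    have "1 / 2 * (u x)\<^sup>2 - 2 / a 1 * (a x * deriv u x * deriv u x) \<le> (u x)\<^sup>2 + 2 * (u x * (x * deriv u x))"
      if "x \<in> space leb" for x
    proof -
      have "2 * (x * deriv u x)\<^sup>2 \<le> 2 / a 1 * (a x * deriv u x * deriv u x)"
        using x_square_le_energy[of x "deriv u x"] that by (simp add: power2_eq_square)
      \<comment> \<open>Young's inequality with weights such that half of \<open>(u x)^2\<close>
        survives; together with the vanishing integral this gives the constant
        \<open>4 / a 1\<close>.\<close>
      moreover have "0 \<le> 1 / 2 * (u x)\<^sup>2 + 2 * (u x * (x * deriv u x)) + 2 * (x * deriv u x)\<^sup>2"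
      proof -
        have "0 \<le> 1 / 2 * (u x + 2 * (x * deriv u x))\<^sup>2" by simp
        then show ?thesis by (simp add: power2_eq_square algebra_simps)
      qed
      ultimately show ?thesis by linarith
    qed
    then have "(LINT x|leb. 1 / 2 * (u x)\<^sup>2 - 2 / a 1 * (a x * deriv u x * deriv u x)) \<le>
        (LINT x|leb. (u x)\<^sup>2 + 2 * (u x * (x * deriv u x)))"
      by (intro integral_mono i1 Bochner_Integration.integrable_diff integrable_mult_right iu iE)
    also have "\<dots> = 0" using V1_square_parts(1)[OF uV] u1 by simp
    finally have "1 / 2 * (LINT x|leb. (u x)\<^sup>2) \<le> 2 / a 1 * ?E"
      using iu iE by (simp add: Bochner_Integration.integral_diff)
    \<comment> \<open>For \<open>mu a > 1\<close> the minimum in \<open>poincare_const\<close> is at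
      least 1, so \<open>4 / a 1\<close> is at most \<open>4 * poincare_const a\<close>.\<close>
    moreover have "1 \<le> min 4 (1 / (2 - mu a))" using False mu_less_2 by (simp add: field_simps)
    then have "1 / a 1 * 1 * ?E \<le> 1 / a 1 * min 4 (1 / (2 - mu a)) * ?E"
      using E0 a_1_pos by (intro mult_right_mono mult_left_mono) auto
    ultimately show ?thesis unfolding poincare_const_def by simp
  next
    case True
    \<comment> \<open>Here \<open>4 * poincare_const a\<close> can be as small as
      \<open>2 / a 1\<close>, half of what the weight \<open>x\<close> yields. The quadratic term in
      the weight gains the factor 2, using the stronger bound
      \<open>a 1 * x \<le> a x\<close>.\<close>
    have lw: "loc_abs_cont (\<lambda>x. x + x\<^sup>2)"
      by (rule C1_loc_abs_cont[of _ "\<lambda>x. 1 + 2 * x"]) (auto intro!: derivative_eq_intros continuous_intros)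
    let ?f = "\<lambda>x. (x + x\<^sup>2) * (u x * u x)"
    let ?g = "\<lambda>x. (1 + 2 * x) * (u x * u x) + 2 * (1 + x) * (u x * (x * deriv u x))"
    have mx: "(\<lambda>x. 1 + 2 * x) \<in> borel_measurable leb" "(\<lambda>x. 2 * (1 + x)) \<in> borel_measurable leb"
      "(\<lambda>x. 1 + x) \<in> borel_measurable leb"
      by (auto intro!: continuous_on_measurable_lebesgue_on continuous_intros)
    have L: "(\<lambda>x. (1 + 2 * x) * u x) \<in> L2 1" "(\<lambda>x. 2 * (1 + x) * u x) \<in> L2 1" "(\<lambda>x. (1 + x) * u x) \<in> L2 1"
      using L2_bounded_mult[OF uL mx(1), of 3] L2_bounded_mult[OF uL mx(2), of 4] L2_bounded_mult[OF uL mx(3), of 2] by auto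
    have ig: "integrable leb ?g"
      using L2_mult_integrable[OF L(1) uL] L2_mult_integrable[OF L(2) V1_x_deriv_L2[OF uV]]
      by (simp add: mult.assoc)
    have "loc_abs_cont ?f" by (intro loc_abs_cont_mult lw lac)
    moreover note ig
    moreover have "AE x in leb. DERIV ?f x :> ?g x"
      using loc_abs_cont_DERIV_AE[OF lac]
      by eventually_elim (auto intro!: derivative_eq_intros simp: power2_eq_square algebra_simps)
    ultimately have lim: "(?f \<longlongrightarrow> ?f 1 - (LINT x|leb. ?g x)) (at_right 0)"
      by (rule loc_abs_cont_tendsto_at_0)
    moreover have "integrable leb (\<lambda>x. ?f x / x)"
      by (rule Bochner_Integration.integrable_cong[THEN iffD1, OF refl _ L2_mult_integrable[OF L(3) uL]])
        (auto simp: power2_eq_square field_simps)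
    ultimately have z: "(LINT x|leb. ?g x) = 0" using u1 by (auto dest: tendsto_0_if_quotient_integrable)
    have "(u x)\<^sup>2 - 2 / a 1 * (a x * deriv u x * deriv u x) \<le> ?g x" if "x \<in> space leb" for x
    proof -
      have x: "0 < x" "x < 1" using that by auto
      define d where "d = deriv u x"
      have "a 1 * x ^ 1 \<le> a x" using True x by (intro a_ge_power) auto
      then have "a 1 * x * d\<^sup>2 \<le> a x * d\<^sup>2" by (intro mult_right_mono) auto
      then have "2 * x * d\<^sup>2 \<le> 2 / a 1 * (a x * d * d)"
        using a_1_pos by (simp add: field_simps power2_eq_square)
      moreover have "0 \<le> (u x)\<^sup>2 + (1 + x) * (u x * d) + d\<^sup>2"
      proof -
        \<comment> \<open>Completing the square; the remainder is nonnegative since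
          \<open>(1 + x) / 2\<close> is at most 1.\<close>
        have "0 \<le> (u x + (1 + x) / 2 * d)\<^sup>2 + (1 - ((1 + x) / 2)\<^sup>2) * d\<^sup>2"
          using x by (intro add_nonneg_nonneg mult_nonneg_nonneg) (auto simp: power_le_one)
        then show ?thesis by (simp add: power2_eq_square algebra_simps)
      qed
      then have "0 \<le> 2 * x * ((u x)\<^sup>2 + (1 + x) * (u x * d) + d\<^sup>2)" using x by simp
      ultimately have "(u x)\<^sup>2 - 2 / a 1 * (a x * d * d) \<le> (1 + 2 * x) * (u x * u x) + 2 * (1 + x) * (u x * (x * d))"
        by (simp add: power2_eq_square algebra_simps)
      then show ?thesis by (simp add: d_def)
    qed
    then have "(LINT x|leb. (u x)\<^sup>2 - 2 / a 1 * (a x * deriv u x * deriv u x)) \<le> (LINT x|leb. ?g x)"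
      by (intro integral_mono ig Bochner_Integration.integrable_diff integrable_mult_right iu iE)
    then have "(LINT x|leb. (u x)\<^sup>2) \<le> 2 / a 1 * ?E"
      using iu iE z by (simp add: Bochner_Integration.integral_diff)
    moreover have "1 / 2 \<le> min 4 (1 / (2 - mu a))" using True mu_nonneg by (simp add: field_simps)
    then have "1 / a 1 * (1 / 2) * ?E \<le> 1 / a 1 * min 4 (1 / (2 - mu a)) * ?E"
      using E0 a_1_pos by (intro mult_right_mono mult_left_mono) auto
    ultimately show ?thesis unfolding poincare_const_def by simp
  qed
qed

subsection \<open>The domain of the wave operator\<close>

text \<open>The flux agrees almost everywhere with an absolutely continuous \<open>h\<close>, so
  \<open>u\<close> is an integral of the continuous function \<open>h / a\<close>. Hence
  \<open>u\<close> is continuously differentiable on \<open>{0<..1}\<close>, and identities that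
  held almost everywhere hold at every point, including the one-sided derivative at 1 that defines
  the trace.\<close>

lemma V2_flux:
  assumes u: "u \<in> V2 a"
  obtains h where "abs_cont_on {0..1} h" "deriv h \<in> L2 1"
    "\<And>x. 0 < x \<Longrightarrow> x < 1 \<Longrightarrow> a x * deriv u x = h x"
    "\<And>x. 0 < x \<Longrightarrow> x < 1 \<Longrightarrow> deriv (\<lambda>x. a x * deriv u x) x = deriv h x"
    "a 1 * deriv_on {0<..1} u 1 = h 1"
    "(u has_real_derivative deriv_on {0<..1} u 1) (at 1 within {0<..1})"
    "\<And>x. 0 < x \<Longrightarrow> x < 1 \<Longrightarrow> DERIV u x :> deriv u x"
proof -
  from u have uV: "u \<in> V1 a" and "(\<lambda>x. a x * deriv u x) \<in> H1" by (auto simp: V2_def)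
  then obtain h where h: "abs_cont_on {0..1} h" "deriv h \<in> L2 1" "eq_ae (\<lambda>x. a x * deriv u x) h"
    by (auto simp: H1_def)
  note lac = V1_loc_abs_cont[OF uV]
  obtain N where N: "negligible N" "\<And>x. x \<in> {0<..<1} - N \<Longrightarrow> a x * deriv u x = h x"
    using AE_lebesgue_on_obtain_negligible[OF h(3)[unfolded eq_ae_def]] by metis
  let ?d = "\<lambda>x. h x / a x"
  have cd: "continuous_on {0<..1} ?d"
    using a_pos by (intro continuous_intros continuous_on_subset[OF a_continuous]
      continuous_on_subset[OF abs_cont_on_continuous[OF h(1)]]) (auto simp: less_le)
  have int: "(?d has_integral u y - u x) {x..y}" if xy: "0 < x" "x \<le> y" "y \<le> 1" for x y
  proof (rule has_integral_spike[OF _ _ loc_abs_cont_has_integral[OF lac xy]])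
    show "negligible (N \<union> {1})" using N(1) by (intro negligible_Un) (auto simp: negligible_finite)
    show "?d z = deriv u z" if z: "z \<in> {x..y} - (N \<union> {1})" for z
    proof -
      have "z \<in> {0<..<1} - N" "a z > 0" using z xy by (auto intro!: a_pos)
      then show ?thesis using N(2)[of z] by (metis less_numeral_extra(3) nonzero_mult_div_cancel_left)
    qed
  qed
  have D: "(u has_real_derivative ?d x) (at x within {0<..1})" if x: "0 < x" "x \<le> 1" for x
  proof -
    have c: "continuous_on {x/2..1} ?d" using x by (auto intro: continuous_on_subset[OF cd])
    have "((\<lambda>y. integral {x/2..y} ?d) has_real_derivative ?d x) (at x within {x/2..1})"
      using x by (intro integral_has_real_derivative c) auto
    then have "((\<lambda>y. u (x/2) + integral {x/2..y} ?d) has_real_derivative ?d x) (at x within {x/2..1})"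
      by (auto intro!: derivative_eq_intros)
    then have "(u has_real_derivative ?d x) (at x within {x/2..1})"
      by (rule has_field_derivative_transform_within[of _ _ _ _ 1])
        (use x in \<open>auto simp: integral_unique[OF int]\<close>)
    also have "at x within {x/2..1} = at x within {0<..1}"
      by (rule at_within_nhd[of _ "{x/2<..}"]) (use x in auto)
    finally show ?thesis .
  qed
  have D': "DERIV u x :> ?d x" if "0 < x" "x < 1" for x
    using D[of x] that by (simp add: at_within_Ioc_1)
  have eq: "a x * deriv u x = h x" if "0 < x" "x < 1" for x
    using DERIV_imp_deriv[OF D'[OF that]] a_pos[of x] that by simp
  have D1: "deriv_on {0<..1} u 1 = ?d 1"
    unfolding deriv_on_def
  proof (rule vector_derivative_within)
    have "at (1::real) within {0<..1} = at_left 1"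
      by (rule at_within_nhd[of _ "{0<..}"]) auto
    then show "at (1::real) within {0<..1} \<noteq> bot" by simp
    show "(u has_vector_derivative ?d 1) (at 1 within {0<..1})"
      using D[of 1] by (simp add: has_real_derivative_iff_has_vector_derivative)
  qed
  show thesis
  proof (rule that[OF h(1,2) eq])
    show "deriv (\<lambda>x. a x * deriv u x) x = deriv h x" if "0 < x" "x < 1" for x
    proof (rule deriv_cong_ev)
      have "\<forall>\<^sub>F z in nhds x. z \<in> {0<..<1}" using that by (intro eventually_nhds_in_open) auto
      then show "\<forall>\<^sub>F x in nhds x. a x * deriv u x = h x"
        by eventually_elim (auto intro: eq)
    qed simp
    show "a 1 * deriv_on {0<..1} u 1 = h 1" using D1 a_1_pos by simp
    show "(u has_real_derivative deriv_on {0<..1} u 1) (at 1 within {0<..1})" using D[of 1] D1 by simp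
    show "DERIV u x :> deriv u x" if "0 < x" "x < 1" for x
      using D'[OF that] DERIV_imp_deriv by metis
  qed auto
qed

lemma V2_deriv_flux_L2:
  assumes u: "u \<in> V2 a" shows "deriv (\<lambda>x. a x * deriv u x) \<in> L2 1"
proof -
  obtain h where h: "deriv h \<in> L2 1" "\<And>x. 0 < x \<Longrightarrow> x < 1 \<Longrightarrow> deriv (\<lambda>x. a x * deriv u x) x = deriv h x"
    by (rule V2_flux[OF u], rule that)
  show ?thesis by (rule L2_cong[OF h(1)]) (use h(2) in auto)
qed

text \<open>The Neumann condition is automatic: \<open>a\<close> is continuously differentiable up
  to 0 with \<open>a 0 = 0\<close>, so \<open>a x \<le> B * x\<close>, and
  \<open>(h x)^2 / x\<close> is dominated by the integrable energy density.\<close>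

lemma flux_zero_at_0:
  assumes u: "u \<in> V1 a" and h: "(h \<longlongrightarrow> l) (at_right 0)" "h \<in> borel_measurable leb"
    and eq: "\<And>x. 0 < x \<Longrightarrow> x < 1 \<Longrightarrow> a x * deriv u x = h x" and mu: "1 \<le> mu a"
  shows "l = 0"
proof -
  have C1: "C1_on {0..1} a" using coefficient mu by (auto simp: degenerate_coefficient_def)
  define b where "b = deriv_on {0..1} a"
  have b: "(a has_real_derivative b x) (at x within {0..1})" if "x \<in> {0..1}" for x
    using C1 that unfolding b_def C1_on_def deriv_on_def has_real_derivative_iff_has_vector_derivative
    by (metis differentiable_on_def vector_derivative_works)
  have "compact (b ` {0..1})"
    using C1 unfolding b_def C1_on_def by (intro compact_continuous_image) auto
  then obtain B where B: "\<And>x. x \<in> {0..1} \<Longrightarrow> \<bar>b x\<bar> \<le> B"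
    by (metis compact_imp_bounded bounded_iff imageI real_norm_def)
  have aB: "a x \<le> B * x" if "0 < x" "x < 1" for x
  proof -
    have "norm (a x - a 0) \<le> B * norm (x - 0)"
      by (rule field_differentiable_bound[of "{0..1}" a b]) (use b B that in auto)
    moreover have "a 0 = 0" using coefficient by (auto simp: degenerate_coefficient_def)
    ultimately show ?thesis using that by auto
  qed
  have "((\<lambda>x. (h x)\<^sup>2) \<longlongrightarrow> l\<^sup>2) (at_right 0)" by (intro tendsto_intros h)
  moreover have "integrable leb (\<lambda>x. (h x)\<^sup>2 / x)"
  proof (rule Bochner_Integration.integrable_bound)
    show "integrable leb (\<lambda>x. B * (a x * deriv u x * deriv u x))"
      by (intro integrable_mult_right V1_energy_integrable u)
    have [measurable]: "(\<lambda>x. x) \<in> borel_measurable leb"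
      by (rule continuous_on_measurable_lebesgue_on) (rule continuous_on_id)
    show "(\<lambda>x. (h x)\<^sup>2 / x) \<in> borel_measurable leb" using h(2) by measurable
    show "AE x in leb. norm ((h x)\<^sup>2 / x) \<le> norm (B * (a x * deriv u x * deriv u x))"
    proof (rule AE_I2)
      fix x assume "x \<in> space leb"
      then have x: "0 < x" "x < 1" by auto
      have "(h x)\<^sup>2 = a x * (a x * deriv u x * deriv u x)" unfolding eq[OF x, symmetric] by (simp add: power2_eq_square)
      also have "\<dots> \<le> (B * x) * (a x * deriv u x * deriv u x)"
      proof (rule mult_right_mono[OF aB[OF x]])
        have "0 \<le> a x * (deriv u x)\<^sup>2" using a_pos[of x] x by simp
        then show "0 \<le> a x * deriv u x * deriv u x" by (simp add: power2_eq_square mult.assoc)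
      qed
      finally have "(h x)\<^sup>2 / x \<le> B * (a x * deriv u x * deriv u x)"
        using x by (simp add: pos_divide_le_eq mult_ac)
      then show "norm ((h x)\<^sup>2 / x) \<le> norm (B * (a x * deriv u x * deriv u x))" using x by auto
    qed
  qed
  ultimately have "l\<^sup>2 = 0" by (rule tendsto_0_if_quotient_integrable)
  then show ?thesis by simp
qed

text \<open>Only the rate \<open>sqrt x\<close> matters, not the constant. A pointwise Young
  inequality with weights depending on \<open>x\<close> takes the place of Cauchy-Schwarz on
  \<open>{0..x}\<close>.\<close>

lemma abs_le_sqrt_if_deriv_L2:
  assumes h: "abs_cont_on {0..1} h" "deriv h \<in> L2 1" "h 0 = 0" and x: "0 < x" "x < 1"
  shows "\<bar>h x\<bar> \<le> (1 + (LINT x|leb. (deriv h x)\<^sup>2)) / 2 * sqrt x"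
proof -
  let ?K = "LINT x|leb. (deriv h x)\<^sup>2"
  let ?r = "1 / sqrt x"
  have Kint: "((\<lambda>x. (deriv h x)\<^sup>2) has_integral ?K) {0..1}"
    unfolding has_integral_Icc_iff_Ioo
    by (rule has_integral_integral_lebesgue_on[OF L2_integrable[OF h(2)]]) simp
  have i2: "(\<lambda>x. (deriv h x)\<^sup>2) integrable_on {0..x}"
    by (rule integrable_on_subinterval[OF has_integral_integrable[OF Kint]]) (use x in auto)
  have Kle: "integral {0..x} (\<lambda>x. (deriv h x)\<^sup>2) \<le> ?K"
    using Kint x by (subst integral_unique[OF Kint, symmetric])
      (intro integral_subset_le i2, auto intro: has_integral_integrable)
  have hi: "(deriv h has_integral h x) {0..x}"
    using abs_cont_on_differentiable_AE[OF h(1)] h(3) x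
    by (metis diff_zero less_eq_real_def order_refl zero_less_one)
  have bound: "((\<lambda>z. ?r / 2 + sqrt x / 2 * (deriv h z)\<^sup>2) has_integral ?r / 2 * x + sqrt x / 2 * integral {0..x} (\<lambda>x. (deriv h x)\<^sup>2)) {0..x}"
    using has_integral_const_real[of "?r / 2" 0 x] integrable_integral[OF i2] x
    by (intro has_integral_add has_integral_mult_right) (auto simp: mult.commute)
  \<comment> \<open>The weight \<open>sqrt x\<close> makes both terms of order \<open>sqrt x\<close>
    after integration over an interval of length \<open>x\<close>.\<close>
  have young: "\<bar>d\<bar> \<le> ?r / 2 + sqrt x / 2 * d\<^sup>2" for d :: real
  proof -
    have "0 \<le> (1 - sqrt x * \<bar>d\<bar>)\<^sup>2 / (2 * sqrt x)" using x by simp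
    also have "\<dots> = ?r / 2 + sqrt x / 2 * d\<^sup>2 - \<bar>d\<bar>"
      using x by (simp add: power2_eq_square field_simps)
    finally show ?thesis by simp
  qed
  have "norm (h x) \<le> ?r / 2 * x + sqrt x / 2 * integral {0..x} (\<lambda>x. (deriv h x)\<^sup>2)"
    unfolding integral_unique[OF hi, symmetric] integral_unique[OF bound, symmetric]
    by (rule integral_norm_bound_integral) (use hi bound young in \<open>auto intro: has_integral_integrable\<close>)
  also have "?r / 2 * x = sqrt x / 2" using x by (simp add: real_div_sqrt)
  also have "sqrt x / 2 + sqrt x / 2 * integral {0..x} (\<lambda>x. (deriv h x)\<^sup>2) \<le> sqrt x / 2 + sqrt x / 2 * ?K"
    using Kle x by (intro add_left_mono mult_left_mono) auto
  finally show ?thesis by (simp add: field_simps)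
qed

text \<open>For \<open>mu a < 1\<close> the factor \<open>v\<close> tends to 0 and the flux stays
  bounded. Otherwise \<open>v\<close> may blow up, but the flux is \<open>O(sqrt x)\<close> and
  \<open>x * (v x)^2\<close> tends to 0.\<close>

lemma flux_mult_tendsto_0:
  assumes u: "u \<in> V1 a" and v: "v \<in> H1a a"
    and h: "abs_cont_on {0..1} h" "deriv h \<in> L2 1"
    and eq: "\<And>x. 0 < x \<Longrightarrow> x < 1 \<Longrightarrow> a x * deriv u x = h x"
  shows "((\<lambda>x. h x * v x) \<longlongrightarrow> 0) (at_right 0)"
proof -
  have vV: "v \<in> V1 a" using v by (auto simp: H1a_def)
  have "(h \<longlongrightarrow> h 0) (at 0 within {0..1})"
    using abs_cont_on_continuous[OF h(1)] by (auto simp: continuous_on_def)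
  then have h0: "(h \<longlongrightarrow> h 0) (at_right 0)" by (simp add: at_within_Icc_at_right)
  show ?thesis
  proof (cases "mu a < 1")
    case True
    then have "(v \<longlongrightarrow> 0) (at_right 0)" using v by (auto simp: H1a_def)
    from tendsto_mult[OF h0 this] show ?thesis by simp
  next
    case False
    have hm: "h \<in> borel_measurable leb"
      by (rule loc_abs_cont_measurable[OF abs_cont_on_loc_abs_cont[OF h(1)]])
    have "h 0 = 0" by (rule flux_zero_at_0[OF u h0 hm eq]) (use False in auto)
    note hb = abs_le_sqrt_if_deriv_L2[OF h this]
    define K where "K = (1 + (LINT x|leb. (deriv h x)\<^sup>2)) / 2"
    have "((\<lambda>x. K * sqrt (x * (v x)\<^sup>2)) \<longlongrightarrow> K * sqrt 0) (at_right 0)"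
      by (intro tendsto_intros V1_square_parts(2)[OF vV])
    then have lim: "((\<lambda>x. K * sqrt (x * (v x)\<^sup>2)) \<longlongrightarrow> 0) (at_right 0)" by simp
    show ?thesis
    proof (rule Lim_null_comparison[OF _ lim])
      have "norm (h x * v x) \<le> K * sqrt (x * (v x)\<^sup>2)" if "0 < x" "x < 1" for x
        using mult_right_mono[OF hb[OF that], of "\<bar>v x\<bar>"]
        by (simp add: K_def abs_mult real_sqrt_mult mult.assoc)
      then show "\<forall>\<^sub>F x in at_right 0. norm (h x * v x) \<le> K * sqrt (x * (v x)\<^sup>2)"
        unfolding eventually_at_right_field by (intro exI[of _ 1]) auto
    qed
  qed
qed

text \<open>Green's formula. It gives both the skewness of the wave operator and the equality of
  \<open>LINT u * (a u')'\<close> with minus the potential energy.\<close>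

lemma flux_parts:
  assumes u: "u \<in> V2 a" and v: "v \<in> H1a a"
  shows "(LINT x|leb. v x * deriv (\<lambda>x. a x * deriv u x) x + a x * deriv v x * deriv u x) = 0"
proof -
  have uV: "u \<in> V1 a" using u by (auto simp: V2_def)
  have vV: "v \<in> V1 a" and v1: "v 1 = 0" using v by (auto simp: H1a_def)
  obtain h where h: "abs_cont_on {0..1} h" "deriv h \<in> L2 1"
    "\<And>x. 0 < x \<Longrightarrow> x < 1 \<Longrightarrow> a x * deriv u x = h x"
    "\<And>x. 0 < x \<Longrightarrow> x < 1 \<Longrightarrow> deriv (\<lambda>x. a x * deriv u x) x = deriv h x"
    by (rule V2_flux[OF u], rule that)
  let ?g = "\<lambda>x. v x * deriv (\<lambda>x. a x * deriv u x) x + a x * deriv v x * deriv u x"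
  have lh: "loc_abs_cont h" by (rule abs_cont_on_loc_abs_cont[OF h(1)])
  have "loc_abs_cont (\<lambda>x. h x * v x)"
    by (intro loc_abs_cont_mult lh V1_loc_abs_cont[OF vV])
  moreover have "integrable leb ?g"
    by (intro Bochner_Integration.integrable_add L2_mult_integrable V1_energy_integrable V1_L2 V2_deriv_flux_L2 u uV vV)
  moreover have "AE x in leb. DERIV (\<lambda>x. h x * v x) x :> ?g x"
    using loc_abs_cont_DERIV_AE[OF lh] loc_abs_cont_DERIV_AE[OF V1_loc_abs_cont[OF vV]] AE_space
    by eventually_elim (auto intro!: derivative_eq_intros simp: h(4) h(3)[symmetric])
  ultimately have "((\<lambda>x. h x * v x) \<longlongrightarrow> h 1 * v 1 - (LINT x|leb. ?g x)) (at_right 0)"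
    by (rule loc_abs_cont_tendsto_at_0)
  from tendsto_unique[OF trivial_limit_at_right_real this flux_mult_tendsto_0[OF uV v h(1-3)]]
  have "h 1 * v 1 - (LINT x|leb. ?g x) = 0" .
  then show ?thesis by (simp add: v1)
qed

lemma log_derivative_bound: "0 < x \<Longrightarrow> x \<le> 1 \<Longrightarrow> \<bar>x * a' x / a x\<bar> \<le> mu a"
  using mu_bound[of x] a_pos[of x] by (simp add: abs_mult pos_divide_le_eq)

text \<open>The logarithmic derivative \<open>x * a' x / a x\<close> is bounded by
  \<open>mu a\<close>, so the integrand is a bounded multiple of the energy density.\<close>

lemma slope_energy_integrable:
  assumes u: "u \<in> V1 a"
  shows "integrable leb (\<lambda>x. x * a' x * (deriv u x)\<^sup>2)"
proof -
  have [measurable]: "(\<lambda>x. x) \<in> borel_measurable leb"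
    by (rule continuous_on_measurable_lebesgue_on) (rule continuous_on_id)
  have m: "(\<lambda>x. x * a' x / a x) \<in> borel_measurable leb"
    using a_measurable a'_measurable by measurable
  have "(\<lambda>x. x * a' x / a x * sderiv u x) \<in> L2 1"
    by (rule L2_bounded_mult[OF V1_sderiv[OF u] m], rule log_derivative_bound) auto
  from L2_mult_integrable[OF this V1_sderiv[OF u]]
  have "integrable leb (\<lambda>x. x * a' x / a x * sderiv u x * sderiv u x)" .
  then show ?thesis
  proof (rule Bochner_Integration.integrable_cong[THEN iffD1, rotated -1])
    fix x assume x: "x \<in> space leb"
    then have "a x \<noteq> 0" using a_pos[of x] by auto
    have "x * a' x / a x * sderiv u x * sderiv u x = x * a' x / a x * (sderiv u x * sderiv u x)" by simp
    also have "\<dots> = x * a' x / a x * (a x * deriv u x * deriv u x)" using sderiv_mult[of x u u] x by (simp only: space_leb)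
    also have "\<dots> = x * a' x * (deriv u x)\<^sup>2" using \<open>a x \<noteq> 0\<close> by (simp add: power2_eq_square)
    finally show "x * a' x / a x * sderiv u x * sderiv u x = x * a' x * (deriv u x)\<^sup>2" .
  qed simp
qed

text \<open>Comes from differentiating \<open>x * a x * (deriv u x)^2\<close>, which leaves the
  trace at 1. The boundary term at 0 vanishes because its quotient by \<open>x\<close> is the energy
  density.\<close>

lemma flux_multiplier_parts:
  assumes u: "u \<in> V2 a"
  shows "a 1 * (deriv_on {0<..1} u 1)\<^sup>2 =
    (LINT x|leb. (a x - x * a' x) * (deriv u x)\<^sup>2 + 2 * (x * deriv u x * deriv (\<lambda>x. a x * deriv u x) x))"
proof -
  have uV: "u \<in> V1 a" using u by (auto simp: V2_def)
  obtain h where h: "abs_cont_on {0..1} h" "deriv h \<in> L2 1"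
    "\<And>x. 0 < x \<Longrightarrow> x < 1 \<Longrightarrow> a x * deriv u x = h x"
    "\<And>x. 0 < x \<Longrightarrow> x < 1 \<Longrightarrow> deriv (\<lambda>x. a x * deriv u x) x = deriv h x"
    "a 1 * deriv_on {0<..1} u 1 = h 1"
    by (rule V2_flux[OF u], rule that)
  \<comment> \<open>Written through the flux \<open>h\<close>, since \<open>h\<close> is absolutely
    continuous and \<open>x / a x\<close> is continuously differentiable on
    \<open>{0<..1}\<close>.\<close>
  let ?f = "\<lambda>x. x / a x * (h x * h x)"
  let ?g = "\<lambda>x. (a x - x * a' x) * (deriv u x)\<^sup>2 + 2 * (x * deriv u x * deriv (\<lambda>x. a x * deriv u x) x)"
  have lh: "loc_abs_cont h" by (rule abs_cont_on_loc_abs_cont[OF h(1)])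
  have lx: "loc_abs_cont (\<lambda>x. x / a x)"
  proof (rule C1_loc_abs_cont[of _ "\<lambda>x. (a x - x * a' x) / (a x)\<^sup>2"])
    show "((\<lambda>x. x / a x) has_real_derivative (a x - x * a' x) / (a x)\<^sup>2) (at x within {0<..1})"
      if "x \<in> {0<..1}" for x
      using a_pos[of x] that by (auto intro!: derivative_eq_intros a_deriv simp: power2_eq_square)
    show "continuous_on {0<..1} (\<lambda>x. (a x - x * a' x) / (a x)\<^sup>2)"
      using a_pos by (intro continuous_intros a'_continuous continuous_on_subset[OF a_continuous]) (auto simp: less_le)
  qed
  have ie: "integrable leb (\<lambda>x. a x * deriv u x * deriv u x)" by (rule V1_energy_integrable[OF uV uV])
  have ig: "integrable leb (\<lambda>x. (a x * deriv u x * deriv u x - x * a' x * (deriv u x)\<^sup>2) +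
      2 * (x * deriv u x * deriv (\<lambda>x. a x * deriv u x) x))"
    by (intro Bochner_Integration.integrable_add Bochner_Integration.integrable_diff ie
        integrable_mult_right slope_energy_integrable L2_mult_integrable V1_x_deriv_L2 V2_deriv_flux_L2 u uV)
  have "loc_abs_cont ?f" by (intro loc_abs_cont_mult lx lh)
  moreover have "integrable leb ?g" using ig by (simp add: left_diff_distrib power2_eq_square mult.assoc)
  moreover have "AE x in leb. DERIV ?f x :> ?g x"
    using loc_abs_cont_DERIV_AE[OF lh] AE_space
  proof eventually_elim
    fix x assume hx: "DERIV h x :> deriv h x" and "x \<in> space leb"
    then have x: "0 < x" "x < 1" by auto
    then have ax: "a x > 0" using a_pos[of x] by simp
    have "DERIV (\<lambda>x. x / a x) x :> (1 * a x - x * a' x) / (a x * a x)"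
      using ax by (intro DERIV_divide DERIV_ident a_DERIV x) simp
    from DERIV_mult[OF this DERIV_mult[OF hx hx]]
    have "DERIV ?f x :> (1 * a x - x * a' x) / (a x * a x) * (h x * h x) + (deriv h x * h x + deriv h x * h x) * (x / a x)" .
    moreover have "(1 * a x - x * a' x) / (a x * a x) * (h x * h x) + (deriv h x * h x + deriv h x * h x) * (x / a x) = ?g x"
      unfolding h(4)[OF x] unfolding h(3)[OF x, symmetric] using ax
      by (simp add: field_simps power2_eq_square)
    ultimately show "DERIV ?f x :> ?g x" by simp
  qed
  ultimately have lim: "(?f \<longlongrightarrow> ?f 1 - (LINT x|leb. ?g x)) (at_right 0)"
    by (rule loc_abs_cont_tendsto_at_0)
  moreover have "integrable leb (\<lambda>x. ?f x / x)"
  proof (rule Bochner_Integration.integrable_cong[THEN iffD1, OF refl _ ie])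
    fix x assume "x \<in> space leb"
    then have x: "0 < x" "x < 1" "a x > 0" using a_pos[of x] by auto
    show "a x * deriv u x * deriv u x = ?f x / x"
      unfolding h(3)[OF x(1,2), symmetric] using x by simp
  qed
  ultimately have "?f 1 - (LINT x|leb. ?g x) = 0" by (rule tendsto_0_if_quotient_integrable)
  moreover have "?f 1 = a 1 * (deriv_on {0<..1} u 1)\<^sup>2"
    unfolding h(5)[symmetric] using a_1_pos by (simp add: power2_eq_square)
  ultimately show ?thesis by simp
qed

end

section \<open>The state space\<close>

lemma state_eq_refl [simp]: "state_eq U U"
  by (simp add: state_eq_def eq_ae_def)

lemma eq_ae_sym: "eq_ae f g \<Longrightarrow> eq_ae g f"
  unfolding eq_ae_def by (erule eventually_mono) simp

lemma state_eq_sym: "state_eq U V \<Longrightarrow> state_eq V U"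
  unfolding state_eq_def by (blast intro: eq_ae_sym)

lemma eq_ae_trans:
  assumes "eq_ae f g" "eq_ae g h" shows "eq_ae f h"
  using assms unfolding eq_ae_def by eventually_elim simp

lemma state_eq_trans: "state_eq U V \<Longrightarrow> state_eq V W \<Longrightarrow> state_eq U W"
  unfolding state_eq_def by (blast intro: eq_ae_trans)

lemma eq_ae_lincomb:
  assumes "eq_ae f f'" "eq_ae g g'" shows "eq_ae (\<lambda>x. c * f x + d * g x) (\<lambda>x. c * f' x + d * g' x)"
  using assms unfolding eq_ae_def by eventually_elim simp

lemma state_eq_lincomb:
  "state_eq U U' \<Longrightarrow> state_eq V V' \<Longrightarrow> state_eq (lincomb c U d V) (lincomb c U' d V')"
  unfolding state_eq_def lincomb_def fst_conv snd_conv by (blast intro: eq_ae_lincomb)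

lemma fst_lincomb: "fst (lincomb c U d V) = (\<lambda>x. c * fst U x + d * fst V x)"
  and snd_lincomb: "snd (lincomb c U d V) = (\<lambda>x. c * snd U x + d * snd V x)"
  by (simp_all add: lincomb_def)

context degenerate
begin

abbreviation "ip \<equiv> state_inner a"
abbreviation "nrm \<equiv> state_norm a"
abbreviation "SS \<equiv> state_space a"
abbreviation "diff U V \<equiv> lincomb 1 U (-1) V"

lemma state_spaceD:
  assumes "U \<in> SS"
  shows "fst U \<in> H1a a" "fst U \<in> V1 a" "snd U \<in> L2 1" "fst U 1 = 0" "loc_abs_cont (fst U)"
  using assms by (auto simp: state_space_def H1a_def intro: V1_loc_abs_cont)

lemma state_space_lincomb: "U \<in> SS \<Longrightarrow> V \<in> SS \<Longrightarrow> lincomb c U d V \<in> SS"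
  unfolding state_space_def mem_Times_iff fst_lincomb snd_lincomb by (auto intro: H1a_lincomb L2_lincomb)

lemma state_inner_integrable:
  assumes "U \<in> SS" "V \<in> SS"
  shows "integrable leb (\<lambda>x. snd U x * snd V x + a x * deriv (fst U) x * deriv (fst V) x)"
  by (intro Bochner_Integration.integrable_add L2_mult_integrable V1_energy_integrable state_spaceD assms)

lemma state_inner_split:
  assumes "U \<in> SS" "V \<in> SS"
  shows "ip U V = (LINT x|leb. snd U x * snd V x) + (LINT x|leb. a x * deriv (fst U) x * deriv (fst V) x)"
  unfolding state_inner_def
  by (intro Bochner_Integration.integral_add L2_mult_integrable V1_energy_integrable state_spaceD assms)

lemma state_inner_commute: "ip U V = ip V U"
  unfolding state_inner_def by (simp add: mult_ac)

lemma state_inner_lincomb_left: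
  assumes U: "U \<in> SS" and V: "V \<in> SS" and W: "W \<in> SS"
  shows "ip (lincomb c U d V) W = c * ip U W + d * ip V W"
proof -
  have "ip (lincomb c U d V) W =
    (LINT x|leb. c * (snd U x * snd W x + a x * deriv (fst U) x * deriv (fst W) x) +
       d * (snd V x * snd W x + a x * deriv (fst V) x * deriv (fst W) x))"
    unfolding state_inner_def
  proof (rule integral_cong_AE)
    have LU: "lincomb c U d V \<in> SS" using U V by (rule state_space_lincomb)
    show "(\<lambda>x. snd (lincomb c U d V) x * snd W x + a x * deriv (fst (lincomb c U d V)) x * deriv (fst W) x)
        \<in> borel_measurable leb"
      using state_inner_integrable[OF LU W] by (rule borel_measurable_integrable)
    show "(\<lambda>x. c * (snd U x * snd W x + a x * deriv (fst U) x * deriv (fst W) x) +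
       d * (snd V x * snd W x + a x * deriv (fst V) x * deriv (fst W) x)) \<in> borel_measurable leb"
      using borel_measurable_integrable[OF state_inner_integrable[OF U W]]
        borel_measurable_integrable[OF state_inner_integrable[OF V W]] by measurable
    show "AE x in leb. snd (lincomb c U d V) x * snd W x + a x * deriv (fst (lincomb c U d V)) x * deriv (fst W) x =
        c * (snd U x * snd W x + a x * deriv (fst U) x * deriv (fst W) x) +
       d * (snd V x * snd W x + a x * deriv (fst V) x * deriv (fst W) x)"
      using deriv_lincomb_AE[OF state_spaceD(5)[OF U] state_spaceD(5)[OF V], of c d]
      by eventually_elim (simp add: fst_lincomb snd_lincomb algebra_simps)
  qed
  also have "\<dots> = c * ip U W + d * ip V W"
    unfolding state_inner_def
    using state_inner_integrable[OF U W] state_inner_integrable[OF V W]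
    by (subst Bochner_Integration.integral_add) auto
  finally show ?thesis .
qed

lemma state_inner_lincomb_right:
  "U \<in> SS \<Longrightarrow> V \<in> SS \<Longrightarrow> W \<in> SS \<Longrightarrow> ip W (lincomb c U d V) = c * ip W U + d * ip W V"
  by (simp add: state_inner_commute[of W] state_inner_lincomb_left)

lemma state_inner_nonneg: "0 \<le> ip U U"
  unfolding state_inner_def
proof (rule integral_nonneg_AE, rule AE_I2)
  fix x assume "x \<in> space leb"
  then have "a x > 0" using a_pos[of x] by auto
  then have "0 \<le> a x * (deriv (fst U) x)\<^sup>2" by simp
  then show "0 \<le> snd U x * snd U x + a x * deriv (fst U) x * deriv (fst U) x"
    by (simp add: power2_eq_square mult.assoc)
qed

lemma state_norm_nonneg [simp]: "0 \<le> nrm U" by (simp add: state_norm_def state_inner_nonneg)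

lemma state_norm_square: "(nrm U)\<^sup>2 = ip U U" by (simp add: state_norm_def state_inner_nonneg)

lemma state_inner_lincomb_self:
  assumes "U \<in> SS" "V \<in> SS"
  shows "ip (lincomb c U d V) (lincomb c U d V) = c\<^sup>2 * ip U U + 2 * c * d * ip U V + d\<^sup>2 * ip V V"
  using assms by (simp add: state_inner_lincomb_left state_inner_lincomb_right state_space_lincomb
      state_inner_commute[of V U] power2_eq_square algebra_simps)

lemma state_Cauchy_Schwarz:
  assumes "U \<in> SS" "V \<in> SS"
  shows "\<bar>ip U V\<bar> \<le> nrm U * nrm V"
proof -
  have "(ip U V)\<^sup>2 \<le> ip U U * ip V V"
  proof (rule quadratic_nonneg_imp_discriminant)
    show "0 \<le> ip U U + 2 * t * ip U V + t\<^sup>2 * ip V V" for t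
      using state_inner_nonneg[of "lincomb 1 U t V"] state_inner_lincomb_self[OF assms, of 1 t] by simp
  qed (rule state_inner_nonneg)
  then have "\<bar>ip U V\<bar>\<^sup>2 \<le> (nrm U * nrm V)\<^sup>2" by (simp add: power_mult_distrib state_norm_square)
  then show ?thesis by (rule power2_le_imp_le) simp
qed

lemma state_norm_lincomb:
  assumes "U \<in> SS" "V \<in> SS"
  shows "nrm (lincomb c U d V) \<le> \<bar>c\<bar> * nrm U + \<bar>d\<bar> * nrm V"
proof (rule power2_le_imp_le)
  have "c * d * ip U V \<le> \<bar>c\<bar> * \<bar>d\<bar> * (nrm U * nrm V)"
  proof -
    have "c * d * ip U V \<le> \<bar>c * d * ip U V\<bar>" by simp
    also have "\<dots> = \<bar>c\<bar> * \<bar>d\<bar> * \<bar>ip U V\<bar>" by (simp add: abs_mult)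
    also have "\<dots> \<le> \<bar>c\<bar> * \<bar>d\<bar> * (nrm U * nrm V)"
      by (intro mult_left_mono state_Cauchy_Schwarz assms) auto
    finally show ?thesis .
  qed
  then show "(nrm (lincomb c U d V))\<^sup>2 \<le> (\<bar>c\<bar> * nrm U + \<bar>d\<bar> * nrm V)\<^sup>2"
    unfolding state_norm_square state_inner_lincomb_self[OF assms]
    by (simp add: power2_sum power_mult_distrib state_norm_square algebra_simps)
qed simp

lemma state_norm_triangle:
  assumes "U \<in> SS" "V \<in> SS" "W \<in> SS"
  shows "nrm (diff U W) \<le> nrm (diff U V) + nrm (diff V W)"
proof -
  have "diff U W = lincomb 1 (diff U V) 1 (diff V W)" by (simp add: lincomb_def)
  then show ?thesis
    using state_norm_lincomb[of "diff U V" "diff V W" 1 1] assms by (simp add: state_space_lincomb)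
qed

lemma state_norm_diff_commute:
  assumes "U \<in> SS" "V \<in> SS" shows "nrm (diff U V) = nrm (diff V U)"
  unfolding state_norm_def using assms
  by (simp add: state_inner_lincomb_self state_inner_commute[of V U] algebra_simps)

lemma state_norm_diff_bound:
  assumes "U \<in> SS" "V \<in> SS" shows "\<bar>nrm U - nrm V\<bar> \<le> nrm (diff U V)"
proof -
  have "nrm X \<le> nrm Y + nrm (diff X Y)" if "X \<in> SS" "Y \<in> SS" for X Y
  proof -
    have "X = lincomb 1 Y 1 (diff X Y)" by (simp add: lincomb_def)
    then show ?thesis using state_norm_lincomb[of Y "diff X Y" 1 1] that by (simp add: state_space_lincomb)
  qed
  from this[OF assms] this[OF assms(2,1)] state_norm_diff_commute[OF assms] show ?thesis by linarith
qed

text \<open>First components are continuous, so the set where they differ is open inside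
  \<open>{0<..<1}\<close> and negligible, hence empty; at 1 both vanish. Traces and derivatives
  therefore do not depend on the representative.\<close>

lemma state_eq_fst:
  assumes U: "U \<in> SS" and V: "V \<in> SS" and eq: "state_eq U V" and x: "0 < x" "x \<le> 1"
  shows "fst U x = fst V x"
proof (cases "x = 1")
  case True
  then show ?thesis using state_spaceD(4) U V by simp
next
  case False
  let ?g = "\<lambda>z. 1 * fst U z + (-1) * fst V z"
  let ?S = "{0<..<1} \<inter> ?g -` (- {0})"
  obtain M where M: "negligible M" "\<And>x. x \<in> {0<..<1} - M \<Longrightarrow> fst U x = fst V x"
    using AE_lebesgue_on_obtain_negligible[OF eq[unfolded state_eq_def eq_ae_def, THEN conjunct1]] by metis
  have "?S \<subseteq> M"
  proof
    fix z assume z: "z \<in> ?S"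
    then have "fst U z \<noteq> fst V z" by simp
    then show "z \<in> M" using M(2)[of z] z by blast
  qed
  then have "negligible ?S" using M(1) negligible_subset by blast
  moreover have "open ?S"
  proof (rule continuous_open_preimage)
    have "loc_abs_cont ?g" by (intro loc_abs_cont_lincomb state_spaceD U V)
    then show "continuous_on {0<..<1} ?g"
      by (rule continuous_on_subset[OF loc_abs_cont_continuous]) auto
  qed auto
  ultimately have "?S = {}" using open_not_negligible by blast
  moreover have "x \<in> {0<..<1}" using x False by simp
  ultimately have "\<not> ?g x \<in> - {0}" by blast
  then show ?thesis by simp
qed

lemma state_eq_deriv_fst:
  assumes U: "U \<in> SS" and V: "V \<in> SS" and eq: "state_eq U V" and x: "0 < x" "x < 1"
  shows "deriv (fst U) x = deriv (fst V) x"
proof (rule deriv_cong_ev)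
  have "\<forall>\<^sub>F z in nhds x. z \<in> {0<..<1}" using x by (intro eventually_nhds_in_open) auto
  then show "\<forall>\<^sub>F z in nhds x. fst U z = fst V z"
    by eventually_elim (auto intro: state_eq_fst[OF U V eq])
qed simp

lemma state_inner_cong:
  assumes U: "U \<in> SS" and U': "U' \<in> SS" and W: "W \<in> SS" and eq: "state_eq U U'"
  shows "ip U W = ip U' W"
  unfolding state_inner_def
proof (rule integral_cong_AE)
  show "AE x in leb. snd U x * snd W x + a x * deriv (fst U) x * deriv (fst W) x =
      snd U' x * snd W x + a x * deriv (fst U') x * deriv (fst W) x"
    using eq[unfolded state_eq_def eq_ae_def, THEN conjunct2] AE_space
    by eventually_elim (auto simp: state_eq_deriv_fst[OF U U' eq])
qed (use state_inner_integrable[OF U W] state_inner_integrable[OF U' W] in \<open>auto intro: borel_measurable_integrable\<close>)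

lemma state_norm_cong:
  assumes "U \<in> SS" "U' \<in> SS" "state_eq U U'"
  shows "nrm U = nrm U'"
  unfolding state_norm_def
  using state_inner_cong[OF assms(1,2) assms(1) assms(3)] state_inner_cong[OF assms(1,2) assms(2,3)]
  by (simp add: state_inner_commute[of U' U])

lemma state_norm_diff_zero:
  assumes "U \<in> SS" "U' \<in> SS" "state_eq U U'"
  shows "nrm (diff U U') = 0"
proof -
  have "ip U U = ip U' U" "ip U U' = ip U' U'"
    using state_inner_cong assms by blast+
  then show ?thesis
    unfolding state_norm_def using assms by (simp add: state_inner_lincomb_self state_inner_commute[of U' U])
qed

lemma state_norm_lincomb_cong:
  assumes "U \<in> SS" "U' \<in> SS" "V \<in> SS" "V' \<in> SS" "state_eq U U'" "state_eq V V'"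
  shows "nrm (lincomb c U d V) = nrm (lincomb c U' d V')"
  using assms by (intro state_norm_cong state_eq_lincomb state_space_lincomb)

text \<open>One notion for the energy product and the multiplier functional, so that invariance
  under \<open>state_eq\<close> and the product rule along the semigroup are proved once. Symmetry
  is not part of it, because the multiplier is not symmetric.\<close>

definition bounded_form :: "(state \<Rightarrow> state \<Rightarrow> real) \<Rightarrow> bool" where
  "bounded_form b \<longleftrightarrow>
     (\<forall>U\<in>SS. \<forall>V\<in>SS. \<forall>W\<in>SS. \<forall>c d. b (lincomb c U d V) W = c * b U W + d * b V W \<and>
        b W (lincomb c U d V) = c * b W U + d * b W V) \<and>
     (\<exists>C\<ge>0. \<forall>U\<in>SS. \<forall>V\<in>SS. \<bar>b U V\<bar> \<le> C * (nrm U * nrm V))"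

lemma bounded_form_inner: "bounded_form ip"
  unfolding bounded_form_def
proof (intro conjI ballI allI)
  show "\<exists>C\<ge>0. \<forall>U\<in>SS. \<forall>V\<in>SS. \<bar>ip U V\<bar> \<le> C * (nrm U * nrm V)"
    using state_Cauchy_Schwarz by (intro exI[of _ 1]) auto
qed (auto simp: state_inner_lincomb_left state_inner_lincomb_right)

text \<open>By boundedness a form vanishes on a difference of \<open>state_eq\<close> states, whose
  norm is 0.\<close>

lemma bounded_form_cong:
  assumes b: "bounded_form b" and S: "U \<in> SS" "U' \<in> SS" "V \<in> SS" "V' \<in> SS"
    and eq: "state_eq U U'" "state_eq V V'"
  shows "b U V = b U' V'"
proof -
  obtain C where C: "\<And>U V. U \<in> SS \<Longrightarrow> V \<in> SS \<Longrightarrow> \<bar>b U V\<bar> \<le> C * (nrm U * nrm V)"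
    using b unfolding bounded_form_def by blast
  have "\<bar>b (diff U U') V\<bar> \<le> 0" "\<bar>b U' (diff V V')\<bar> \<le> 0"
    using C[of "diff U U'" V] C[of U' "diff V V'"] S
    by (auto simp: state_space_lincomb state_norm_diff_zero eq)
  moreover have "b (diff U U') V = b U V - b U' V" "b U' (diff V V') = b U' V - b U' V'"
    using b S unfolding bounded_form_def by auto
  ultimately show ?thesis by simp
qed

text \<open>The functional differentiated in time is the diagonal \<open>multiplier U U\<close>.
  Keeping two arguments lets the product rule express its derivative.\<close>

definition multiplier :: "state \<Rightarrow> state \<Rightarrow> real" where
  "multiplier U V = (LINT x|leb. (x * deriv (fst U) x + mu a / 4 * fst U x) * snd V x)"

lemma multiplier_L2:
  "U \<in> SS \<Longrightarrow> (\<lambda>x. 1 * (x * deriv (fst U) x) + mu a / 4 * fst U x) \<in> L2 1"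
  by (intro L2_lincomb V1_x_deriv_L2 V1_L2 state_spaceD)

lemma multiplier_integrable:
  assumes "U \<in> SS" "V \<in> SS"
  shows "integrable leb (\<lambda>x. (x * deriv (fst U) x + mu a / 4 * fst U x) * snd V x)"
  using L2_mult_integrable[OF multiplier_L2[OF assms(1)] state_spaceD(3)[OF assms(2)]] by simp

lemma multiplier_split:
  assumes "U \<in> SS" "V \<in> SS"
  shows "multiplier U V = (LINT x|leb. x * deriv (fst U) x * snd V x) + mu a / 4 * (LINT x|leb. fst U x * snd V x)"
proof -
  have "integrable leb (\<lambda>x. x * deriv (fst U) x * snd V x)"
    using assms by (intro L2_mult_integrable V1_x_deriv_L2 state_spaceD)
  moreover have "integrable leb (\<lambda>x. fst U x * snd V x)"
    using assms by (intro L2_mult_integrable V1_L2 state_spaceD)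
  ultimately show ?thesis unfolding multiplier_def
    by (simp add: distrib_right mult.assoc Bochner_Integration.integral_add)
qed

lemma LINT_square_snd_add:
  assumes "U \<in> SS"
  shows "(LINT x|leb. (snd U x)\<^sup>2) + (LINT x|leb. a x * deriv (fst U) x * deriv (fst U) x) = (nrm U)\<^sup>2"
  unfolding state_norm_square state_inner_split[OF assms assms] by (simp add: power2_eq_square)

lemma LINT_energy_nonneg: "0 \<le> (LINT x|leb. a x * deriv u x * deriv u x)"
  unfolding V1_energy_LINT by simp

lemma x_deriv_energy_le:
  assumes "u \<in> V1 a"
  shows "(LINT x|leb. (x * deriv u x)\<^sup>2) \<le> 1 / a 1 * (LINT x|leb. a x * deriv u x * deriv u x)"
proof -
  have "(LINT x|leb. (x * deriv u x)\<^sup>2) \<le> (LINT x|leb. 1 / a 1 * (a x * deriv u x * deriv u x))"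
    using x_square_le_energy
    by (intro integral_mono L2_integrable V1_x_deriv_L2 integrable_mult_right V1_energy_integrable assms)
      (auto simp: power2_eq_square mult.assoc)
  then show ?thesis by simp
qed

lemma poincare_const_pos: "poincare_const a > 0"
  using a_1_pos mu_less_2 by (simp add: poincare_const_def)

lemma bounded_form_multiplier: "bounded_form multiplier"
  unfolding bounded_form_def
proof (intro conjI ballI allI)
  fix U V W c d assume U: "U \<in> SS" and V: "V \<in> SS" and W: "W \<in> SS"
  note i = multiplier_integrable[OF U W] multiplier_integrable[OF V W]
    multiplier_integrable[OF W U] multiplier_integrable[OF W V]
  have "multiplier (lincomb c U d V) W =
    (LINT x|leb. c * ((x * deriv (fst U) x + mu a / 4 * fst U x) * snd W x) +
      d * ((x * deriv (fst V) x + mu a / 4 * fst V x) * snd W x))"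
    unfolding multiplier_def
  proof (rule integral_cong_AE)
    show "(\<lambda>x. (x * deriv (fst (lincomb c U d V)) x + mu a / 4 * fst (lincomb c U d V) x) * snd W x) \<in> borel_measurable leb"
      by (intro borel_measurable_integrable multiplier_integrable state_space_lincomb U V W)
    show "(\<lambda>x. c * ((x * deriv (fst U) x + mu a / 4 * fst U x) * snd W x) +
      d * ((x * deriv (fst V) x + mu a / 4 * fst V x) * snd W x)) \<in> borel_measurable leb"
      using i[THEN borel_measurable_integrable] by measurable
    show "AE x in leb. (x * deriv (fst (lincomb c U d V)) x + mu a / 4 * fst (lincomb c U d V) x) * snd W x =
      c * ((x * deriv (fst U) x + mu a / 4 * fst U x) * snd W x) +
      d * ((x * deriv (fst V) x + mu a / 4 * fst V x) * snd W x)"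
      using deriv_lincomb_AE[OF state_spaceD(5)[OF U] state_spaceD(5)[OF V], of c d]
      by eventually_elim (simp add: fst_lincomb algebra_simps)
  qed
  also have "\<dots> = c * multiplier U W + d * multiplier V W"
    unfolding multiplier_def using i by (subst Bochner_Integration.integral_add) auto
  finally show "multiplier (lincomb c U d V) W = c * multiplier U W + d * multiplier V W" .
  have "multiplier W (lincomb c U d V) =
    (LINT x|leb. c * ((x * deriv (fst W) x + mu a / 4 * fst W x) * snd U x) +
      d * ((x * deriv (fst W) x + mu a / 4 * fst W x) * snd V x))"
    unfolding multiplier_def snd_lincomb by (intro Bochner_Integration.integral_cong) (auto simp: algebra_simps)
  also have "\<dots> = c * multiplier W U + d * multiplier W V"
    unfolding multiplier_def using i by (subst Bochner_Integration.integral_add) auto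
  finally show "multiplier W (lincomb c U d V) = c * multiplier W U + d * multiplier W V" .
next
  define C where "C = sqrt (1 / a 1) + mu a / 4 * sqrt (4 * poincare_const a)"
  have "\<bar>multiplier U V\<bar> \<le> C * (nrm U * nrm V)" if U: "U \<in> SS" and V: "V \<in> SS" for U V
  proof -
    have v: "(LINT x|leb. (snd V x)\<^sup>2) \<le> (nrm V)\<^sup>2"
      using LINT_square_snd_add[OF V] LINT_energy_nonneg[of "fst V"] by simp
    have e: "(LINT x|leb. a x * deriv (fst U) x * deriv (fst U) x) \<le> (nrm U)\<^sup>2"
      unfolding LINT_square_snd_add[OF U, symmetric] by simp
    have "(LINT x|leb. x * deriv (fst U) x * snd V x)\<^sup>2 \<le> (LINT x|leb. (x * deriv (fst U) x)\<^sup>2) * (LINT x|leb. (snd V x)\<^sup>2)"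
      using U V by (intro L2_Cauchy_Schwarz V1_x_deriv_L2 state_spaceD)
    also have "\<dots> \<le> (1 / a 1 * (nrm U)\<^sup>2) * (nrm V)\<^sup>2"
      using x_deriv_energy_le[OF state_spaceD(2)[OF U]] a_1_pos
      by (intro mult_mono v order_trans[OF x_deriv_energy_le[OF state_spaceD(2)[OF U]]] mult_left_mono e) auto
    also have "\<dots> = (sqrt (1 / a 1) * (nrm U * nrm V))\<^sup>2"
      using a_1_pos by (simp only: power_mult_distrib) (simp add: field_simps)
    finally have 1: "\<bar>LINT x|leb. x * deriv (fst U) x * snd V x\<bar> \<le> sqrt (1 / a 1) * (nrm U * nrm V)"
      using a_1_pos by (subst (asm) abs_le_square_iff[symmetric]) (simp add: abs_mult)
    have "(LINT x|leb. fst U x * snd V x)\<^sup>2 \<le> (LINT x|leb. (fst U x)\<^sup>2) * (LINT x|leb. (snd V x)\<^sup>2)"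
      using U V by (intro L2_Cauchy_Schwarz V1_L2 state_spaceD)
    also have "\<dots> \<le> (4 * poincare_const a * (nrm U)\<^sup>2) * (nrm V)\<^sup>2"
      using poincare_const_pos
      by (intro mult_mono v order_trans[OF Poincare[OF state_spaceD(1)[OF U]]] mult_left_mono e) auto
    also have "\<dots> = (sqrt (4 * poincare_const a) * (nrm U * nrm V))\<^sup>2"
      using poincare_const_pos by (simp only: power_mult_distrib) (simp add: field_simps)
    finally have 2: "\<bar>LINT x|leb. fst U x * snd V x\<bar> \<le> sqrt (4 * poincare_const a) * (nrm U * nrm V)"
      using poincare_const_pos by (subst (asm) abs_le_square_iff[symmetric]) (simp add: abs_mult)
    have "\<bar>multiplier U V\<bar> \<le> \<bar>LINT x|leb. x * deriv (fst U) x * snd V x\<bar> + mu a / 4 * \<bar>LINT x|leb. fst U x * snd V x\<bar>"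
      unfolding multiplier_split[OF U V] using mu_nonneg
      by (intro order_trans[OF abs_triangle_ineq]) (simp add: abs_mult)
    also have "\<dots> \<le> sqrt (1 / a 1) * (nrm U * nrm V) + mu a / 4 * (sqrt (4 * poincare_const a) * (nrm U * nrm V))"
      using mu_nonneg by (intro add_mono mult_left_mono 1 2) auto
    finally show ?thesis by (simp add: C_def algebra_simps)
  qed
  moreover have "0 \<le> C" using a_1_pos mu_nonneg poincare_const_pos by (simp add: C_def)
  ultimately show "\<exists>C\<ge>0. \<forall>U\<in>SS. \<forall>V\<in>SS. \<bar>multiplier U V\<bar> \<le> C * (nrm U * nrm V)" by blast
qed

text \<open>On the diagonal both Cauchy-Schwarz factors belong to the same state, so the
  arithmetic-geometric mean inequality gains a factor 1/2. It absorbs the 2 that comes from the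
  square root of the factor 4 in \<open>Poincare\<close>.\<close>

lemma multiplier_self_bound:
  assumes U: "U \<in> SS"
  shows "\<bar>multiplier U U\<bar> \<le> 1 / 2 * (1 / min 1 (a 1) + mu a / 2 * sqrt (poincare_const a)) * (nrm U)\<^sup>2"
proof -
  let ?v = "LINT x|leb. (snd U x)\<^sup>2" and ?e = "LINT x|leb. a x * deriv (fst U) x * deriv (fst U) x"
  have v: "0 \<le> ?v" by simp
  note e = LINT_energy_nonneg[of "fst U"] and ve = LINT_square_snd_add[OF U]
  let ?m = "1 / min 1 (a 1)"
  have m: "1 / a 1 \<le> ?m" "1 \<le> ?m" using a_1_pos by (auto simp: min_def field_simps)
  have L: "(\<lambda>x. x * deriv (fst U) x) \<in> L2 1" "snd U \<in> L2 1" "fst U \<in> L2 1"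
    using U by (auto intro: V1_x_deriv_L2 V1_L2 state_spaceD)
  have "\<bar>LINT x|leb. x * deriv (fst U) x * snd U x\<bar> \<le> sqrt ((1 / a 1 * ?e) * ?v)"
  proof (rule real_le_rsqrt)
    have "(LINT x|leb. x * deriv (fst U) x * snd U x)\<^sup>2 \<le> (LINT x|leb. (x * deriv (fst U) x)\<^sup>2) * ?v"
      by (intro L2_Cauchy_Schwarz L)
    also have "\<dots> \<le> (1 / a 1 * ?e) * ?v"
      by (intro mult_right_mono x_deriv_energy_le state_spaceD U v)
    finally show "\<bar>LINT x|leb. x * deriv (fst U) x * snd U x\<bar>\<^sup>2 \<le> (1 / a 1 * ?e) * ?v" by simp
  qed
  also have "\<dots> \<le> (1 / a 1 * ?e + ?v) / 2"
    using arith_geo_mean_sqrt[of "1 / a 1 * ?e" ?v] v e a_1_pos by simp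
  also have "\<dots> \<le> (?m * ?e + ?m * ?v) / 2"
    using mult_right_mono[OF m(1) e] mult_right_mono[OF m(2) v]
    by (intro divide_right_mono add_mono) auto
  also have "\<dots> = 1 / 2 * ?m * (nrm U)\<^sup>2" unfolding ve[symmetric] by (simp add: distrib_left)
  finally have 1: "\<bar>LINT x|leb. x * deriv (fst U) x * snd U x\<bar> \<le> 1 / 2 * (1 / min 1 (a 1)) * (nrm U)\<^sup>2" .
  have "\<bar>LINT x|leb. fst U x * snd U x\<bar> \<le> sqrt ((4 * poincare_const a * ?e) * ?v)"
  proof (rule real_le_rsqrt)
    have "(LINT x|leb. fst U x * snd U x)\<^sup>2 \<le> (LINT x|leb. (fst U x)\<^sup>2) * ?v"
      by (intro L2_Cauchy_Schwarz L)
    also have "\<dots> \<le> (4 * poincare_const a * ?e) * ?v"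
      by (intro mult_right_mono Poincare state_spaceD U v)
    finally show "\<bar>LINT x|leb. fst U x * snd U x\<bar>\<^sup>2 \<le> (4 * poincare_const a * ?e) * ?v" by simp
  qed
  also have "\<dots> = 2 * sqrt (poincare_const a) * sqrt (?e * ?v)"
    by (simp add: real_sqrt_mult mult.assoc)
  also have "\<dots> \<le> 2 * sqrt (poincare_const a) * ((?e + ?v) / 2)"
    using arith_geo_mean_sqrt[of ?e ?v] v e poincare_const_pos by (intro mult_left_mono) auto
  also have "\<dots> = sqrt (poincare_const a) * (nrm U)\<^sup>2" unfolding ve[symmetric] by simp
  finally have 2: "\<bar>LINT x|leb. fst U x * snd U x\<bar> \<le> sqrt (poincare_const a) * (nrm U)\<^sup>2" .
  have "\<bar>multiplier U U\<bar> \<le> \<bar>LINT x|leb. x * deriv (fst U) x * snd U x\<bar> + mu a / 4 * \<bar>LINT x|leb. fst U x * snd U x\<bar>"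
    unfolding multiplier_split[OF U U] using mu_nonneg
    by (intro order_trans[OF abs_triangle_ineq]) (simp add: abs_mult)
  also have "\<dots> \<le> 1 / 2 * (1 / min 1 (a 1)) * (nrm U)\<^sup>2 + mu a / 4 * (sqrt (poincare_const a) * (nrm U)\<^sup>2)"
    using mu_nonneg by (intro add_mono mult_left_mono 1 2) auto
  finally show ?thesis by (simp add: algebra_simps)
qed

subsection \<open>The domain of the wave operator in the state space\<close>

abbreviation trace :: "state \<Rightarrow> real" where
  "trace Z \<equiv> deriv_on {0<..1} (fst Z) 1"

lemma wave_domD:
  assumes "Z \<in> wave_dom a"
  shows "fst Z \<in> V2 a" "fst Z \<in> H1a a" "snd Z \<in> H1a a" "Z \<in> SS" "wave_op a Z \<in> SS"
proof -
  show Z: "fst Z \<in> V2 a" "fst Z \<in> H1a a" "snd Z \<in> H1a a"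
    using assms by (auto simp: wave_dom_def H2a_def)
  then show "Z \<in> SS" by (auto simp: state_space_def mem_Times_iff H1a_def intro: V1_L2)
  show "wave_op a Z \<in> SS"
    using Z V2_deriv_flux_L2[OF Z(1)] by (auto simp: state_space_def wave_op_def)
qed

lemma wave_op_skew:
  assumes Z: "Z \<in> wave_dom a" shows "ip (wave_op a Z) Z = 0"
  using flux_parts[OF wave_domD(1)[OF Z] wave_domD(3)[OF Z]]
  by (simp add: state_inner_def wave_op_def mult_ac)

text \<open>The identity is stated for one element of the domain, with time derivatives replaced by
  \<open>wave_op a Z\<close>; \<open>R\<close> is the remaining quadratic form in the energy
  densities.\<close>

lemma multiplier_identity:
  assumes Z: "Z \<in> wave_dom a"
  obtains R where "a 1 / 2 * (trace Z)\<^sup>2 = multiplier (wave_op a Z) Z + multiplier Z (wave_op a Z) + R"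
    "(1 / 2 - mu a / 4) * (nrm Z)\<^sup>2 \<le> R" "R \<le> 2 * (nrm Z)\<^sup>2"
proof -
  note ZD = wave_domD[OF Z]
  have uV: "fst Z \<in> V1 a" and vV: "snd Z \<in> V1 a" and v1: "snd Z 1 = 0"
    using ZD by (auto simp: H1a_def)
  let ?f = "deriv (\<lambda>x. a x * deriv (fst Z) x)"
  have fL: "?f \<in> L2 1" by (rule V2_deriv_flux_L2[OF ZD(1)])
  define Iv where "Iv = (LINT x|leb. (snd Z x)\<^sup>2)"
  define Ie where "Ie = (LINT x|leb. a x * deriv (fst Z) x * deriv (fst Z) x)"
  define Is where "Is = (LINT x|leb. x * a' x * (deriv (fst Z) x)\<^sup>2)"
  define X where "X = (LINT x|leb. x * deriv (fst Z) x * ?f x)"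
  \<comment> \<open>With \<open>Is \<le> mu a * Ie\<close> the coefficient of \<open>Ie\<close> is
    at least \<open>1 / 2 + mu a / 4 - mu a / 2\<close>, that of \<open>Iv\<close>: this equality
    fixes the factor \<open>mu a / 4\<close> in the multiplier. With
    \<open>Is \<ge> - mu a * Ie\<close> it is at most \<open>1 / 2 + 3 / 4 * mu a\<close>, which is
    below 2.\<close>
  define R where "R = (1 / 2 + mu a / 4) * Ie - 1 / 2 * Is + (1 / 2 - mu a / 4) * Iv"
  have iv: "integrable leb (\<lambda>x. (snd Z x)\<^sup>2)" by (rule L2_integrable[OF V1_L2[OF vV]])
  have ie: "integrable leb (\<lambda>x. a x * deriv (fst Z) x * deriv (fst Z) x)" by (rule V1_energy_integrable[OF uV uV])
  have isl: "integrable leb (\<lambda>x. x * a' x * (deriv (fst Z) x)\<^sup>2)" by (rule slope_energy_integrable[OF uV])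
  have iX: "integrable leb (\<lambda>x. x * deriv (fst Z) x * ?f x)"
    by (rule L2_mult_integrable[OF V1_x_deriv_L2[OF uV] fL])
  have 1: "(LINT x|leb. x * deriv (snd Z) x * snd Z x) = - 1 / 2 * Iv"
  proof -
    have i: "integrable leb (\<lambda>x. x * deriv (snd Z) x * snd Z x)"
      by (rule L2_mult_integrable[OF V1_x_deriv_L2[OF vV] V1_L2[OF vV]])
    have "0 = (LINT x|leb. (snd Z x)\<^sup>2 + 2 * (x * deriv (snd Z) x * snd Z x))"
      using V1_square_parts(1)[OF vV] v1 by (simp add: mult_ac)
    also have "\<dots> = Iv + 2 * (LINT x|leb. x * deriv (snd Z) x * snd Z x)"
      unfolding Iv_def using iv i by (subst Bochner_Integration.integral_add) auto
    finally show ?thesis by simp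
  qed
  have 2: "a 1 * (trace Z)\<^sup>2 = Ie - Is + 2 * X"
  proof -
    have "a 1 * (trace Z)\<^sup>2 = (LINT x|leb. (a x * deriv (fst Z) x * deriv (fst Z) x - x * a' x * (deriv (fst Z) x)\<^sup>2) + 2 * (x * deriv (fst Z) x * ?f x))"
      unfolding flux_multiplier_parts[OF ZD(1)] by (simp add: left_diff_distrib power2_eq_square mult.assoc)
    also have "\<dots> = Ie - Is + 2 * X"
      unfolding Ie_def Is_def X_def using ie isl iX
      by (subst Bochner_Integration.integral_add) auto
    finally show ?thesis .
  qed
  have 3: "(LINT x|leb. fst Z x * ?f x) = - Ie"
  proof -
    have i: "integrable leb (\<lambda>x. fst Z x * ?f x)" by (rule L2_mult_integrable[OF V1_L2[OF uV] fL])
    have "0 = (LINT x|leb. fst Z x * ?f x + a x * deriv (fst Z) x * deriv (fst Z) x)"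
      using flux_parts[OF ZD(1,2)] by simp
    also have "\<dots> = (LINT x|leb. fst Z x * ?f x) + Ie"
      unfolding Ie_def using i ie by (subst Bochner_Integration.integral_add) auto
    finally show ?thesis by simp
  qed
  have m1: "multiplier (wave_op a Z) Z = - 1 / 2 * Iv + mu a / 4 * Iv"
    unfolding multiplier_split[OF ZD(5,4)] using 1 by (simp add: wave_op_def Iv_def power2_eq_square)
  have m2: "multiplier Z (wave_op a Z) = X - mu a / 4 * Ie"
    unfolding multiplier_split[OF ZD(4,5)] using 3 by (simp add: wave_op_def X_def)
  have ss: "x * a' x * d\<^sup>2 \<le> mu a * (a x * d * d) \<and> - (mu a * (a x * d * d)) \<le> x * a' x * d\<^sup>2"
    if "x \<in> space leb" for x d
  proof -
    have "\<bar>x * a' x\<bar> * d\<^sup>2 \<le> (mu a * a x) * d\<^sup>2"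
      using mu_bound[of x] that by (intro mult_right_mono) (auto simp: abs_mult)
    then have "\<bar>x * a' x * d\<^sup>2\<bar> \<le> mu a * (a x * d * d)" by (simp add: abs_mult power2_eq_square mult.assoc)
    then show ?thesis by linarith
  qed
  have s1: "Is \<le> mu a * Ie"
  proof -
    have "Is \<le> (LINT x|leb. mu a * (a x * deriv (fst Z) x * deriv (fst Z) x))"
      unfolding Is_def using ss by (intro integral_mono isl integrable_mult_right ie) blast
    then show ?thesis by (simp add: Ie_def)
  qed
  have s2: "- (mu a * Ie) \<le> Is"
  proof -
    have "(LINT x|leb. - (mu a * (a x * deriv (fst Z) x * deriv (fst Z) x))) \<le> Is"
      unfolding Is_def using ss by (intro integral_mono isl Bochner_Integration.integrable_minus integrable_mult_right ie) blast
    then show ?thesis by (simp add: Ie_def)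
  qed
  have nrm: "(nrm Z)\<^sup>2 = Iv + Ie" using LINT_square_snd_add[OF ZD(4)] by (simp add: Iv_def Ie_def)
  have I0: "0 \<le> Iv" "0 \<le> Ie" unfolding Iv_def Ie_def by (simp_all add: LINT_energy_nonneg)
  have "mu a * Ie \<le> 2 * Ie" "mu a * Iv \<ge> 0" using mu_nonneg mu_less_2 I0 by (auto intro: mult_right_mono)
  then show thesis
    using that[of R] 2 s1 s2 I0 unfolding m1 m2 R_def nrm by (simp add: field_simps)
qed

section \<open>Linear structure of the domain\<close>

lemma V2_lincomb:
  assumes u: "u \<in> V2 a" and w: "w \<in> V2 a"
  shows "(\<lambda>x. c * u x + d * w x) \<in> V2 a"
proof -
  obtain h where h: "abs_cont_on {0..1} h" "deriv h \<in> L2 1"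
    "\<And>x. 0 < x \<Longrightarrow> x < 1 \<Longrightarrow> a x * deriv u x = h x" by (rule V2_flux[OF u], rule that)
  obtain k where k: "abs_cont_on {0..1} k" "deriv k \<in> L2 1"
    "\<And>x. 0 < x \<Longrightarrow> x < 1 \<Longrightarrow> a x * deriv w x = k x" by (rule V2_flux[OF w], rule that)
  have V: "u \<in> V1 a" "w \<in> V1 a" using u w by (auto simp: V2_def)
  have "(\<lambda>x. a x * deriv (\<lambda>x. c * u x + d * w x) x) \<in> H1"
    unfolding H1_def
  proof (rule CollectI, intro exI conjI)
    show "abs_cont_on {0..1} (\<lambda>x. c * h x + d * k x)" by (rule abs_cont_on_lincomb[OF h(1) k(1)])
    show "deriv (\<lambda>x. c * h x + d * k x) \<in> L2 1"
    proof (rule L2_cong_AE[OF L2_lincomb[OF h(2) k(2)]])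
      show "AE x in leb. c * deriv h x + d * deriv k x = deriv (\<lambda>x. c * h x + d * k x) x"
        using deriv_lincomb_AE[OF abs_cont_on_loc_abs_cont[OF h(1)] abs_cont_on_loc_abs_cont[OF k(1)], of c d]
        by eventually_elim simp
    qed
    show "eq_ae (\<lambda>x. a x * deriv (\<lambda>x. c * u x + d * w x) x) (\<lambda>x. c * h x + d * k x)"
      unfolding eq_ae_def
      using deriv_lincomb_AE[OF V1_loc_abs_cont[OF V(1)] V1_loc_abs_cont[OF V(2)], of c d] AE_space
      by eventually_elim (auto simp: h(3)[symmetric] k(3)[symmetric] algebra_simps)
  qed
  then show ?thesis using V1_lincomb[OF V] by (auto simp: V2_def)
qed

lemma wave_dom_lincomb:
  assumes "Z \<in> wave_dom a" "W \<in> wave_dom a"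
  shows "lincomb c Z d W \<in> wave_dom a"
  using wave_domD[OF assms(1)] wave_domD[OF assms(2)]
  by (auto simp: wave_dom_def H2a_def mem_Times_iff fst_lincomb snd_lincomb intro: V2_lincomb H1a_lincomb)

text \<open>Only up to \<open>state_eq\<close>: \<open>deriv\<close> is additive where both fluxes
  are differentiable, which holds almost everywhere.\<close>

lemma wave_op_lincomb:
  assumes Z: "Z \<in> wave_dom a" and W: "W \<in> wave_dom a"
  shows "state_eq (wave_op a (lincomb c Z d W)) (lincomb c (wave_op a Z) d (wave_op a W))"
proof -
  obtain h where h: "abs_cont_on {0..1} h"
    "\<And>x. 0 < x \<Longrightarrow> x < 1 \<Longrightarrow> a x * deriv (fst Z) x = h x"
    "\<And>x. 0 < x \<Longrightarrow> x < 1 \<Longrightarrow> deriv (\<lambda>x. a x * deriv (fst Z) x) x = deriv h x"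
    "\<And>x. 0 < x \<Longrightarrow> x < 1 \<Longrightarrow> DERIV (fst Z) x :> deriv (fst Z) x"
    by (rule V2_flux[OF wave_domD(1)[OF Z]], rule that)
  obtain k where k: "abs_cont_on {0..1} k"
    "\<And>x. 0 < x \<Longrightarrow> x < 1 \<Longrightarrow> a x * deriv (fst W) x = k x"
    "\<And>x. 0 < x \<Longrightarrow> x < 1 \<Longrightarrow> deriv (\<lambda>x. a x * deriv (fst W) x) x = deriv k x"
    "\<And>x. 0 < x \<Longrightarrow> x < 1 \<Longrightarrow> DERIV (fst W) x :> deriv (fst W) x"
    by (rule V2_flux[OF wave_domD(1)[OF W]], rule that)
  have flux: "a x * deriv (\<lambda>x. c * fst Z x + d * fst W x) x = c * h x + d * k x" if x: "0 < x" "x < 1" for x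
  proof -
    have "DERIV (\<lambda>x. c * fst Z x + d * fst W x) x :> c * deriv (fst Z) x + d * deriv (fst W) x"
      using h(4)[OF x] k(4)[OF x] by (auto intro!: derivative_eq_intros)
    then show ?thesis
      using h(2)[OF x] k(2)[OF x] by (auto dest!: DERIV_imp_deriv simp: algebra_simps)
  qed
  have dflux: "deriv (\<lambda>x. a x * deriv (\<lambda>x. c * fst Z x + d * fst W x) x) x = deriv (\<lambda>x. c * h x + d * k x) x"
    if x: "0 < x" "x < 1" for x
  proof (rule deriv_cong_ev)
    have "\<forall>\<^sub>F z in nhds x. z \<in> {0<..<1}" using x by (intro eventually_nhds_in_open) auto
    then show "\<forall>\<^sub>F x in nhds x. a x * deriv (\<lambda>x. c * fst Z x + d * fst W x) x = c * h x + d * k x"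
      by eventually_elim (rule flux, auto)
  qed simp
  have "eq_ae (deriv (\<lambda>x. a x * deriv (\<lambda>x. c * fst Z x + d * fst W x) x))
      (\<lambda>x. c * deriv (\<lambda>x. a x * deriv (fst Z) x) x + d * deriv (\<lambda>x. a x * deriv (fst W) x) x)"
    unfolding eq_ae_def
    using deriv_lincomb_AE[OF abs_cont_on_loc_abs_cont[OF h(1)] abs_cont_on_loc_abs_cont[OF k(1)], of c d] AE_space
  proof eventually_elim
    fix x assume "deriv (\<lambda>x. c * h x + d * k x) x = c * deriv h x + d * deriv k x" "x \<in> space leb"
    then show "deriv (\<lambda>x. a x * deriv (\<lambda>x. c * fst Z x + d * fst W x) x) x =
      c * deriv (\<lambda>x. a x * deriv (fst Z) x) x + d * deriv (\<lambda>x. a x * deriv (fst W) x) x"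
      using dflux[of x] h(3)[of x] k(3)[of x] by simp
  qed
  then show ?thesis
    by (simp add: state_eq_def wave_op_def lincomb_def eq_ae_def)
qed

lemma trace_lincomb:
  assumes Z: "Z \<in> wave_dom a" and W: "W \<in> wave_dom a"
  shows "trace (lincomb c Z d W) = c * trace Z + d * trace W"
proof -
  have Z1: "(fst Z has_real_derivative trace Z) (at 1 within {0<..1})"
    by (rule V2_flux[OF wave_domD(1)[OF Z]])
  have W1: "(fst W has_real_derivative trace W) (at 1 within {0<..1})"
    by (rule V2_flux[OF wave_domD(1)[OF W]])
  have "at (1::real) within {0<..1} = at_left 1"
    by (rule at_within_nhd[of _ "{0<..}"]) auto
  moreover have "((\<lambda>x. c * fst Z x + d * fst W x) has_real_derivative c * trace Z + d * trace W) (at 1 within {0<..1})"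
    using Z1 W1 by (auto intro!: derivative_eq_intros)
  ultimately show ?thesis
    unfolding deriv_on_def fst_lincomb
    by (intro vector_derivative_within) (auto simp: has_real_derivative_iff_has_vector_derivative deriv_on_def)
qed

lemma trace_cong:
  assumes eq: "\<And>x. 0 < x \<Longrightarrow> x \<le> 1 \<Longrightarrow> f x = g x"
  shows "deriv_on {0<..1} f 1 = deriv_on {0<..1} g 1"
proof -
  have "(f has_vector_derivative D) (at 1 within {0<..1}) \<longleftrightarrow> (g has_vector_derivative D) (at 1 within {0<..1})" for D
    using eq by (intro has_vector_derivative_cong_ev) (auto simp: eventually_at_filter intro!: always_eventually)
  then show ?thesis by (simp add: deriv_on_def vector_derivative_def)
qed

end

section \<open>Completeness and dense subsets of L2\<close>

lemma continuous_on_Icc_bounded: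
  fixes f :: "real \<Rightarrow> real"
  assumes "continuous_on {c..d} f"
  obtains B where "\<And>x. x \<in> {c..d} \<Longrightarrow> \<bar>f x\<bar> \<le> B"
proof -
  have "bounded (f ` {c..d})"
    using assms by (intro compact_imp_bounded compact_continuous_image) auto
  then obtain B where "\<forall>x\<in>{c..d}. \<bar>f x\<bar> \<le> B" by (auto simp: bounded_iff)
  then show thesis by (intro that[of B]) auto
qed

lemma L2_diff: "f \<in> L2 b \<Longrightarrow> g \<in> L2 b \<Longrightarrow> (\<lambda>x. f x - g x) \<in> L2 b"
  using L2_lincomb[of f b g 1 "-1"] by simp

lemma LINT_square_add_le:
  assumes "f \<in> L2 b" "g \<in> L2 b"
  shows "(LINT x|lebesgue_on {0<..<b}. (f x + g x)\<^sup>2) \<le>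
    2 * (LINT x|lebesgue_on {0<..<b}. (f x)\<^sup>2) + 2 * (LINT x|lebesgue_on {0<..<b}. (g x)\<^sup>2)"
proof -
  have fg: "(\<lambda>x. f x + g x) \<in> L2 b" using L2_lincomb[OF assms, of 1 1] by simp
  have "(LINT x|lebesgue_on {0<..<b}. (f x + g x)\<^sup>2) \<le> (LINT x|lebesgue_on {0<..<b}. 2 * (f x)\<^sup>2 + 2 * (g x)\<^sup>2)"
  proof (rule integral_mono)
    fix x
    have "0 \<le> (f x - g x)\<^sup>2" by simp
    then show "(f x + g x)\<^sup>2 \<le> 2 * (f x)\<^sup>2 + 2 * (g x)\<^sup>2" by (simp add: power2_eq_square algebra_simps)
  qed (intro Bochner_Integration.integrable_add integrable_mult_right L2_integrable assms fg)+
  also have "\<dots> = 2 * (LINT x|lebesgue_on {0<..<b}. (f x)\<^sup>2) + 2 * (LINT x|lebesgue_on {0<..<b}. (g x)\<^sup>2)"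
    using assms[THEN L2_integrable] by (subst Bochner_Integration.integral_add) auto
  finally show ?thesis .
qed

text \<open>The interval has finite measure, so the sequence is Cauchy in L1 and a subsequence
  converges almost everywhere. Fatou's lemma carries the Cauchy bounds over to the limit.\<close>

lemma L2_complete:
  assumes f: "\<And>n. f n \<in> L2 T"
    and cauchy: "\<And>e. e > 0 \<Longrightarrow> \<exists>K. \<forall>i\<ge>K. \<forall>j\<ge>K. (LINT x|lebesgue_on {0<..<T}. (f i x - f j x)\<^sup>2) < e"
  obtains g where "g \<in> L2 T" "(\<lambda>n. LINT x|lebesgue_on {0<..<T}. (f n x - g x)\<^sup>2) \<longlonglongrightarrow> 0"
proof -
  let ?M = "lebesgue_on {0<..<T}"
  \<comment> \<open>The total mass. Division by \<open>m + 1\<close> below is safe and makes the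
    resulting bound strict.\<close>
  define m where "m = (LINT x|?M. (1::real)\<^sup>2)"
  have m0: "m \<ge> 0" unfolding m_def by simp
  have L1: "(LINT x|?M. norm (f i x - f j x)) < e"
    if "(LINT x|?M. (f i x - f j x)\<^sup>2) < e\<^sup>2 / (m + 1)" "e > 0" for i j e
  proof -
    have d: "(\<lambda>x. \<bar>f i x - f j x\<bar>) \<in> L2 T"
      using L2_diff[OF f f, of i j] by (auto simp: L2_def)
    have "(LINT x|?M. \<bar>f i x - f j x\<bar> * 1)\<^sup>2 \<le> (LINT x|?M. \<bar>f i x - f j x\<bar>\<^sup>2) * m"
      unfolding m_def by (rule L2_Cauchy_Schwarz[OF d L2_const])
    also have "\<dots> \<le> e\<^sup>2 / (m + 1) * m" using that m0 by (intro mult_right_mono) auto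
    also have "\<dots> < e\<^sup>2" using m0 that by (simp add: field_simps)
    finally show ?thesis using that(2) by (simp add: power2_less_imp_less)
  qed
  have "\<exists>K. \<forall>i\<ge>K. \<forall>j\<ge>K. (LINT x|?M. norm (f i x - f j x)) < e" if "e > 0" for e
  proof -
    have "e\<^sup>2 / (m + 1) > 0" using that m0 by simp
    from cauchy[OF this] show ?thesis using L1[OF _ that] by blast
  qed
  then obtain r where r: "strict_mono r" "AE x in ?M. Cauchy (\<lambda>i. f (r i) x)"
    using cauchy_L1_AE_cauchy_subseq[of ?M f] L2_imp_integrable[OF f] by blast
  define g where "g = (\<lambda>x. lim (\<lambda>i. f (r i) x))"
  have [measurable]: "f n \<in> borel_measurable ?M" for n by (rule L2_measurable[OF f])
  have gm [measurable]: "g \<in> borel_measurable ?M" unfolding g_def by measurable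
  have lim: "AE x in ?M. (\<lambda>i. f (r i) x) \<longlonglongrightarrow> g x"
    using r(2) by eventually_elim (simp add: g_def Cauchy_convergent convergent_LIMSEQ_iff[symmetric])
  have fatou: "(\<integral>\<^sup>+x. ennreal ((f n x - g x)\<^sup>2) \<partial>?M) \<le> ennreal e"
    if K: "\<And>j. j \<ge> K \<Longrightarrow> (LINT x|?M. (f n x - f j x)\<^sup>2) < e" for n K e
  proof -
    have "(\<integral>\<^sup>+x. ennreal ((f n x - g x)\<^sup>2) \<partial>?M) = (\<integral>\<^sup>+x. liminf (\<lambda>i. ennreal ((f n x - f (r i) x)\<^sup>2)) \<partial>?M)"
    proof (rule nn_integral_cong_AE, use lim in eventually_elim)
      fix x assume "(\<lambda>i. f (r i) x) \<longlonglongrightarrow> g x"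
      then have "(\<lambda>i. ennreal ((f n x - f (r i) x)\<^sup>2)) \<longlonglongrightarrow> ennreal ((f n x - g x)\<^sup>2)"
        by (intro tendsto_intros)
      then show "ennreal ((f n x - g x)\<^sup>2) = liminf (\<lambda>i. ennreal ((f n x - f (r i) x)\<^sup>2))"
        by (rule lim_imp_Liminf[OF sequentially_bot, symmetric])
    qed
    also have "\<dots> \<le> liminf (\<lambda>i. \<integral>\<^sup>+x. ennreal ((f n x - f (r i) x)\<^sup>2) \<partial>?M)"
      by (rule nn_integral_liminf) measurable
    also have "\<dots> \<le> limsup (\<lambda>i. \<integral>\<^sup>+x. ennreal ((f n x - f (r i) x)\<^sup>2) \<partial>?M)"
      by (rule Liminf_le_Limsup) simp
    also have "\<dots> \<le> ennreal e"
    proof (rule Limsup_bounded)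
      have "(\<integral>\<^sup>+x. ennreal ((f n x - f (r i) x)\<^sup>2) \<partial>?M) \<le> ennreal e" if "i \<ge> K" for i
      proof -
        have "r i \<ge> K" using seq_suble[OF r(1), of i] that by simp
        moreover have "(\<integral>\<^sup>+x. ennreal ((f n x - f (r i) x)\<^sup>2) \<partial>?M) = ennreal (LINT x|?M. (f n x - f (r i) x)\<^sup>2)"
          by (intro nn_integral_eq_integral L2_integrable L2_diff f) auto
        ultimately show ?thesis using K[of "r i"] by (simp add: ennreal_leI less_imp_le)
      qed
      then show "\<forall>\<^sub>F i in sequentially. (\<integral>\<^sup>+x. ennreal ((f n x - f (r i) x)\<^sup>2) \<partial>?M) \<le> ennreal e"
        by (auto simp: eventually_sequentially)
    qed
    finally show ?thesis .
  qed
  have close: "(\<lambda>x. f n x - g x) \<in> L2 T \<and> (LINT x|?M. (f n x - g x)\<^sup>2) \<le> e"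
    if K: "\<And>j. j \<ge> K \<Longrightarrow> (LINT x|?M. (f n x - f j x)\<^sup>2) < e" and e: "e > 0" for n K e
  proof -
    have le: "(\<integral>\<^sup>+x. ennreal ((f n x - g x)\<^sup>2) \<partial>?M) \<le> ennreal e" by (rule fatou[OF K])
    have i: "integrable ?M (\<lambda>x. (f n x - g x)\<^sup>2)"
    proof (rule integrableI_bounded)
      show "(\<integral>\<^sup>+x. ennreal (norm ((f n x - g x)\<^sup>2)) \<partial>?M) < \<infinity>"
        using le by (simp add: le_less_trans)
    qed measurable
    moreover have "ennreal (LINT x|?M. (f n x - g x)\<^sup>2) \<le> ennreal e"
      using le nn_integral_eq_integral[OF i] by simp
    ultimately show ?thesis using e by (auto simp: L2_def ennreal_le_iff)
  qed
  obtain K1 where K1: "\<And>i j. i \<ge> K1 \<Longrightarrow> j \<ge> K1 \<Longrightarrow> (LINT x|?M. (f i x - f j x)\<^sup>2) < 1"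
    using cauchy[of 1] by auto
  \<comment> \<open>Membership of \<open>g\<close> itself is obtained through its difference from a
    single term of the sequence.\<close>
  have dL: "(\<lambda>x. f K1 x - g x) \<in> L2 T" using close[of K1 K1 1] K1 by auto
  show thesis
  proof
    show "g \<in> L2 T" using L2_diff[OF f dL, of K1] by simp
    show "(\<lambda>n. LINT x|?M. (f n x - g x)\<^sup>2) \<longlonglongrightarrow> 0"
    proof (rule LIMSEQ_I)
      fix e :: real assume e: "e > 0"
      obtain K where K: "\<And>i j. i \<ge> K \<Longrightarrow> j \<ge> K \<Longrightarrow> (LINT x|?M. (f i x - f j x)\<^sup>2) < e / 2"
        using cauchy[of "e / 2"] e by auto
      have "norm ((LINT x|?M. (f n x - g x)\<^sup>2) - 0) < e" if "n \<ge> K" for n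
        using close[of K n "e / 2"] K that e by fastforce
      then show "\<exists>no. \<forall>n\<ge>no. norm ((LINT x|?M. (f n x - g x)\<^sup>2) - 0) < e" by blast
    qed
  qed
qed

text \<open>A measurable function is an almost everywhere limit of continuous ones. Clipping these
  to \<open>[-M, M]\<close> and approximating the n-th one uniformly within
  \<open>1 / (n + 1)\<close> keeps the polynomials bounded, as dominated convergence
  requires.\<close>

lemma polynomial_approximation_AE:
  assumes f: "f \<in> borel_measurable leb" and M: "\<And>x. x \<in> {0<..<1} \<Longrightarrow> \<bar>f x\<bar> \<le> M"
  obtains p where "\<And>n :: nat. real_polynomial_function (p n)"
    "\<And>n x. x \<in> {0<..<1} \<Longrightarrow> \<bar>p n x\<bar> \<le> M + 1" "AE x in leb. (\<lambda>n. p n x) \<longlonglongrightarrow> f x"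
proof -
  have M0: "0 \<le> M" using M[of "1/2"] by auto
  have "f measurable_on {0<..<1}"
    using f by (simp add: measurable_on_iff_borel_measurable)
  then obtain Z g where Z: "negligible Z" and g: "\<And>n. continuous_on UNIV (g n)"
    "\<And>x. x \<notin> Z \<Longrightarrow> (\<lambda>n. g n x) \<longlonglongrightarrow> (if x \<in> {0<..<1} then f x else 0)"
    unfolding measurable_on_def by blast
  define c where "c = (\<lambda>n x. max (- M) (min M (g n x)))"
  have cc: "continuous_on {0..1} (c n)" for n
    unfolding c_def by (intro continuous_intros continuous_on_subset[OF g(1)]) auto
  have cM: "\<bar>c n x\<bar> \<le> M" for n x using M0 by (auto simp: c_def)
  have "\<exists>p. real_polynomial_function p \<and> (\<forall>x\<in>{0..1}. \<bar>c n x - p x\<bar> < 1 / (real n + 1))" for n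
    by (rule Stone_Weierstrass_real_polynomial_function[of "{0..1}" "c n" "1 / (real n + 1)"]) (auto intro: cc)
  then obtain p where p: "\<And>n. real_polynomial_function (p n)"
    "\<And>n x. x \<in> {0..1} \<Longrightarrow> \<bar>c n x - p n x\<bar> < 1 / (real n + 1)" by metis
  show thesis
  proof (rule that[OF p(1)])
    show "\<bar>p n x\<bar> \<le> M + 1" if "x \<in> {0<..<1}" for n x
    proof -
      have "\<bar>c n x - p n x\<bar> < 1 / (real n + 1)" using p(2)[of x n] that by auto
      also have "\<dots> \<le> 1" by simp
      finally show ?thesis using cM[of n x] by linarith
    qed
    show "AE x in leb. (\<lambda>n. p n x) \<longlonglongrightarrow> f x"
    proof (rule AE_lebesgue_on_negligible[OF Z])
      fix x assume x: "x \<in> {0<..<1} - Z"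
      have "(\<lambda>n. c n x) \<longlonglongrightarrow> max (- M) (min M (f x))"
        unfolding c_def using g(2)[of x] x by (intro tendsto_intros) auto
      also have "max (- M) (min M (f x)) = f x" using M[of x] x by auto
      finally have cl: "(\<lambda>n. c n x) \<longlonglongrightarrow> f x" .
      have "(\<lambda>n. c n x - p n x) \<longlonglongrightarrow> 0"
      proof (rule Lim_null_comparison)
        show "\<forall>\<^sub>F n in sequentially. norm (c n x - p n x) \<le> 1 / (real n + 1)"
          using p(2)[of x] x by (intro always_eventually allI) (simp add: less_imp_le)
        show "(\<lambda>n. 1 / (real n + 1)) \<longlonglongrightarrow> 0"
          using LIMSEQ_inverse_real_of_nat by (simp add: inverse_eq_divide add.commute)
      qed
      from tendsto_diff[OF cl this] show "(\<lambda>n. p n x) \<longlonglongrightarrow> f x" by simp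
    qed
  qed
qed

text \<open>The weight may vanish at the end points; this is how boundary behaviour gets built into
  the approximants.\<close>

lemma weighted_polynomials_dense:
  assumes w: "w \<in> borel_measurable leb" "\<And>x. x \<in> {0<..<1} \<Longrightarrow> 0 < w x" "\<And>x. x \<in> {0<..<1} \<Longrightarrow> w x \<le> B"
    and f: "f \<in> L2 1" and e: "e > 0"
  obtains p where "real_polynomial_function p" "(\<lambda>x. w x * p x) \<in> L2 1"
    "(LINT x|leb. (w x * p x - f x)\<^sup>2) < e"
proof -
  have fm [measurable]: "f \<in> borel_measurable leb" by (rule L2_measurable[OF f])
  note w(1)[measurable]
  \<comment> \<open>The truncation bounds \<open>f\<close> and discards the points where
    \<open>w\<close> is below \<open>1 / k\<close>, so \<open>t k / w\<close> is bounded by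
    \<open>k * k\<close> and can be approximated by bounded polynomials.\<close>
  define t where "t = (\<lambda>(k::nat) x. if \<bar>f x\<bar> \<le> real k \<and> 1 \<le> real k * w x then f x else 0)"
  have tm [measurable]: "t k \<in> borel_measurable leb" for k unfolding t_def by measurable
  have tk: "\<bar>t k x\<bar> \<le> real k" for k x by (auto simp: t_def)
  have tL: "t k \<in> L2 1" for k by (rule L2_bounded[OF tm tk])
  have "(\<lambda>k. LINT x|leb. (t k x - f x)\<^sup>2) \<longlonglongrightarrow> (LINT x|leb. 0)"
  proof (rule integral_dominated_convergence[where w = "\<lambda>x. (f x)\<^sup>2"])
    show "AE x in leb. (\<lambda>k. (t k x - f x)\<^sup>2) \<longlonglongrightarrow> 0"
    proof (rule AE_I2)
      fix x assume x: "x \<in> space leb"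
      obtain K :: nat where K: "real K \<ge> max \<bar>f x\<bar> (1 / w x)" using real_arch_simple by blast
      have "(t k x - f x)\<^sup>2 = 0" if "k \<ge> K" for k
      proof -
        have k: "real k \<ge> \<bar>f x\<bar>" "real k \<ge> 1 / w x" using K that by auto
        then have "1 \<le> real k * w x" using w(2)[of x] x by (simp add: pos_divide_le_eq)
        with k show ?thesis by (simp add: t_def)
      qed
      then show "(\<lambda>k. (t k x - f x)\<^sup>2) \<longlonglongrightarrow> 0"
        by (intro tendsto_eventually) (auto simp: eventually_sequentially)
    qed
    show "AE x in leb. norm ((t k x - f x)\<^sup>2) \<le> (f x)\<^sup>2" for k by (rule AE_I2) (simp add: t_def)
  qed (use L2_integrable[OF f] in auto)
  \<comment> \<open>A quarter each, because \<open>LINT_square_add_le\<close> doubles both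
    errors.\<close>
  then have "\<forall>\<^sub>F k in sequentially. (LINT x|leb. (t k x - f x)\<^sup>2) < e / 4"
    using e by (intro order_tendstoD) auto
  then obtain k where k: "(LINT x|leb. (t k x - f x)\<^sup>2) < e / 4" by (auto simp: eventually_sequentially)
  define M where "M = real k * real k"
  have hb: "\<bar>t k x / w x\<bar> \<le> M" if x: "x \<in> {0<..<1}" for x
  proof (cases "t k x = 0")
    case False
    then have "\<bar>f x\<bar> \<le> real k" "1 \<le> real k * w x" "t k x = f x" unfolding t_def by presburger+
    moreover from this have "1 / w x \<le> real k" using w(2)[OF x] by (simp add: pos_divide_le_eq)
    ultimately have "\<bar>t k x\<bar> * (1 / w x) \<le> M" unfolding M_def using w(2)[OF x] by (intro mult_mono) auto
    then show ?thesis using w(2)[OF x] by simp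
  qed (simp add: M_def)
  have hm: "(\<lambda>x. t k x / w x) \<in> borel_measurable leb" by measurable
  obtain p where p: "\<And>n :: nat. real_polynomial_function (p n)"
    "\<And>n x. x \<in> {0<..<1} \<Longrightarrow> \<bar>p n x\<bar> \<le> M + 1" "AE x in leb. (\<lambda>n. p n x) \<longlonglongrightarrow> t k x / w x"
    by (rule polynomial_approximation_AE[OF hm hb], assumption, rule that)
  have pm [measurable]: "p n \<in> borel_measurable leb" for n
    using p(1)[of n] by (intro continuous_on_measurable_lebesgue_on) (simp add: continuous_on_polymonial_function real_polynomial_function_eq)
  have wp: "\<bar>w x * p n x\<bar> \<le> B * (M + 1)" if "x \<in> {0<..<1}" for n x
    unfolding abs_mult using w(2,3)[OF that] p(2)[OF that, of n] by (intro mult_mono) auto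
  have wpL: "(\<lambda>x. w x * p n x) \<in> L2 1" for n
    by (rule L2_bounded[OF _ wp]) auto
  have "(\<lambda>n. LINT x|leb. (w x * p n x - t k x)\<^sup>2) \<longlonglongrightarrow> (LINT x|leb. 0)"
  proof (rule integral_dominated_convergence[where w = "\<lambda>x. (B * (M + 1) + real k)\<^sup>2"])
    show "AE x in leb. (\<lambda>n. (w x * p n x - t k x)\<^sup>2) \<longlonglongrightarrow> 0"
      using p(3) AE_space
    proof eventually_elim
      fix x assume l: "(\<lambda>n. p n x) \<longlonglongrightarrow> t k x / w x" and x: "x \<in> space leb"
      have "(\<lambda>n. (w x * p n x - t k x)\<^sup>2) \<longlonglongrightarrow> (w x * (t k x / w x) - t k x)\<^sup>2"
        by (intro tendsto_intros l)
      moreover have "w x * (t k x / w x) - t k x = 0" using w(2)[of x] x by simp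
      ultimately show "(\<lambda>n. (w x * p n x - t k x)\<^sup>2) \<longlonglongrightarrow> 0" by simp
    qed
    show "AE x in leb. norm ((w x * p n x - t k x)\<^sup>2) \<le> (B * (M + 1) + real k)\<^sup>2" for n
    proof (rule AE_I2)
      fix x assume "x \<in> space leb"
      then have "\<bar>w x * p n x - t k x\<bar> \<le> B * (M + 1) + real k"
        using wp[of x n] tk[of k x] by auto
      then have "\<bar>w x * p n x - t k x\<bar>\<^sup>2 \<le> (B * (M + 1) + real k)\<^sup>2" by (intro power_mono) auto
      then show "norm ((w x * p n x - t k x)\<^sup>2) \<le> (B * (M + 1) + real k)\<^sup>2" by simp
    qed
    show "integrable leb (\<lambda>x. (B * (M + 1) + real k)\<^sup>2)"
      by (rule finite_measure.integrable_const[OF finite_measure_lebesgue_on_Ioo])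
  qed auto
  then have "\<forall>\<^sub>F n in sequentially. (LINT x|leb. (w x * p n x - t k x)\<^sup>2) < e / 4"
    using e by (intro order_tendstoD) auto
  then obtain n where n: "(LINT x|leb. (w x * p n x - t k x)\<^sup>2) < e / 4" by (auto simp: eventually_sequentially)
  show thesis
  proof (rule that[OF p(1) wpL])
    show "(LINT x|leb. (w x * p n x - f x)\<^sup>2) < e"
      using LINT_square_add_le[OF L2_diff[OF wpL tL] L2_diff[OF tL f], of n k k] n k by simp
  qed
qed

section \<open>Density of the domain of the wave operator\<close>

context degenerate
begin

lemma polynomial_C1:
  assumes "real_polynomial_function p"
  obtains p' where "\<And>x. (p has_real_derivative p' x) (at x)" "continuous_on S p'"
  using has_real_derivative_polynomial_function[OF assms]
  by (metis continuous_on_polymonial_function real_polynomial_function_eq)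

text \<open>The weight \<open>x * (1 - x)\<close> makes the approximants vanish at both ends, as
  membership in \<open>H1a a\<close> demands at 1 and, for \<open>mu a < 1\<close>, at 0.\<close>

lemma velocity_dense:
  assumes f: "f \<in> L2 1" and e: "e > 0"
  obtains v where "v \<in> H1a a" "(LINT x|leb. (v x - f x)\<^sup>2) < e"
proof -
  let ?w = "\<lambda>x::real. x * (1 - x)"
  have wb: "?w x \<le> 1" if "x \<in> {0<..<1}" for x using that by (auto intro: mult_le_one)
  have wm: "?w \<in> borel_measurable leb"
    by (rule continuous_on_measurable_lebesgue_on) (intro continuous_intros)
  obtain p where p: "real_polynomial_function p" "(\<lambda>x. ?w x * p x) \<in> L2 1"
    "(LINT x|leb. (?w x * p x - f x)\<^sup>2) < e"
    using weighted_polynomials_dense[OF wm _ wb f e] by (auto)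
  let ?v = "\<lambda>x. ?w x * p x"
  obtain p' where p': "\<And>x. (p has_real_derivative p' x) (at x)" "continuous_on {0..1} p'"
    by (rule polynomial_C1[OF p(1)], rule that)
  let ?v' = "\<lambda>x. (1 - 2 * x) * p x + ?w x * p' x"
  have cp: "continuous_on S p" for S
    using p(1) by (simp add: continuous_on_polymonial_function real_polynomial_function_eq)
  have D: "(?v has_real_derivative ?v' x) (at x)" for x
    by (auto intro!: derivative_eq_intros p' simp: algebra_simps)
  have cv': "continuous_on {0..1} ?v'" by (intro continuous_intros cp p')
  have "loc_abs_cont ?v"
    by (rule C1_loc_abs_cont[OF has_field_derivative_at_within[OF D]]) (auto intro: continuous_on_subset[OF cv'])
  moreover have "sderiv ?v \<in> L2 1"
  proof -
    have c: "continuous_on {0..1} (\<lambda>x. sqrt (a x) * ?v' x)"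
      by (intro continuous_intros a_continuous cv')
    obtain B where B: "\<And>x. x \<in> {0..1} \<Longrightarrow> \<bar>sqrt (a x) * ?v' x\<bar> \<le> B"
      by (rule continuous_on_Icc_bounded[OF c], rule that)
    have "(\<lambda>x. sqrt (a x) * ?v' x) \<in> L2 1"
      by (rule L2_bounded[OF continuous_on_measurable_lebesgue_on[OF continuous_on_subset[OF c]] B]) auto
    then show ?thesis by (simp only: DERIV_imp_deriv[OF D])
  qed
  moreover have "(?v \<longlongrightarrow> ?v 0) (at_right 0)"
    using DERIV_isCont[OF D[of 0]] unfolding isCont_def by (rule filterlim_mono) (auto simp: at_within_le_at)
  ultimately have "?v \<in> H1a a" using p(2) by (auto simp: H1a_def V1_def)
  then show thesis using that p(3) by blast
qed

lemma x2_div_a_bound: "0 < x \<Longrightarrow> x \<le> 1 \<Longrightarrow> x\<^sup>2 / a x \<le> 1 / a 1"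
  using a_ge_square[of x] a_pos[of x] a_1_pos by (simp add: field_simps)

text \<open>An element of the domain is built by prescribing its flux \<open>x^2 * q x\<close>. The
  factor \<open>x^2\<close> compensates the degeneracy, so the derivative is bounded; the
  compatibility condition expresses that the primitive vanishing at 1 also vanishes at 0.\<close>

lemma polynomial_flux:
  assumes q: "real_polynomial_function q"
    and compat: "mu a < 1 \<Longrightarrow> (LINT x|leb. x\<^sup>2 * q x / a x) = 0"
  obtains u where "u \<in> H2a a" "\<And>x. x \<in> {0<..<1} \<Longrightarrow> deriv u x = x\<^sup>2 * q x / a x"
proof -
  let ?g = "\<lambda>x. x\<^sup>2 * q x / a x"
  have cq: "continuous_on S q" for S
    using q by (simp add: continuous_on_polymonial_function real_polynomial_function_eq)
  obtain q' where q': "\<And>x. (q has_real_derivative q' x) (at x)" "continuous_on {0..1} q'"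
    by (rule polynomial_C1[OF q], rule that)
  obtain B where B: "\<And>x. x \<in> {0..1} \<Longrightarrow> \<bar>q x\<bar> \<le> B"
    by (rule continuous_on_Icc_bounded[OF cq], rule that)
  have cg: "continuous_on {0<..1} ?g"
    using a_pos by (intro continuous_intros cq continuous_on_subset[OF a_continuous]) (auto simp: less_le)
  have gB: "\<bar>?g x\<bar> \<le> 1 / a 1 * B" if x: "x \<in> {0<..<1}" for x
  proof -
    have "\<bar>?g x\<bar> = x\<^sup>2 / a x * \<bar>q x\<bar>" using a_pos[of x] x by (simp add: abs_mult)
    also have "\<dots> \<le> 1 / a 1 * B" using x2_div_a_bound[of x] B[of x] x a_1_pos by (intro mult_mono) auto
    finally show ?thesis .
  qed
  have gm: "?g \<in> borel_measurable leb"
    by (rule continuous_on_measurable_lebesgue_on[OF continuous_on_subset[OF cg]]) auto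
  have gL: "?g \<in> L2 1" by (rule L2_bounded[OF gm gB])
  define u where "u = (\<lambda>x. - integral {x..1} ?g)"
  have io: "?g integrable_on {x..y}" if "0 < x" "y \<le> 1" for x y
    using that by (intro integrable_continuous_real continuous_on_subset[OF cg]) auto
  have Du: "(u has_real_derivative ?g x) (at x within {0<..1})" if x: "x \<in> {0<..1}" for x
  proof -
    have "((\<lambda>y. integral {x/2..y} ?g) has_real_derivative ?g x) (at x within {x/2..1})"
      using x by (intro integral_has_real_derivative continuous_on_subset[OF cg]) auto
    then have "((\<lambda>y. integral {x/2..y} ?g - integral {x/2..1} ?g) has_real_derivative ?g x) (at x within {x/2..1})"
      by (auto intro!: derivative_eq_intros)
    then have "(u has_real_derivative ?g x) (at x within {x/2..1})"
    proof (rule has_field_derivative_transform_within[of _ _ _ _ 1])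
      fix y assume y: "y \<in> {x/2..1}"
      have "integral {x/2..y} ?g + integral {y..1} ?g = integral {x/2..1} ?g"
        using y x by (intro Henstock_Kurzweil_Integration.integral_combine io) auto
      then show "integral {x/2..y} ?g - integral {x/2..1} ?g = u y" by (simp add: u_def)
    qed (use x in auto)
    also have "at x within {x/2..1} = at x within {0<..1}"
      by (rule at_within_nhd[of _ "{x/2<..}"]) (use x in auto)
    finally show ?thesis .
  qed
  have du: "deriv u x = ?g x" if "x \<in> {0<..<1}" for x
    using Du[of x] that by (intro DERIV_imp_deriv) (simp add: at_within_Ioc_1)
  have lac: "loc_abs_cont u" by (rule C1_loc_abs_cont[OF Du cg])
  have u1: "u 1 = 0" by (simp add: u_def)
  have uL: "u \<in> L2 1"
  proof (rule L2_bounded[OF loc_abs_cont_measurable[OF lac]])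
    fix x :: real assume x: "x \<in> {0<..<1}"
    have "norm (integral {x..1} ?g) \<le> integral {x..1} (\<lambda>_. 1 / a 1 * B)"
    proof (rule integral_norm_bound_integral)
      show "norm (?g y) \<le> 1 / a 1 * B" if "y \<in> {x..1}" for y
      proof (cases "y = 1")
        case True then show ?thesis using B[of 1] a_1_pos by (simp add: divide_right_mono)
      next
        case False then show ?thesis using gB[of y] that x by auto
      qed
    qed (use x io in auto)
    also have "\<dots> = 1 / a 1 * B * (1 - x)" using x by simp
    also have "\<dots> \<le> 1 / a 1 * B * 1"
      using x a_1_pos B[of 1] by (intro mult_left_mono mult_nonneg_nonneg) auto
    finally show "\<bar>u x\<bar> \<le> 1 / a 1 * B" by (simp add: u_def)
  qed
  have uV: "u \<in> V1 a"
  proof -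
    have "(\<lambda>x. sqrt (a x) * ?g x) \<in> L2 1"
    proof -
      obtain A where A': "\<And>x. x \<in> {0..1} \<Longrightarrow> \<bar>a x\<bar> \<le> A"
        by (rule continuous_on_Icc_bounded[OF a_continuous], rule that)
      have A: "\<bar>sqrt (a x)\<bar> \<le> sqrt A" if "x \<in> {0<..<1}" for x
        using A'[of x] a_pos[of x] that by auto
      show ?thesis
        by (rule L2_bounded_mult[OF gL _ A]) (use a_measurable in measurable)
    qed
    then have "sderiv u \<in> L2 1" by (rule L2_cong) (simp add: du)
    then show ?thesis using uL lac by (simp add: V1_def)
  qed
  let ?h = "\<lambda>x. x\<^sup>2 * q x"
  let ?h' = "\<lambda>x. 2 * x * q x + x\<^sup>2 * q' x"
  have Dh: "(?h has_real_derivative ?h' x) (at x)" for x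
    by (auto intro!: derivative_eq_intros q' simp: power2_eq_square algebra_simps)
  have ch': "continuous_on {0..1} ?h'" by (intro continuous_intros cq q')
  obtain C where C: "\<And>x. x \<in> {0..1} \<Longrightarrow> \<bar>?h' x\<bar> \<le> C"
    by (rule continuous_on_Icc_bounded[OF ch'], rule that)
  have "abs_cont_on {0..1} ?h"
  proof (rule lipschitz_abs_cont_on)
    fix x y :: real assume xy: "x \<in> {0..1}" "y \<in> {0..1}" "x \<le> y"
    have "norm (?h y - ?h x) \<le> C * norm (y - x)"
      by (rule field_differentiable_bound[of "{0..1}" ?h ?h'])
        (use xy C has_field_derivative_at_within[OF Dh] in auto)
    then show "\<bar>?h y - ?h x\<bar> \<le> C * (y - x)" using xy by simp
  qed
  moreover have "deriv ?h \<in> L2 1"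
  proof -
    have "?h' \<in> L2 1"
      by (rule L2_bounded[OF continuous_on_measurable_lebesgue_on[OF continuous_on_subset[OF ch']] C]) auto
    moreover have "deriv ?h = ?h'" by (rule ext, rule DERIV_imp_deriv[OF Dh])
    ultimately show ?thesis by simp
  qed
  moreover have "eq_ae (\<lambda>x. a x * deriv u x) ?h"
    unfolding eq_ae_def using a_pos by (intro AE_I2) (auto simp: du less_le)
  ultimately have "(\<lambda>x. a x * deriv u x) \<in> H1" unfolding H1_def by blast
  moreover have "(u \<longlongrightarrow> 0) (at_right 0)" if "mu a < 1"
  proof -
    have "AE x in leb. DERIV u x :> ?g x"
      using Du by (intro AE_I2) (auto simp: at_within_Ioc_1[symmetric])
    from loc_abs_cont_tendsto_at_0[OF lac L2_imp_integrable[OF gL] this]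
    show ?thesis using compat[OF that] u1 by simp
  qed
  ultimately have "u \<in> H2a a" using uV u1 by (auto simp: H2a_def V2_def H1a_def)
  then show thesis using that du by blast
qed

text \<open>By \<open>a_ge_powr\<close> with exponent \<open>mu a\<close>, \<open>1 / a\<close> is
  dominated by a multiple of \<open>x powr - mu a\<close>, integrable for
  \<open>mu a < 1\<close>.\<close>

lemma inverse_sqrt_a_L2:
  assumes "mu a < 1" shows "(\<lambda>x. 1 / sqrt (a x)) \<in> L2 1"
proof -
  have m: "(\<lambda>x. 1 / sqrt (a x)) \<in> borel_measurable leb" using a_measurable by measurable
  have "(\<lambda>x. x powr - mu a) integrable_on {0..1::real}"
    using assms by (intro integrable_on_powr_from_0) auto
  then have "(\<lambda>x. x powr - mu a) absolutely_integrable_on {0..1::real}"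
    by (rule nonnegative_absolutely_integrable_1) auto
  then have "(\<lambda>x. x powr - mu a) absolutely_integrable_on {0<..<1::real}"
    by (simp add: absolutely_integrable_on_Icc_iff_Ioo)
  then have i: "integrable leb (\<lambda>x. x powr - mu a)"
    by (simp add: set_integrable_def integrable_restrict_space)
  have "integrable leb (\<lambda>x. (1 / sqrt (a x))\<^sup>2)"
  proof (rule Bochner_Integration.integrable_bound)
    show "integrable leb (\<lambda>x. 1 / a 1 * x powr - mu a)" by (intro integrable_mult_right i)
    show "AE x in leb. norm ((1 / sqrt (a x))\<^sup>2) \<le> norm (1 / a 1 * x powr - mu a)"
    proof (rule AE_I2)
      fix x assume "x \<in> space leb"
      then have x: "0 < x" "x \<le> 1" by auto
      have "a 1 * x powr mu a \<le> a x" by (rule a_ge_powr[OF order_refl x])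
      then have "1 / a x \<le> 1 / (a 1 * x powr mu a)" using a_1_pos x a_pos[OF x] by (intro divide_left_mono) auto
      then show "norm ((1 / sqrt (a x))\<^sup>2) \<le> norm (1 / a 1 * x powr - mu a)"
        using x a_pos[OF x] a_1_pos by (simp add: power_divide powr_minus divide_simps)
    qed
  qed (use m in measurable)
  with m show ?thesis by (simp add: L2_def)
qed

text \<open>Approximating \<open>sqrt (a x) * deriv u x\<close> by
  \<open>x^2 / sqrt (a x) * q x\<close> gives fluxes as in \<open>polynomial_flux\<close>. For
  \<open>mu a < 1\<close> the compatibility condition is restored by subtracting a constant from
  \<open>q\<close>; this constant is small because \<open>u\<close> satisfies the corresponding
  condition exactly.\<close>

lemma displacement_dense:
  assumes u: "u \<in> H1a a" and e: "e > 0"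
  obtains z where "z \<in> H2a a" "(LINT x|leb. a x * (deriv z x - deriv u x)\<^sup>2) < e"
proof -
  let ?w = "\<lambda>x. x\<^sup>2 / sqrt (a x)"
  have uV: "u \<in> V1 a" and u1: "u 1 = 0" using u by (auto simp: H1a_def)
  have [measurable]: "(\<lambda>x. x) \<in> borel_measurable leb"
    by (rule continuous_on_measurable_lebesgue_on) (rule continuous_on_id)
  have wm: "?w \<in> borel_measurable leb" using a_measurable by measurable
  have w0: "0 < ?w x" if "x \<in> {0<..<1}" for x using that a_pos[of x] by simp
  have wB: "?w x \<le> 1 / sqrt (a 1)" if x: "x \<in> {0<..<1}" for x
  proof -
    have "?w x = x * (x / sqrt (a x))" by (simp add: power2_eq_square)
    also have "\<dots> \<le> 1 * (1 / sqrt (a 1))"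
      using x x_div_sqrt_a_bound[of x] a_pos[of x] by (intro mult_mono) auto
    finally show ?thesis by simp
  qed
  have wL: "?w \<in> L2 1"
  proof (rule L2_bounded[OF wm])
    show "\<bar>?w x\<bar> \<le> 1 / sqrt (a 1)" if "x \<in> {0<..<1}" for x
      using w0[OF that] wB[OF that] by (simp only: abs_of_pos)
  qed
  have pL: "sderiv u \<in> L2 1" by (rule V1_sderiv[OF uV])
  note result = that
  have fin: thesis if q: "real_polynomial_function q" "mu a < 1 \<Longrightarrow> (LINT x|leb. x\<^sup>2 * q x / a x) = 0"
    "(LINT x|leb. (?w x * q x - sderiv u x)\<^sup>2) < e" for q
  proof -
    obtain z where z: "z \<in> H2a a" "\<And>x. x \<in> {0<..<1} \<Longrightarrow> deriv z x = x\<^sup>2 * q x / a x"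
      by (rule polynomial_flux[OF q(1)], erule q(2), rule that)
    have "(LINT x|leb. a x * (deriv z x - deriv u x)\<^sup>2) = (LINT x|leb. (?w x * q x - sderiv u x)\<^sup>2)"
    proof (rule Bochner_Integration.integral_cong[OF refl])
      fix x assume x: "x \<in> space leb"
      then have ax: "a x > 0" using a_pos[of x] by auto
      have "?w x = sqrt (a x) * (x\<^sup>2 / a x)"
        using ax by (simp add: real_div_sqrt field_simps)
      then have "?w x * q x - sderiv u x = sqrt (a x) * (deriv z x - deriv u x)"
        using z(2)[of x] x by (simp add: algebra_simps)
      then show "a x * (deriv z x - deriv u x)\<^sup>2 = (?w x * q x - sderiv u x)\<^sup>2"
        using ax by (simp add: power_mult_distrib)
    qed
    with q(3) z(1) show thesis by (intro result[of z]) auto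
  qed
  show thesis
  proof (cases "mu a < 1")
    case False
    obtain q where "real_polynomial_function q" "(LINT x|leb. (?w x * q x - sderiv u x)\<^sup>2) < e"
      by (rule weighted_polynomials_dense[OF wm w0 wB pL e])
    then show thesis using fin False by blast
  next
    case True
    let ?i = "\<lambda>x. 1 / sqrt (a x)"
    have iL: "?i \<in> L2 1" by (rule inverse_sqrt_a_L2[OF True])
    define K where "K = (LINT x|leb. ?w x * ?i x)"
    define A where "A = (LINT x|leb. (?i x)\<^sup>2)"
    define B where "B = (LINT x|leb. (?w x)\<^sup>2)"
    have AB: "A \<ge> 0" "B \<ge> 0" by (simp_all add: A_def B_def)
    have K: "K > 0"
    proof -
      have "0 \<le> K" unfolding K_def by (rule integral_nonneg_AE, rule AE_I2) (use a_pos in \<open>auto simp: less_imp_le\<close>)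
      moreover have "K \<noteq> 0"
      proof
        assume "K = 0"
        then have "AE x in leb. ?w x * ?i x = 0"
          unfolding K_def using a_pos
          by (subst (asm) integral_nonneg_eq_0_iff_AE[OF L2_mult_integrable[OF wL iL]]) (auto intro!: AE_I2 simp: less_imp_le)
        then have ae: "AE x in leb. False" using AE_space by eventually_elim (use w0 a_pos in fastforce)
        have "negligible {0<..<1::real}"
        proof (rule AE_lebesgue_on_obtain_negligible[OF ae])
          fix Z :: "real set" assume "negligible Z" and Z: "\<And>x. x \<in> {0<..<1} - Z \<Longrightarrow> False"
          from this(1) show ?thesis by (rule negligible_subset) (use Z in blast)
        qed
        then show False using open_not_negligible[of "{0<..<1::real}"] by simp
      qed
      ultimately show ?thesis by simp
    qed
    \<comment> \<open>Chosen so that the approximation error and the error of the correction add up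
      to at most \<open>2 * \<epsilon> * D\<close>, which is \<open>2 / 3 * e\<close>.\<close>
    define D where "D = 1 + A * B / K\<^sup>2"
    define \<epsilon> where "\<epsilon> = e / (3 * D)"
    have pos: "D > 0" unfolding D_def using AB K by (intro add_pos_nonneg) auto
    have \<epsilon>: "\<epsilon> > 0" using e pos by (simp add: \<epsilon>_def)
    obtain q where q: "real_polynomial_function q" "(\<lambda>x. ?w x * q x) \<in> L2 1" "(LINT x|leb. (?w x * q x - sderiv u x)\<^sup>2) < \<epsilon>"
      by (rule weighted_polynomials_dense[OF wm w0 wB pL \<epsilon>])
    \<comment> \<open>This is the integral of \<open>deriv u\<close>, and \<open>u\<close> vanishes
      at both ends.\<close>
    have u'0: "(LINT x|leb. sderiv u x * ?i x) = 0"
    proof -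
      have eq: "sderiv u x * ?i x = deriv u x" if "x \<in> space leb" for x using that a_pos[of x] by auto
      have "integrable leb (deriv u)"
        by (rule Bochner_Integration.integrable_cong[THEN iffD1, OF refl eq L2_mult_integrable[OF pL iL]])
      from loc_abs_cont_tendsto_at_0[OF V1_loc_abs_cont[OF uV] this loc_abs_cont_DERIV_AE[OF V1_loc_abs_cont[OF uV]]]
      have "(u \<longlongrightarrow> u 1 - (LINT x|leb. deriv u x)) (at_right 0)" .
      moreover have "(u \<longlongrightarrow> 0) (at_right 0)" using u True by (simp add: H1a_def)
      ultimately have "u 1 - (LINT x|leb. deriv u x) = 0" by (rule tendsto_unique[OF trivial_limit_at_right_real])
      moreover have "(LINT x|leb. sderiv u x * ?i x) = (LINT x|leb. deriv u x)"
        by (rule Bochner_Integration.integral_cong[OF refl eq])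
      ultimately show ?thesis using u1 by simp
    qed
    \<comment> \<open>The constant that makes the integral of \<open>x^2 * (q x - c) / a x\<close>
      vanish. Since \<open>sderiv u\<close> is orthogonal to \<open>?i\<close>, Cauchy-Schwarz
      bounds \<open>c\<close> by the approximation error.\<close>
    define c where "c = (LINT x|leb. ?w x * q x * ?i x) / K"
    have cK: "c * K = (LINT x|leb. ?w x * q x * ?i x)" using K by (simp add: c_def)
    have dL: "(\<lambda>x. ?w x * q x - sderiv u x) \<in> L2 1" by (rule L2_diff[OF q(2) pL])
    have "c * K = (LINT x|leb. (?w x * q x - sderiv u x) * ?i x)"
    proof -
      have "(LINT x|leb. (?w x * q x - sderiv u x) * ?i x) = (LINT x|leb. ?w x * q x * ?i x - sderiv u x * ?i x)"
        by (simp only: left_diff_distrib)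
      also have "\<dots> = (LINT x|leb. ?w x * q x * ?i x) - (LINT x|leb. sderiv u x * ?i x)"
        by (intro Bochner_Integration.integral_diff L2_mult_integrable q iL pL)
      finally show ?thesis using K u'0 by (simp add: c_def)
    qed
    then have "(c * K)\<^sup>2 \<le> (LINT x|leb. (?w x * q x - sderiv u x)\<^sup>2) * A"
      unfolding A_def using L2_Cauchy_Schwarz[OF dL iL] by simp
    also have "\<dots> \<le> \<epsilon> * A" using q(3) AB by (intro mult_right_mono) auto
    finally have c2: "c\<^sup>2 \<le> \<epsilon> * A / K\<^sup>2" using K by (simp add: power_mult_distrib field_simps)
    show thesis
    proof (rule fin[of "\<lambda>x. q x - c"])
      show "real_polynomial_function (\<lambda>x. q x - c)"
        by (intro real_polynomial_function_diff q) auto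
      have i1: "integrable leb (\<lambda>x. ?w x * q x * ?i x)" by (intro L2_mult_integrable q iL)
      have i2: "integrable leb (\<lambda>x. ?w x * ?i x)" by (intro L2_mult_integrable wL iL)
      have "(LINT x|leb. x\<^sup>2 * (q x - c) / a x) = (LINT x|leb. ?w x * q x * ?i x - c * (?w x * ?i x))"
      proof (rule Bochner_Integration.integral_cong[OF refl])
        fix x assume "x \<in> space leb"
        then have "a x > 0" using a_pos[of x] by auto
        then have wi: "?w x * ?i x = x\<^sup>2 / a x" by simp
        have wqi: "?w x * q x * ?i x = q x * (?w x * ?i x)" by (simp only: mult_ac)
        then show "x\<^sup>2 * (q x - c) / a x = ?w x * q x * ?i x - c * (?w x * ?i x)"
          unfolding wqi wi by (simp add: algebra_simps diff_divide_distrib)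
      qed
      also have "\<dots> = (LINT x|leb. ?w x * q x * ?i x) - (LINT x|leb. c * (?w x * ?i x))"
        by (rule Bochner_Integration.integral_diff[OF i1 integrable_mult_right[OF i2]])
      also have "(LINT x|leb. c * (?w x * ?i x)) = c * K"
        unfolding K_def by (rule integral_mult_right_zero)
      finally have "(LINT x|leb. x\<^sup>2 * (q x - c) / a x) = (LINT x|leb. ?w x * q x * ?i x) - c * K" .
      then show "(LINT x|leb. x\<^sup>2 * (q x - c) / a x) = 0"
        by (simp only: cK diff_self)
      have "(LINT x|leb. (?w x * (q x - c) - sderiv u x)\<^sup>2) = (LINT x|leb. ((?w x * q x - sderiv u x) + (- c) * ?w x)\<^sup>2)"
      proof -
        have "w * (q - c) - s = (w * q - s) + (- c) * w" for w q s :: real by (simp add: algebra_simps)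
        then show ?thesis by (simp only:)
      qed
      also have "\<dots> \<le> 2 * (LINT x|leb. (?w x * q x - sderiv u x)\<^sup>2) + 2 * (LINT x|leb. ((- c) * ?w x)\<^sup>2)"
        by (rule LINT_square_add_le[OF dL]) (use L2_lincomb[OF wL wL, of "- c" 0] in simp)
      also have "\<dots> = 2 * (LINT x|leb. (?w x * q x - sderiv u x)\<^sup>2) + 2 * (c\<^sup>2 * B)"
        unfolding power_mult_distrib B_def by simp
      also have "\<dots> \<le> 2 * \<epsilon> + 2 * (\<epsilon> * A / K\<^sup>2 * B)"
        using q(3) c2 AB by (intro add_mono mult_left_mono mult_right_mono) auto
      also have "\<dots> = 2 * \<epsilon> * D" by (simp add: D_def algebra_simps)
      also have "\<dots> = 2 / 3 * e" using pos by (simp add: \<epsilon>_def)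
      also have "\<dots> < e" using e by simp
      finally show "(LINT x|leb. (?w x * (q x - c) - sderiv u x)\<^sup>2) < e" .
    qed
  qed
qed

lemma wave_dom_dense:
  assumes U: "U \<in> SS"
  obtains W where "\<And>n :: nat. W n \<in> wave_dom a" "(\<lambda>n. nrm (diff (W n) U)) \<longlonglongrightarrow> 0"
proof -
  have "\<exists>W\<in>wave_dom a. (nrm (diff W U))\<^sup>2 < e" if e: "e > 0" for e
  proof -
    obtain z where z: "z \<in> H2a a" "(LINT x|leb. a x * (deriv z x - deriv (fst U) x)\<^sup>2) < e / 2"
      by (rule displacement_dense[OF state_spaceD(1)[OF U], of "e / 2"]) (use e in auto)
    obtain v where v: "v \<in> H1a a" "(LINT x|leb. (v x - snd U x)\<^sup>2) < e / 2"
      by (rule velocity_dense[OF state_spaceD(3)[OF U], of "e / 2"]) (use e in auto)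
    have W: "(z, v) \<in> wave_dom a" using z v by (auto simp: wave_dom_def)
    note WS = wave_domD(4)[OF W]
    have D: "diff (z, v) U \<in> SS" by (rule state_space_lincomb[OF WS U])
    have "(LINT x|leb. a x * deriv (fst (diff (z, v) U)) x * deriv (fst (diff (z, v) U)) x) =
        (LINT x|leb. a x * (deriv z x - deriv (fst U) x)\<^sup>2)"
    proof (rule integral_cong_AE)
      show "(\<lambda>x. a x * deriv (fst (diff (z, v) U)) x * deriv (fst (diff (z, v) U)) x) \<in> borel_measurable leb"
        by (intro borel_measurable_integrable V1_energy_integrable state_spaceD D)
      have "deriv z \<in> borel_measurable leb" "deriv (fst U) \<in> borel_measurable leb"
        using V1_deriv_measurable[OF state_spaceD(2)[OF WS]] V1_deriv_measurable[OF state_spaceD(2)[OF U]] by auto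
      then show "(\<lambda>x. a x * (deriv z x - deriv (fst U) x)\<^sup>2) \<in> borel_measurable leb"
        using a_measurable by measurable
      have "loc_abs_cont z" using state_spaceD(5)[OF WS] by simp
      from deriv_lincomb_AE[OF this state_spaceD(5)[OF U], of 1 "-1"]
      show "AE x in leb. a x * deriv (fst (diff (z, v) U)) x * deriv (fst (diff (z, v) U)) x =
          a x * (deriv z x - deriv (fst U) x)\<^sup>2"
        by eventually_elim (simp add: fst_lincomb power2_eq_square)
    qed
    moreover have "(LINT x|leb. (snd (diff (z, v) U) x)\<^sup>2) = (LINT x|leb. (v x - snd U x)\<^sup>2)"
      by (simp add: snd_lincomb)
    ultimately have "(nrm (diff (z, v) U))\<^sup>2 < e"
      unfolding LINT_square_snd_add[OF D, symmetric] using z(2) v(2) by simp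
    with W show ?thesis by blast
  qed
  then have "\<exists>W\<in>wave_dom a. (nrm (diff W U))\<^sup>2 < (1 / (real n + 1))\<^sup>2" for n :: nat
    by simp
  then obtain W where W: "\<And>n. W n \<in> wave_dom a" "\<And>n. (nrm (diff (W n) U))\<^sup>2 < (1 / (real n + 1))\<^sup>2" by metis
  show thesis
  proof (rule that[OF W(1)])
    show "(\<lambda>n. nrm (diff (W n) U)) \<longlonglongrightarrow> 0"
    proof (rule Lim_null_comparison)
      show "\<forall>\<^sub>F n in sequentially. norm (nrm (diff (W n) U)) \<le> 1 / (real n + 1)"
        using W(2) by (intro always_eventually allI) (auto intro!: less_imp_le power2_less_imp_less[OF W(2)])
      show "(\<lambda>n. 1 / (real n + 1)) \<longlonglongrightarrow> 0"
        using LIMSEQ_inverse_real_of_nat by (simp add: inverse_eq_divide add.commute)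
    qed
  qed
qed

end

section \<open>The semigroup\<close>

text \<open>Turns a modulus for small positive time steps into two-sided limits at any time
  \<open>t\<close>.\<close>

lemma tendsto_abs_diff_at_right:
  fixes w :: "real \<Rightarrow> real"
  assumes "(w \<longlongrightarrow> 0) (at_right 0)"
  shows "((\<lambda>s. w \<bar>s - t\<bar>) \<longlongrightarrow> 0) (at t within A)"
proof (rule filterlim_compose[OF assms])
  have "((\<lambda>s. \<bar>s - t\<bar>) \<longlongrightarrow> \<bar>t - t\<bar>) (at t within A)" by (intro tendsto_intros)
  then show "filterlim (\<lambda>s. \<bar>s - t\<bar>) (at_right 0) (at t within A)"
    by (auto simp: filterlim_at eventually_at_filter intro!: always_eventually)
qed

locale wave = degenerate +
  fixes S :: "real \<Rightarrow> state \<Rightarrow> state"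
  assumes wave: "wave_semigroup a S"
begin

lemma S_space: "0 \<le> t \<Longrightarrow> U \<in> SS \<Longrightarrow> S t U \<in> SS"
  and S_lincomb: "0 \<le> t \<Longrightarrow> U \<in> SS \<Longrightarrow> V \<in> SS \<Longrightarrow>
    state_eq (S t (lincomb c U d V)) (lincomb c (S t U) d (S t V))"
  and S_norm: "0 \<le> t \<Longrightarrow> U \<in> SS \<Longrightarrow> nrm (S t U) \<le> nrm U"
  and S_zero: "U \<in> SS \<Longrightarrow> state_eq (S 0 U) U"
  and S_add: "0 \<le> s \<Longrightarrow> 0 \<le> t \<Longrightarrow> U \<in> SS \<Longrightarrow> state_eq (S (s + t) U) (S s (S t U))"
  and S_at_0: "U \<in> SS \<Longrightarrow> ((\<lambda>t. nrm (diff (S t U) U)) \<longlongrightarrow> 0) (at_right 0)"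
  using wave unfolding wave_semigroup_def contraction_semigroup_def state_dist_def by blast+

lemma generator_graph_eq: "generator_graph a S = wave_graph a"
  using wave unfolding wave_semigroup_def by blast

lemma S_norm_lincomb:
  assumes "0 \<le> t" "U \<in> SS" "V \<in> SS"
  shows "nrm (lincomb c (S t U) d (S t V)) \<le> nrm (lincomb c U d V)"
proof -
  have "nrm (lincomb c (S t U) d (S t V)) = nrm (S t (lincomb c U d V))"
    using assms by (intro state_norm_cong state_eq_sym[OF S_lincomb] S_space state_space_lincomb)
  also have "\<dots> \<le> nrm (lincomb c U d V)" using assms by (intro S_norm state_space_lincomb)
  finally show ?thesis .
qed

lemma S_norm_diff:
  assumes "0 \<le> s" "0 \<le> t" and V: "V \<in> SS"
  shows "nrm (diff (S s V) (S t V)) \<le> nrm (diff (S \<bar>s - t\<bar> V) V)"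
proof -
  have *: "nrm (diff (S s V) (S t V)) \<le> nrm (diff (S (s - t) V) V)" if t: "0 \<le> t" "t \<le> s" for s t
  proof -
    have "state_eq (S s V) (S t (S (s - t) V))" using S_add[of t "s - t" V] t V by simp
    then have "nrm (diff (S s V) (S t V)) = nrm (diff (S t (S (s - t) V)) (S t V))"
      using t V by (intro state_norm_lincomb_cong S_space) auto
    also have "\<dots> \<le> nrm (diff (S (s - t) V) V)" using t V by (intro S_norm_lincomb S_space) auto
    finally show ?thesis .
  qed
  show ?thesis
  proof (cases "t \<le> s")
    case True
    then show ?thesis using *[OF assms(2) True] by simp
  next
    case False
    then show ?thesis
      using *[of s t] assms state_norm_diff_commute[OF S_space[OF assms(1) V] S_space[OF assms(2) V]] by simp
  qed
qed

lemma S_continuous: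
  assumes "0 \<le> t" "V \<in> SS"
  shows "((\<lambda>s. nrm (diff (S s V) (S t V))) \<longlongrightarrow> 0) (at t within {0..})"
proof (rule Lim_null_comparison)
  show "((\<lambda>s. nrm (diff (S \<bar>s - t\<bar> V) V)) \<longlongrightarrow> 0) (at t within {0..})"
    by (rule tendsto_abs_diff_at_right[OF S_at_0[OF assms(2)]])
  show "\<forall>\<^sub>F s in at t within {0..}. norm (nrm (diff (S s V) (S t V))) \<le> nrm (diff (S \<bar>s - t\<bar> V) V)"
    using S_norm_diff assms by (auto simp: eventually_at_filter intro!: always_eventually)
qed

section \<open>Difference quotients along classical orbits\<close>

abbreviation quotient :: "state \<Rightarrow> real \<Rightarrow> real \<Rightarrow> state" where
  "quotient W s t \<equiv> lincomb (1 / (s - t)) (S s W) (- (1 / (s - t))) (S t W)"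

text \<open>A modulus independent of the base time, obtained from contractivity. The first term
  handles forward quotients; the second pays for moving the base point in backward ones.\<close>

definition quotient_error :: "state \<Rightarrow> real \<Rightarrow> real" where
  "quotient_error W h = nrm (diff (lincomb (1 / h) (S h W) (- (1 / h)) W) (wave_op a W)) +
     nrm (diff (S h (wave_op a W)) (wave_op a W))"

lemma quotient_error_at_0:
  assumes W: "W \<in> wave_dom a"
  shows "(quotient_error W \<longlongrightarrow> 0) (at_right 0)"
proof -
  have "(W, wave_op a W) \<in> wave_graph a"
    using wave_domD[OF W] W unfolding wave_graph_def by (auto intro!: bexI[of _ W])
  then have "((\<lambda>h. nrm (diff (lincomb (1 / h) (S h W) (- (1 / h)) W) (wave_op a W))) \<longlongrightarrow> 0) (at_right 0)"
    unfolding generator_graph_eq[symmetric] generator_graph_def state_dist_def by simp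
  from tendsto_add[OF this S_at_0[OF wave_domD(5)[OF W]]]
  show ?thesis unfolding quotient_error_def by simp
qed

text \<open>For \<open>s > t\<close> the semigroup law factors out \<open>S t\<close>, a
  contraction. For \<open>s < t\<close> the quotient is compared with
  \<open>S s (wave_op a W)\<close>, which is then moved to time \<open>t\<close>.\<close>

lemma quotient_error_bound:
  assumes W: "W \<in> wave_dom a" and st: "0 \<le> s" "0 \<le> t" "s \<noteq> t"
  shows "nrm (diff (quotient W s t) (S t (wave_op a W))) \<le> quotient_error W \<bar>s - t\<bar>"
proof -
  let ?F = "wave_op a W"
  note WS = wave_domD(4)[OF W] and FS = wave_domD(5)[OF W]
  have *: "nrm (diff (quotient W s t) (S t ?F)) \<le> nrm (diff (lincomb (1 / (s - t)) (S (s - t) W) (- (1 / (s - t))) W) ?F)"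
    if t: "0 \<le> t" "t < s" for s t
  proof -
    let ?h = "s - t"
    let ?D = "lincomb (1 / ?h) (S ?h W) (- (1 / ?h)) W"
    have S: "S s W \<in> SS" "S t W \<in> SS" "S ?h W \<in> SS" "S t (S ?h W) \<in> SS" "S t ?F \<in> SS" "?D \<in> SS" "S t ?D \<in> SS"
      using t WS FS by (auto intro!: S_space state_space_lincomb)
    have "state_eq (S s W) (S t (S ?h W))" using S_add[of t "s - t" W] t WS by simp
    then have "state_eq (quotient W s t) (lincomb (1 / ?h) (S t (S ?h W)) (- (1 / ?h)) (S t W))"
      by (intro state_eq_lincomb) auto
    also have "state_eq \<dots> (S t ?D)"
      using t WS S by (intro state_eq_sym[OF S_lincomb]) auto
    finally (state_eq_trans) have "nrm (diff (quotient W s t) (S t ?F)) = nrm (diff (S t ?D) (S t ?F))"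
      using S by (intro state_norm_lincomb_cong state_space_lincomb) auto
    also have "\<dots> \<le> nrm (diff ?D ?F)" using t S FS by (intro S_norm_lincomb) auto
    finally show ?thesis .
  qed
  show ?thesis
  proof (cases "t < s")
    case True
    then show ?thesis using *[OF st(2) True] by (simp add: quotient_error_def add_increasing2)
  next
    case False
    then have ts: "s < t" using st by simp
    have eq: "quotient W s t = quotient W t s"
      using ts by (simp add: lincomb_def field_simps minus_divide_left[symmetric] minus_divide_right)
    have S: "quotient W t s \<in> SS" "S s ?F \<in> SS" "S t ?F \<in> SS"
      using st WS FS by (auto intro!: S_space state_space_lincomb)
    have "nrm (diff (quotient W t s) (S t ?F)) \<le> nrm (diff (quotient W t s) (S s ?F)) + nrm (diff (S s ?F) (S t ?F))"
      by (rule state_norm_triangle[OF S])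
    then show ?thesis
      using *[OF st(1) ts] S_norm_diff[OF st(1,2) FS] ts unfolding eq quotient_error_def by simp
  qed
qed

text \<open>The difference quotients of \<open>S t W\<close> converge to
  \<open>S t (wave_op a W)\<close>, so this pair lies in the generator graph. That graph equals
  \<open>wave_graph a\<close>, which is closed under almost everywhere equality and supplies the
  representative \<open>Z\<close>.\<close>

lemma domain_invariant:
  assumes W: "W \<in> wave_dom a" and t: "0 \<le> t"
  obtains Z where "Z \<in> wave_dom a" "state_eq (S t W) Z" "state_eq (S t (wave_op a W)) (wave_op a Z)"
proof -
  let ?F = "wave_op a W"
  note WS = wave_domD(4)[OF W] and FS = wave_domD(5)[OF W]
  have "((\<lambda>h. nrm (diff (lincomb (1 / h) (S h (S t W)) (- (1 / h)) (S t W)) (S t ?F))) \<longlongrightarrow> 0) (at_right 0)"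
  proof (rule Lim_null_comparison[OF _ quotient_error_at_0[OF W]])
    have "nrm (diff (lincomb (1 / h) (S h (S t W)) (- (1 / h)) (S t W)) (S t ?F)) \<le> quotient_error W h" if h: "0 < h" for h
    proof -
      have S: "S h (S t W) \<in> SS" "S (h + t) W \<in> SS" "S t W \<in> SS" "S t ?F \<in> SS"
        using h t WS FS by (auto intro!: S_space)
      have "state_eq (S h (S t W)) (S (h + t) W)" using S_add[of h t W] h t WS by (auto intro: state_eq_sym)
      then have "state_eq (lincomb (1 / h) (S h (S t W)) (- (1 / h)) (S t W)) (quotient W (h + t) t)"
        unfolding add_diff_cancel_right' by (intro state_eq_lincomb state_eq_refl)
      then have "nrm (diff (lincomb (1 / h) (S h (S t W)) (- (1 / h)) (S t W)) (S t ?F)) = nrm (diff (quotient W (h + t) t) (S t ?F))"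
        using S by (intro state_norm_lincomb_cong state_space_lincomb state_eq_refl)
      also have "\<dots> \<le> quotient_error W \<bar>h + t - t\<bar>" using h t by (intro quotient_error_bound[OF W]) auto
      finally show ?thesis using h by simp
    qed
    then show "\<forall>\<^sub>F h in at_right 0. norm (nrm (diff (lincomb (1 / h) (S h (S t W)) (- (1 / h)) (S t W)) (S t ?F))) \<le> quotient_error W h"
      by (auto simp: eventually_at_filter intro!: always_eventually)
  qed
  then have "(S t W, S t ?F) \<in> wave_graph a"
    unfolding generator_graph_eq[symmetric] generator_graph_def state_dist_def
    using t WS FS by (auto intro!: S_space)
  then show thesis using that unfolding wave_graph_def by auto
qed

text \<open>The product rule, with convergence of the quotients in norm and boundedness of the form.
  Derivatives are taken within \<open>{0..}\<close> because orbits exist for nonnegative times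
  only.\<close>

lemma bounded_form_DERIV:
  assumes b: "bounded_form b" and W: "W \<in> wave_dom a" and t: "0 \<le> t"
  shows "((\<lambda>s. b (S s W) (S s W)) has_real_derivative
    b (S t (wave_op a W)) (S t W) + b (S t W) (S t (wave_op a W))) (at t within {0..})"
  unfolding has_field_derivative_iff
proof (rule Lim_transform_within[where d = 1])
  let ?F = "wave_op a W"
  note WS = wave_domD(4)[OF W] and FS = wave_domD(5)[OF W]
  obtain C where C: "C \<ge> 0" "\<And>U V. U \<in> SS \<Longrightarrow> V \<in> SS \<Longrightarrow> \<bar>b U V\<bar> \<le> C * (nrm U * nrm V)"
    using b unfolding bounded_form_def by blast
  have lin: "b (lincomb c U d V) Y = c * b U Y + d * b V Y" "b Y (lincomb c U d V) = c * b Y U + d * b Y V"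
    if "U \<in> SS" "V \<in> SS" "Y \<in> SS" for c U d V Y
    using b that unfolding bounded_form_def by blast+
  \<comment> \<open>The usual splitting: the increment of one argument is paired with the other
    argument at time \<open>s\<close> in the first term and at time \<open>t\<close> in the
    second.\<close>
  let ?q = "\<lambda>s. b (quotient W s t) (S s W) + b (S t W) (quotient W s t)"
  let ?L = "b (S t ?F) (S t W) + b (S t W) (S t ?F)"
  let ?e = "\<lambda>s. C * (2 * nrm W * quotient_error W \<bar>s - t\<bar> + nrm ?F * nrm (diff (S s W) (S t W)))"
  have "(?e \<longlongrightarrow> C * (2 * nrm W * 0 + nrm ?F * 0)) (at t within {0..})"
    by (intro tendsto_intros tendsto_abs_diff_at_right quotient_error_at_0[OF W] S_continuous t WS)
  then have e0: "(?e \<longlongrightarrow> 0) (at t within {0..})" by simp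
  have "((\<lambda>s. ?q s - ?L) \<longlongrightarrow> 0) (at t within {0..})"
  proof (rule Lim_null_comparison[OF _ e0])
    have "norm (?q s - ?L) \<le> ?e s" if s: "0 \<le> s" "s \<noteq> t" for s
    proof -
      let ?D = "diff (quotient W s t) (S t ?F)" and ?X = "diff (S s W) (S t W)"
      have S: "S s W \<in> SS" "S t W \<in> SS" "S t ?F \<in> SS" "quotient W s t \<in> SS" "?D \<in> SS" "?X \<in> SS"
        using s t WS FS by (auto intro!: S_space state_space_lincomb)
      have D: "nrm ?D \<le> quotient_error W \<bar>s - t\<bar>" by (rule quotient_error_bound[OF W s(1) t s(2)])
      have qe: "0 \<le> quotient_error W \<bar>s - t\<bar>" by (simp add: quotient_error_def)
      have "b ?D (S s W) = b (quotient W s t) (S s W) - b (S t ?F) (S s W)"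
        "b (S t ?F) ?X = b (S t ?F) (S s W) - b (S t ?F) (S t W)"
        "b (S t W) ?D = b (S t W) (quotient W s t) - b (S t W) (S t ?F)"
        using lin[OF S(4,3,1), of 1 "-1"] lin[OF S(1,2,3), of 1 "-1"] lin[OF S(4,3,2), of 1 "-1"] by simp_all
      then have "norm (?q s - ?L) \<le> \<bar>b ?D (S s W)\<bar> + \<bar>b (S t ?F) ?X\<bar> + \<bar>b (S t W) ?D\<bar>"
        unfolding real_norm_def by linarith
      also have "\<dots> \<le> C * (nrm ?D * nrm (S s W)) + C * (nrm (S t ?F) * nrm ?X) + C * (nrm (S t W) * nrm ?D)"
        using S by (intro add_mono C(2))
      also have "\<dots> \<le> C * (quotient_error W \<bar>s - t\<bar> * nrm W) + C * (nrm ?F * nrm ?X) + C * (nrm W * quotient_error W \<bar>s - t\<bar>)"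
        using C(1) s t WS FS by (intro add_mono mult_left_mono mult_mono D S_norm qe) auto
      finally show ?thesis by (simp add: algebra_simps)
    qed
    then show "\<forall>\<^sub>F s in at t within {0..}. norm (?q s - ?L) \<le> ?e s"
      by (auto simp: eventually_at_filter intro!: always_eventually)
  qed
  then show "(?q \<longlongrightarrow> ?L) (at t within {0..})" by (simp add: LIM_zero_iff)
  show "?q s = (b (S s W) (S s W) - b (S t W) (S t W)) / (s - t)" if "s \<in> {0..}" "0 < dist s t" for s
  proof -
    have S: "S s W \<in> SS" "S t W \<in> SS" using that t WS by (auto intro!: S_space)
    have "c * x + - c * y + (c * y + - c * z) = c * (x - z)" for c x y z :: real
      by (simp add: algebra_simps)
    then have "?q s = 1 / (s - t) * (b (S s W) (S s W) - b (S t W) (S t W))"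
      unfolding lin(1)[OF S S(1)] lin(2)[OF S S(2)] by blast
    then show ?thesis by simp
  qed
qed simp

text \<open>Contractivity gives only an inequality; equality comes from the skewness of the wave
  operator, evaluated on a representative in the domain.\<close>

lemma energy_conservation:
  assumes W: "W \<in> wave_dom a" and t: "0 \<le> t"
  shows "nrm (S t W) = nrm W"
proof -
  note WS = wave_domD(4)[OF W] and FS = wave_domD(5)[OF W]
  have "((\<lambda>s. ip (S s W) (S s W)) has_real_derivative 0) (at t within {0..})" if t: "t \<in> {0..}" for t
  proof -
    have t0: "0 \<le> t" using t by simp
    obtain Z where Z: "Z \<in> wave_dom a" "state_eq (S t W) Z" "state_eq (S t (wave_op a W)) (wave_op a Z)"
      by (rule domain_invariant[OF W t0])
    have "ip (S t (wave_op a W)) (S t W) = ip (wave_op a Z) Z"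
      using t0 WS FS Z wave_domD[OF Z(1)] by (intro bounded_form_cong[OF bounded_form_inner] S_space)
    also have "\<dots> = 0" by (rule wave_op_skew[OF Z(1)])
    finally show ?thesis
      using bounded_form_DERIV[OF bounded_form_inner W t0] by (simp add: state_inner_commute[of "S t W"])
  qed
  then obtain c where c: "\<And>t. t \<in> {0..} \<Longrightarrow> ip (S t W) (S t W) = c"
    using has_field_derivative_zero_constant[of "{0::real..}" "\<lambda>s. ip (S s W) (S s W)"] by auto
  have "nrm (S t W) = nrm (S 0 W)" using c[of t] c[of 0] t by (simp add: state_norm_def)
  also have "\<dots> = nrm W" using WS by (intro state_norm_cong S_zero S_space) auto
  finally show ?thesis .
qed

subsection \<open>The normal trace of classical solutions\<close>

lemma classical_trace_eq:
  assumes W: "W \<in> wave_dom a" and t: "0 \<le> t" and Z: "Z \<in> wave_dom a" "state_eq (S t W) Z"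
  shows "classical_trace S W t = trace Z"
  unfolding classical_trace_def
  using t by (intro trace_cong state_eq_fst[OF _ _ Z(2)] S_space wave_domD W Z(1)) auto

text \<open>Bounds the trace by the geometric mean of the norm and the graph norm, so that it is
  continuous along orbits on which \<open>wave_op\<close> stays bounded.\<close>

lemma trace_square_le:
  obtains C where "C \<ge> 0"
    "\<And>Z. Z \<in> wave_dom a \<Longrightarrow> a 1 / 2 * (trace Z)\<^sup>2 \<le> C * nrm (wave_op a Z) * nrm Z + 2 * (nrm Z)\<^sup>2"
proof -
  obtain C where C: "C \<ge> 0" "\<And>U V. U \<in> SS \<Longrightarrow> V \<in> SS \<Longrightarrow> \<bar>multiplier U V\<bar> \<le> C * (nrm U * nrm V)"
    using bounded_form_multiplier unfolding bounded_form_def by blast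
  show thesis
  proof (rule that[of "2 * C"])
    fix Z assume Z: "Z \<in> wave_dom a"
    note ZD = wave_domD(4,5)[OF Z]
    obtain R where "a 1 / 2 * (trace Z)\<^sup>2 = multiplier (wave_op a Z) Z + multiplier Z (wave_op a Z) + R"
      "R \<le> 2 * (nrm Z)\<^sup>2"
      by (rule multiplier_identity[OF Z])
    moreover have "multiplier (wave_op a Z) Z \<le> C * (nrm (wave_op a Z) * nrm Z)"
      "multiplier Z (wave_op a Z) \<le> C * (nrm Z * nrm (wave_op a Z))"
      using C(2)[OF ZD(2,1)] C(2)[OF ZD] by linarith+
    ultimately show "a 1 / 2 * (trace Z)\<^sup>2 \<le> 2 * C * nrm (wave_op a Z) * nrm Z + 2 * (nrm Z)\<^sup>2"
      by (simp add: algebra_simps)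
  qed (use C(1) in simp)
qed

text \<open>\<open>trace_square_le\<close> is applied to the difference of two points of the orbit:
  its image under \<open>wave_op\<close> stays bounded by \<open>2 * nrm ?F\<close> while its norm
  tends to 0. Continuity provides measurability in time.\<close>

lemma classical_trace_continuous:
  assumes W: "W \<in> wave_dom a"
  shows "continuous_on {0..} (classical_trace S W)"
  unfolding continuous_on_def
proof
  fix t :: real assume t: "t \<in> {0..}"
  let ?F = "wave_op a W" and ?g = "classical_trace S W"
  note WS = wave_domD(4)[OF W] and FS = wave_domD(5)[OF W]
  obtain C where C: "C \<ge> 0"
    "\<And>Z. Z \<in> wave_dom a \<Longrightarrow> a 1 / 2 * (trace Z)\<^sup>2 \<le> C * nrm (wave_op a Z) * nrm Z + 2 * (nrm Z)\<^sup>2"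
    by (rule trace_square_le, rule that)
  let ?d = "\<lambda>s. nrm (diff (S s W) (S t W))"
  have bound: "a 1 / 2 * (?g s - ?g t)\<^sup>2 \<le> C * (2 * nrm ?F) * ?d s + 2 * (?d s)\<^sup>2" if s: "0 \<le> s" for s
  proof -
    have t0: "0 \<le> t" using t by simp
    obtain Y where Y: "Y \<in> wave_dom a" "state_eq (S s W) Y" "state_eq (S s ?F) (wave_op a Y)"
      by (rule domain_invariant[OF W s])
    obtain Z where Z: "Z \<in> wave_dom a" "state_eq (S t W) Z" "state_eq (S t ?F) (wave_op a Z)"
      by (rule domain_invariant[OF W t0])
    have S: "S s W \<in> SS" "S t W \<in> SS" "S s ?F \<in> SS" "S t ?F \<in> SS" using s t0 WS FS by (auto intro!: S_space)
    note YZ = wave_dom_lincomb[OF Y(1) Z(1), of 1 "-1"]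
    have "?g s - ?g t = trace (diff Y Z)"
      using classical_trace_eq[OF W s Y(1,2)] classical_trace_eq[OF W t0 Z(1,2)] trace_lincomb[OF Y(1) Z(1), of 1 "-1"] by simp
    moreover have "nrm (diff Y Z) = ?d s"
      by (rule state_norm_lincomb_cong[OF wave_domD(4)[OF Y(1)] S(1) wave_domD(4)[OF Z(1)] S(2)
            state_eq_sym[OF Y(2)] state_eq_sym[OF Z(2)]])
    moreover have "nrm (wave_op a (diff Y Z)) \<le> 2 * nrm ?F"
    proof -
      have "state_eq (wave_op a (diff Y Z)) (diff (wave_op a Y) (wave_op a Z))" by (rule wave_op_lincomb[OF Y(1) Z(1)])
      also have "state_eq \<dots> (diff (S s ?F) (S t ?F))" by (rule state_eq_lincomb[OF state_eq_sym[OF Y(3)] state_eq_sym[OF Z(3)]])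
      finally (state_eq_trans) have "nrm (wave_op a (diff Y Z)) = nrm (diff (S s ?F) (S t ?F))"
        using S by (intro state_norm_cong wave_domD(5)[OF YZ] state_space_lincomb)
      also have "\<dots> \<le> nrm (S s ?F) + nrm (S t ?F)" using state_norm_lincomb[OF S(3,4), of 1 "-1"] by simp
      also have "\<dots> \<le> 2 * nrm ?F" using S_norm[OF s FS] S_norm[OF t0 FS] by simp
      finally show ?thesis .
    qed
    then have "C * nrm (wave_op a (diff Y Z)) * nrm (diff Y Z) \<le> C * (2 * nrm ?F) * nrm (diff Y Z)"
      using C(1) by (intro mult_right_mono mult_left_mono) auto
    ultimately show ?thesis using C(2)[OF YZ] by simp
  qed
  have t0: "0 \<le> t" using t by simp
  have "((\<lambda>s. sqrt (2 / a 1 * (C * (2 * nrm ?F) * ?d s + 2 * (?d s)\<^sup>2))) \<longlongrightarrow> sqrt (2 / a 1 * (C * (2 * nrm ?F) * 0 + 2 * 0\<^sup>2))) (at t within {0..})"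
    by (intro tendsto_intros S_continuous t0 WS)
  then have lim: "((\<lambda>s. sqrt (2 / a 1 * (C * (2 * nrm ?F) * ?d s + 2 * (?d s)\<^sup>2))) \<longlongrightarrow> 0) (at t within {0..})" by simp
  have "((\<lambda>s. ?g s - ?g t) \<longlongrightarrow> 0) (at t within {0..})"
  proof (rule Lim_null_comparison[OF _ lim])
    have "norm (?g s - ?g t) \<le> sqrt (2 / a 1 * (C * (2 * nrm ?F) * ?d s + 2 * (?d s)\<^sup>2))" if "0 \<le> s" for s
    proof (rule real_le_rsqrt)
      show "(norm (?g s - ?g t))\<^sup>2 \<le> 2 / a 1 * (C * (2 * nrm ?F) * ?d s + 2 * (?d s)\<^sup>2)"
        using mult_left_mono[OF bound[OF that], of "2 / a 1"] a_1_pos by simp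
    qed
    then show "\<forall>\<^sub>F s in at t within {0..}. norm (?g s - ?g t) \<le> sqrt (2 / a 1 * (C * (2 * nrm ?F) * ?d s + 2 * (?d s)\<^sup>2))"
      by (auto simp: eventually_at_filter intro!: always_eventually)
  qed
  then show "(?g \<longlongrightarrow> ?g t) (at t within {0..})" by (simp add: LIM_zero_iff)
qed

lemma classical_trace_L2:
  assumes W: "W \<in> wave_dom a"
  shows "classical_trace S W \<in> L2 T"
proof -
  have c: "continuous_on {0..T} (classical_trace S W)"
    by (rule continuous_on_subset[OF classical_trace_continuous[OF W]]) auto
  obtain B where B: "\<And>t. t \<in> {0..T} \<Longrightarrow> \<bar>classical_trace S W t\<bar> \<le> B"
    by (rule continuous_on_Icc_bounded[OF c], rule that)
  have m: "classical_trace S W \<in> borel_measurable (lebesgue_on {0<..<T})"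
    by (rule continuous_on_measurable_lebesgue_on[OF continuous_on_subset[OF c]]) auto
  show ?thesis
  proof (rule L2_bounded[OF m])
    show "\<bar>classical_trace S W t\<bar> \<le> B" if "t \<in> {0<..<T}" for t
      using that by (intro B) simp
  qed
qed

lemma classical_trace_diff:
  assumes V: "V \<in> wave_dom a" and W: "W \<in> wave_dom a" and t: "0 \<le> t"
  shows "classical_trace S (diff V W) t = classical_trace S V t - classical_trace S W t"
proof -
  obtain Y where Y: "Y \<in> wave_dom a" "state_eq (S t V) Y" by (rule domain_invariant[OF V t])
  obtain Z where Z: "Z \<in> wave_dom a" "state_eq (S t W) Z" by (rule domain_invariant[OF W t])
  have "state_eq (S t (diff V W)) (diff (S t V) (S t W))"
    using t wave_domD(4) V W by (intro S_lincomb) auto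
  also have "state_eq \<dots> (diff Y Z)" using Y Z by (intro state_eq_lincomb)
  finally (state_eq_trans) have "state_eq (S t (diff V W)) (diff Y Z)" .
  then have "classical_trace S (diff V W) t = trace (diff Y Z)"
    by (rule classical_trace_eq[OF wave_dom_lincomb[OF V W] t wave_dom_lincomb[OF Y(1) Z(1)]])
  also have "\<dots> = trace Y - trace Z" using trace_lincomb[OF Y(1) Z(1), of 1 "-1"] by simp
  finally show ?thesis
    using classical_trace_eq[OF V t Y] classical_trace_eq[OF W t Z] by simp
qed

text \<open>Twice the constant of \<open>multiplier_self_bound\<close>, hence a bound for the
  difference of the functional between times 0 and \<open>T\<close>, relative to the squared
  norm.\<close>

definition boundary_const :: real where
  "boundary_const = 1 / min 1 (a 1) + mu a / 2 * sqrt (poincare_const a)"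

text \<open>The first part is the observability inequality for classical solutions, the second the
  hidden regularity that gives mild solutions a trace.\<close>

lemma classical_trace_bounds:
  assumes W: "W \<in> wave_dom a" and T: "0 \<le> T"
  shows "a 1 * (LINT t|lebesgue_on {0<..<T}. (classical_trace S W t)\<^sup>2) \<ge>
      ((1 - mu a / 2) * T - 2 * boundary_const) * (nrm W)\<^sup>2"
    and "a 1 * (LINT t|lebesgue_on {0<..<T}. (classical_trace S W t)\<^sup>2) \<le>
      (4 * T + 2 * boundary_const) * (nrm W)\<^sup>2"
proof -
  let ?F = "wave_op a W" and ?g = "classical_trace S W"
  note WS = wave_domD(4)[OF W] and FS = wave_domD(5)[OF W]
  let ?Q = "\<lambda>t. multiplier (S t W) (S t W)"
  let ?Q' = "\<lambda>t. multiplier (S t ?F) (S t W) + multiplier (S t W) (S t ?F)"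
  \<comment> \<open>The gauge integral recovers a function from its derivative, so no regularity of
    \<open>?Q'\<close> in time is needed.\<close>
  have Q': "(?Q' has_integral ?Q T - ?Q 0) {0..T}"
  proof (rule fundamental_theorem_of_calculus[OF T])
    fix t assume t: "t \<in> {0..T}"
    have "(?Q has_real_derivative ?Q' t) (at t within {0..})"
      using t by (intro bounded_form_DERIV[OF bounded_form_multiplier W]) auto
    then have "(?Q has_real_derivative ?Q' t) (at t within {0..T})"
      by (rule has_field_derivative_subset) auto
    then show "(?Q has_vector_derivative ?Q' t) (at t within {0..T})"
      by (simp add: has_real_derivative_iff_has_vector_derivative)
  qed
  let ?I = "LINT t|lebesgue_on {0<..<T}. (?g t)\<^sup>2"
  have g: "((\<lambda>t. a 1 / 2 * (?g t)\<^sup>2) has_integral a 1 / 2 * ?I) {0..T}"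
  proof (rule has_integral_mult_right)
    show "((\<lambda>t. (?g t)\<^sup>2) has_integral ?I) {0..T}"
      unfolding has_integral_Icc_iff_Ioo
      by (rule has_integral_integral_lebesgue_on[OF L2_integrable[OF classical_trace_L2[OF W]]]) simp
  qed
  have pt: "?Q' t + (1 / 2 - mu a / 4) * (nrm W)\<^sup>2 \<le> a 1 / 2 * (?g t)\<^sup>2 \<and>
      a 1 / 2 * (?g t)\<^sup>2 \<le> ?Q' t + 2 * (nrm W)\<^sup>2" if t: "t \<in> {0..T}" for t
  proof -
    have t0: "0 \<le> t" using t by simp
    obtain Z where Z: "Z \<in> wave_dom a" "state_eq (S t W) Z" "state_eq (S t ?F) (wave_op a Z)"
      by (rule domain_invariant[OF W t0])
    note ZD = wave_domD(4,5)[OF Z(1)]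
    have S: "S t W \<in> SS" "S t ?F \<in> SS" using t0 WS FS by (auto intro!: S_space)
    obtain R where R: "a 1 / 2 * (trace Z)\<^sup>2 = multiplier (wave_op a Z) Z + multiplier Z (wave_op a Z) + R"
      "(1 / 2 - mu a / 4) * (nrm Z)\<^sup>2 \<le> R" "R \<le> 2 * (nrm Z)\<^sup>2"
      by (rule multiplier_identity[OF Z(1)])
    have "multiplier (S t ?F) (S t W) = multiplier (wave_op a Z) Z"
      by (rule bounded_form_cong[OF bounded_form_multiplier S(2) ZD(2) S(1) ZD(1) Z(3,2)])
    moreover have "multiplier (S t W) (S t ?F) = multiplier Z (wave_op a Z)"
      by (rule bounded_form_cong[OF bounded_form_multiplier S(1) ZD(1) S(2) ZD(2) Z(2,3)])
    moreover have "nrm Z = nrm W"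
      using state_norm_cong[OF S(1) ZD(1) Z(2)] energy_conservation[OF W t0] by simp
    ultimately show ?thesis using R unfolding classical_trace_eq[OF W t0 Z(1,2)] by simp
  qed
  have Qb: "\<bar>?Q t\<bar> \<le> 1 / 2 * boundary_const * (nrm W)\<^sup>2" if "0 \<le> t" for t
    using multiplier_self_bound[OF S_space[OF that WS]] energy_conservation[OF W that]
    by (simp add: boundary_const_def)
  have Q2: "\<bar>?Q T - ?Q 0\<bar> \<le> boundary_const * (nrm W)\<^sup>2"
  proof -
    have "\<bar>p - q\<bar> \<le> c * d" if "\<bar>p\<bar> \<le> 1 / 2 * c * d" "\<bar>q\<bar> \<le> 1 / 2 * c * d" for p q c d :: real
      using that by (simp add: abs_if split: if_splits)
    from this[OF Qb[OF T] Qb[OF order_refl]] show ?thesis .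
  qed
  have lower: "2 * (A - B) \<le> e * x" if "q + A \<le> e / 2 * x" "\<bar>q\<bar> \<le> B" for q A B e x :: real
    using that by (simp add: abs_if split: if_splits)
  have upper: "e * x \<le> 2 * (A + B)" if "e / 2 * x \<le> q + A" "\<bar>q\<bar> \<le> B" for q A B e x :: real
    using that by (simp add: abs_if split: if_splits)
  have const: "((\<lambda>t. c) has_integral T * c) {0..T}" for c :: real
    using has_integral_const_real[of c 0 T] T by simp
  have "(?Q T - ?Q 0) + T * ((1 / 2 - mu a / 4) * (nrm W)\<^sup>2) \<le> a 1 / 2 * ?I"
    by (rule has_integral_le[OF has_integral_add[OF Q' const] g]) (use pt in blast)
  from lower[OF this Q2]
  show "a 1 * ?I \<ge> ((1 - mu a / 2) * T - 2 * boundary_const) * (nrm W)\<^sup>2"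
    by (simp add: algebra_simps)
  have "a 1 / 2 * ?I \<le> (?Q T - ?Q 0) + T * (2 * (nrm W)\<^sup>2)"
    by (rule has_integral_le[OF g has_integral_add[OF Q' const]]) (use pt in blast)
  from upper[OF this Q2]
  show "a 1 * ?I \<le> (4 * T + 2 * boundary_const) * (nrm W)\<^sup>2"
    by (simp add: algebra_simps)
qed

section \<open>Observability\<close>

lemma classical_trace_diff_LINT_le:
  assumes V: "V \<in> wave_dom a" and W: "W \<in> wave_dom a" and T: "0 \<le> T"
  shows "(LINT t|lebesgue_on {0<..<T}. (classical_trace S V t - classical_trace S W t)\<^sup>2) \<le>
    (4 * T + 2 * boundary_const) / a 1 * (nrm (diff V W))\<^sup>2"
proof -
  have "(LINT t|lebesgue_on {0<..<T}. (classical_trace S V t - classical_trace S W t)\<^sup>2) =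
      (LINT t|lebesgue_on {0<..<T}. (classical_trace S (diff V W) t)\<^sup>2)"
    by (intro Bochner_Integration.integral_cong refl) (simp add: classical_trace_diff[OF V W])
  then show ?thesis
    using classical_trace_bounds(2)[OF wave_dom_lincomb[OF V W] T, of 1 "-1"] a_1_pos
    by (simp add: field_simps)
qed

text \<open>\<open>normal_trace\<close> is a choice and says something only if a trace exists.
  Density provides an approximating sequence, the upper trace bound makes its traces Cauchy, and
  comparison with this fixed sequence shows that every other one has the same limit.\<close>

lemma normal_trace_exists:
  assumes U: "U \<in> SS" and T: "0 \<le> T"
  shows "\<exists>g. is_normal_trace a S T U g"
proof -
  let ?M = "lebesgue_on {0<..<T}" and ?g = "classical_trace S"
  define K where "K = (4 * T + 2 * boundary_const) / a 1"
  have K: "K \<ge> 0"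
    using T a_1_pos mu_nonneg poincare_const_pos by (simp add: K_def boundary_const_def)
  obtain W where W: "\<And>n :: nat. W n \<in> wave_dom a" "(\<lambda>n. nrm (diff (W n) U)) \<longlonglongrightarrow> 0"
    by (rule wave_dom_dense[OF U], rule that)
  have le: "(LINT t|?M. (?g V t - ?g V' t)\<^sup>2) \<le> K * (nrm (diff V U) + nrm (diff V' U))\<^sup>2"
    if V: "V \<in> wave_dom a" "V' \<in> wave_dom a" for V V'
  proof -
    note VS = wave_domD(4)[OF V(1)] wave_domD(4)[OF V(2)]
    have "(LINT t|?M. (?g V t - ?g V' t)\<^sup>2) \<le> K * (nrm (diff V V'))\<^sup>2"
      unfolding K_def by (rule classical_trace_diff_LINT_le[OF V T])
    also have "\<dots> \<le> K * (nrm (diff V U) + nrm (diff V' U))\<^sup>2"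
      using state_norm_triangle[OF VS(1) U VS(2)] state_norm_diff_commute[OF VS(2) U] K
      by (intro mult_left_mono power_mono) auto
    finally show ?thesis .
  qed
  obtain g where g: "g \<in> L2 T" "(\<lambda>n. LINT t|?M. (?g (W n) t - g t)\<^sup>2) \<longlonglongrightarrow> 0"
  proof (rule L2_complete[of "\<lambda>n. ?g (W n)" T])
    show "?g (W n) \<in> L2 T" for n by (rule classical_trace_L2[OF W(1)])
    fix e :: real assume e: "e > 0"
    \<comment> \<open>Solves \<open>4 * (K + 1) * d^2 = e\<close>; the added 1 gives strictness,
      also when \<open>K = 0\<close>.\<close>
    define d where "d = sqrt (e / (4 * (K + 1)))"
    have d: "d > 0" using e K by (simp add: d_def)
    obtain m where m: "\<And>n. n \<ge> m \<Longrightarrow> nrm (diff (W n) U) < d"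
      using LIMSEQ_D[OF W(2) d] by auto
    have "(LINT t|?M. (?g (W i) t - ?g (W j) t)\<^sup>2) < e" if ij: "i \<ge> m" "j \<ge> m" for i j
    proof -
      have "(LINT t|?M. (?g (W i) t - ?g (W j) t)\<^sup>2) \<le> K * (nrm (diff (W i) U) + nrm (diff (W j) U))\<^sup>2"
        by (rule le[OF W(1) W(1)])
      also have "\<dots> \<le> K * (d + d)\<^sup>2"
        using m[OF ij(1)] m[OF ij(2)] K by (intro mult_left_mono power_mono add_mono) auto
      also have "\<dots> = 4 * K * d\<^sup>2" by (simp add: power2_eq_square)
      also have "\<dots> < 4 * (K + 1) * d\<^sup>2" using d by simp
      also have "\<dots> = e" using e K by (simp add: d_def)
      finally show ?thesis .
    qed
    then show "\<exists>m. \<forall>i\<ge>m. \<forall>j\<ge>m. (LINT t|?M. (?g (W i) t - ?g (W j) t)\<^sup>2) < e" by blast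
  qed (rule that)
  have "is_normal_trace a S T U g"
    unfolding is_normal_trace_def
  proof (intro conjI allI impI g(1))
    fix V :: "nat \<Rightarrow> state"
    assume "(\<forall>n. V n \<in> wave_dom a) \<and> (\<lambda>n. state_dist a (V n) U) \<longlonglongrightarrow> 0"
    then have V: "\<And>n. V n \<in> wave_dom a" "(\<lambda>n. nrm (diff (V n) U)) \<longlonglongrightarrow> 0"
      by (auto simp: state_dist_def)
    show VL: "?g (V n) \<in> L2 T" for n by (rule classical_trace_L2[OF V(1)])
    have lim: "(\<lambda>n. 2 * (K * (nrm (diff (V n) U) + nrm (diff (W n) U))\<^sup>2) + 2 * (LINT t|?M. (?g (W n) t - g t)\<^sup>2)) \<longlonglongrightarrow> 2 * (K * (0 + 0)\<^sup>2) + 2 * 0"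
      by (intro tendsto_intros V W g)
    show "(\<lambda>n. LINT t|?M. (?g (V n) t - g t)\<^sup>2) \<longlonglongrightarrow> 0"
    proof (rule Lim_null_comparison)
      have "norm (LINT t|?M. (?g (V n) t - g t)\<^sup>2) \<le>
          2 * (K * (nrm (diff (V n) U) + nrm (diff (W n) U))\<^sup>2) + 2 * (LINT t|?M. (?g (W n) t - g t)\<^sup>2)" for n
      proof -
        have WL: "?g (W n) \<in> L2 T" by (rule classical_trace_L2[OF W(1)])
        have "(LINT t|?M. (?g (V n) t - g t)\<^sup>2) = (LINT t|?M. ((?g (V n) t - ?g (W n) t) + (?g (W n) t - g t))\<^sup>2)"
          by simp
        also have "\<dots> \<le> 2 * (LINT t|?M. (?g (V n) t - ?g (W n) t)\<^sup>2) + 2 * (LINT t|?M. (?g (W n) t - g t)\<^sup>2)"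
          by (rule LINT_square_add_le[OF L2_diff[OF VL WL] L2_diff[OF WL g(1)]])
        finally show ?thesis using le[OF V(1) W(1), of n n] by simp
      qed
      then show "\<forall>\<^sub>F n in sequentially. norm (LINT t|?M. (?g (V n) t - g t)\<^sup>2) \<le>
          2 * (K * (nrm (diff (V n) U) + nrm (diff (W n) U))\<^sup>2) + 2 * (LINT t|?M. (?g (W n) t - g t)\<^sup>2)"
        by simp
      show "(\<lambda>n. 2 * (K * (nrm (diff (V n) U) + nrm (diff (W n) U))\<^sup>2) + 2 * (LINT t|?M. (?g (W n) t - g t)\<^sup>2)) \<longlonglongrightarrow> 0"
        using lim by simp
    qed
  qed
  then show ?thesis by blast
qed

lemma L2_norm_tendsto:
  assumes f: "\<And>n :: nat. f n \<in> L2 T" and g: "g \<in> L2 T"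
    and lim: "(\<lambda>n. LINT t|lebesgue_on {0<..<T}. (f n t - g t)\<^sup>2) \<longlonglongrightarrow> 0"
  shows "(\<lambda>n. LINT t|lebesgue_on {0<..<T}. (f n t)\<^sup>2) \<longlonglongrightarrow> (LINT t|lebesgue_on {0<..<T}. (g t)\<^sup>2)"
proof -
  let ?M = "lebesgue_on {0<..<T}"
  let ?d = "\<lambda>n. LINT t|?M. (f n t - g t)\<^sup>2" and ?G = "LINT t|?M. (g t)\<^sup>2"
  have dL: "(\<lambda>t. f n t - g t) \<in> L2 T" for n by (rule L2_diff[OF f g])
  have eq: "(LINT t|?M. (f n t)\<^sup>2) - ?G = ?d n + 2 * (LINT t|?M. (f n t - g t) * g t)" for n
  proof -
    have "(LINT t|?M. (f n t)\<^sup>2) = (LINT t|?M. ((f n t - g t)\<^sup>2 + 2 * ((f n t - g t) * g t)) + (g t)\<^sup>2)"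
      by (simp add: power2_eq_square algebra_simps)
    also have "\<dots> = ?d n + 2 * (LINT t|?M. (f n t - g t) * g t) + ?G"
      using L2_integrable[OF dL] L2_mult_integrable[OF dL g] L2_integrable[OF g]
      by (simp add: Bochner_Integration.integral_add)
    finally show ?thesis by simp
  qed
  have "(\<lambda>n. ?d n + 2 * sqrt (?d n * ?G)) \<longlonglongrightarrow> 0 + 2 * sqrt (0 * ?G)" by (intro tendsto_intros lim)
  then have lim': "(\<lambda>n. ?d n + 2 * sqrt (?d n * ?G)) \<longlonglongrightarrow> 0" by simp
  have "(\<lambda>n. (LINT t|?M. (f n t)\<^sup>2) - ?G) \<longlonglongrightarrow> 0"
  proof (rule Lim_null_comparison[OF _ lim'])
    have "norm ((LINT t|?M. (f n t)\<^sup>2) - ?G) \<le> ?d n + 2 * sqrt (?d n * ?G)" for n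
    proof -
      have "\<bar>LINT t|?M. (f n t - g t) * g t\<bar> \<le> sqrt (?d n * ?G)"
        using L2_Cauchy_Schwarz[OF dL g] by (intro real_le_rsqrt) simp
      moreover have "0 \<le> ?d n" by simp
      ultimately show ?thesis unfolding eq real_norm_def by linarith
    qed
    then show "\<forall>\<^sub>F n in sequentially. norm ((LINT t|?M. (f n t)\<^sup>2) - ?G) \<le> ?d n + 2 * sqrt (?d n * ?G)" by simp
  qed
  then show ?thesis by (simp add: LIM_zero_iff)
qed

lemma normal_trace_lower_bound:
  assumes U: "U \<in> SS" and T: "0 \<le> T"
  shows "a 1 * (LINT t|lebesgue_on {0<..<T}. (normal_trace a S T U t)\<^sup>2) \<ge>
      ((1 - mu a / 2) * T - 2 * boundary_const) * (nrm U)\<^sup>2"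
proof -
  have nt: "is_normal_trace a S T U (normal_trace a S T U)"
    unfolding normal_trace_def using normal_trace_exists[OF U T] by (rule someI_ex)
  obtain W where W: "\<And>n :: nat. W n \<in> wave_dom a" "(\<lambda>n. nrm (diff (W n) U)) \<longlonglongrightarrow> 0"
    by (rule wave_dom_dense[OF U], rule that)
  have g: "normal_trace a S T U \<in> L2 T"
    "(\<lambda>n. LINT t|lebesgue_on {0<..<T}. (classical_trace S (W n) t - normal_trace a S T U t)\<^sup>2) \<longlonglongrightarrow> 0"
    using nt W unfolding is_normal_trace_def state_dist_def by blast+
  have "(\<lambda>n. nrm (W n) - nrm U) \<longlonglongrightarrow> 0"
    by (rule Lim_null_comparison[OF _ W(2)]) (use state_norm_diff_bound[OF wave_domD(4)[OF W(1)] U] in simp)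
  then have n: "(\<lambda>n. nrm (W n)) \<longlonglongrightarrow> nrm U" by (simp add: LIM_zero_iff)
  show ?thesis
  proof (rule LIMSEQ_le)
    show "(\<lambda>n. ((1 - mu a / 2) * T - 2 * boundary_const) * (nrm (W n))\<^sup>2) \<longlonglongrightarrow>
        ((1 - mu a / 2) * T - 2 * boundary_const) * (nrm U)\<^sup>2"
      by (intro tendsto_intros n)
    show "(\<lambda>n. a 1 * (LINT t|lebesgue_on {0<..<T}. (classical_trace S (W n) t)\<^sup>2)) \<longlonglongrightarrow>
        a 1 * (LINT t|lebesgue_on {0<..<T}. (normal_trace a S T U t)\<^sup>2)"
      by (intro tendsto_intros L2_norm_tendsto[OF classical_trace_L2[OF W(1)] g])
    show "\<exists>m. \<forall>n\<ge>m. ((1 - mu a / 2) * T - 2 * boundary_const) * (nrm (W n))\<^sup>2 \<le>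
        a 1 * (LINT t|lebesgue_on {0<..<T}. (classical_trace S (W n) t)\<^sup>2)"
      using classical_trace_bounds(1)[OF W(1) T] by blast
  qed
qed

lemma energy_0:
  assumes U: "U \<in> SS" shows "energy a S U 0 = 1 / 2 * (nrm U)\<^sup>2"
proof -
  have "energy a S U 0 = 1 / 2 * ip (S 0 U) (S 0 U)"
    by (simp add: energy_def state_inner_def power2_eq_square mult.assoc)
  also have "\<dots> = 1 / 2 * (nrm U)\<^sup>2"
    using state_norm_cong[OF S_space[OF order_refl U] U S_zero[OF U]] by (simp add: state_norm_square[symmetric])
  finally show ?thesis .
qed

lemma observability_constantI:
  assumes T: "T > observability_time a"
  shows "T > 0"
    and "observability_constant a S T
      (1 / a 1 * ((2 - mu a) * T - 4 / min 1 (a 1) - 2 * mu a * sqrt (poincare_const a)))"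
proof -
  let ?k = "(2 - mu a) * T - 4 / min 1 (a 1) - 2 * mu a * sqrt (poincare_const a)"
  have "0 < 4 / min 1 (a 1) + 2 * mu a * sqrt (poincare_const a)"
    using a_1_pos mu_nonneg poincare_const_pos by (intro add_pos_nonneg) auto
  then have "0 < observability_time a"
    unfolding observability_time_def using mu_less_2 by simp
  then show T0: "T > 0" using T by simp
  have "4 / min 1 (a 1) + 2 * mu a * sqrt (poincare_const a) < (2 - mu a) * T"
    using T mu_less_2 unfolding observability_time_def by (simp add: field_simps)
  then have k: "?k > 0" by simp
  have "(LINT t|lebesgue_on {0<..<T}. (normal_trace a S T U t)\<^sup>2) \<ge> 1 / a 1 * ?k * energy a S U 0"
    if U: "U \<in> SS" for U
  proof -
    \<comment> \<open>\<open>?k\<close> is twice the factor on the right, because the energy is half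
      the squared norm; the hypothesis on \<open>T\<close> says exactly that \<open>?k\<close> is
      positive.\<close>
    have "?k * energy a S U 0 = ((1 - mu a / 2) * T - 2 * boundary_const) * (nrm U)\<^sup>2"
      unfolding energy_0[OF U] boundary_const_def by (simp add: field_simps)
    also have "\<dots> \<le> a 1 * (LINT t|lebesgue_on {0<..<T}. (normal_trace a S T U t)\<^sup>2)"
      using normal_trace_lower_bound[OF U] T0 by simp
    finally show ?thesis using a_1_pos by (simp add: field_simps)
  qed
  with k a_1_pos show "observability_constant a S T (1 / a 1 * ?k)"
    unfolding observability_constant_def by simp
qed

end

theorem corollary3p5:
  fixes a :: "real \<Rightarrow> real" and S :: "real \<Rightarrow> state \<Rightarrow> state" and T :: real
  assumes "degenerate_coefficient a"
    and "wave_semigroup a S"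
    and "T > observability_time a"
  shows "observable a S T \<and>
    best_constant a S T \<ge>
      ereal (1 / a 1 * ((2 - mu a) * T - 4 / min 1 (a 1) - 2 * mu a * sqrt (poincare_const a)))"
proof -
  interpret wave a S by unfold_locales (fact assms)+
  show ?thesis
    using observability_constantI[OF assms(3)]
    unfolding observable_def best_constant_def by (blast intro: SUP_upper)
qed

end
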